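(* Let $s=\{s_n;n\in\mathbb{N}_0^d\}$ be a positive semi-definite $d$-sequence, where $d\ge 3$. Suppose that for arbitrary $j\in\{1,\dots,d-1\}$ and arbitrary numbers $k_1,\dots,k_{j-1},k_{j+1},\dots,k_d\in 2\mathbb{N}_0$ the $1$-sequence $$\{s_{(k_1,\dots,k_{j-1},n,k_{j+1},\dots,k_{d-1},k_d+2)}+s_{(k_1,\dots,k_{j-1},n,k_{j+1},\dots,k_{d-1},k_d)};\ n\in\mathbb{N}_0\}$$ is determinate. Further, suppose that for all $j,l\in\{1,\dots,d-1\}$ with $j<l$, all sequences of (at least) one of the following two sets of $1$-sequences, indexed over $n\in\mathbb{N}_0$, are determinate: the set of all $$\{s_{(k_1,\dots,k_{j-1},n,k_{j+1},\dots,k_{l-1},k_l+2,k_{l+1},\dots,k_d)}+s_{(k_1,\dots,k_{j-1},n,k_{j+1},\dots,k_{l-1},k_l,k_{l+1},\dots,k_d)}\},$$ or the set of all $$\{s_{(k_1,\dots,k_{j-1},k_j+2,k_{j+1},\dots,k_{l-1},n,k_{l+1},\dots,k_d)}+s_{(k_1,\dots,k_{j-1},k_j,k_{j+1},\dots,k_{l-1},n,k_{l+1},\dots,k_d)}\},$$ where $k_1,\dots,k_d$ range over $2\mathbb{N}_0$. Then the $d$-sequence $s$ is a moment sequence. If in addition the $1$-sequence $\{s_{(0,\dots,0,n)};n\in\mathbb{N}_0\}$ is determinate, then $s$ is also determinate.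
   Context: $\mathbb{N}_0=\{0,1,2,\dots\}$. A $d$-sequence $s=\{s_\alpha;\alpha\in\mathbb{N}_0^d\}$ is positive semi-definite if $\sum_{\alpha,\beta}s_{\alpha+\beta}\xi_\alpha\overline{\xi_\beta}\ge0$ for every finitely supported complex sequence $\{\xi_\alpha;\alpha\in\mathbb{N}_0^d\}$. $\mathcal{M}(\mathbb{R}^d)$ is the set of positive Borel measures on $\mathbb{R}^d$ having all moments finite. A $d$-sequence $s$ is a moment sequence if there is $\mu\in\mathcal{M}(\mathbb{R}^d)$ with $s_\alpha=\int x^\alpha\,d\mu(x)$ for all $\alpha\in\mathbb{N}_0^d$; it is determinate if there is exactly one such measure $\mu\in\mathcal{M}(\mathbb{R}^d)$. For $1$-sequences the same definitions are used with $d=1$. *)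

theory Defs
  imports "HOL-Analysis.Analysis"
begin

text \<open>
  A d-sequence is a function on multi-indices \<open>nat ^ 'd\<close> with \<open>CARD('d) = d\<close>. It is allowed to
  have complex values; positive semi-definiteness as well as being a moment sequence forces
  them to be real.
\<close>

definition positive_semidefinite :: "(nat ^ 'd::finite \<Rightarrow> complex) \<Rightarrow> bool" where
  "positive_semidefinite s \<longleftrightarrow>
     (\<forall>\<xi> :: nat ^ 'd \<Rightarrow> complex. finite {\<alpha>. \<xi> \<alpha> \<noteq> 0} \<longrightarrow>
        (\<Sum>\<alpha> | \<xi> \<alpha> \<noteq> 0. \<Sum>\<beta> | \<xi> \<beta> \<noteq> 0. s (\<alpha> + \<beta>) * \<xi> \<alpha> * cnj (\<xi> \<beta>)) \<in> \<real>\<^sub>\<ge>\<^sub>0)"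

definition monomial :: "nat ^ 'd::finite \<Rightarrow> real ^ 'd \<Rightarrow> real" where
  "monomial \<alpha> x = (\<Prod>i\<in>UNIV. (x $ i) ^ (\<alpha> $ i))"

text \<open>Finiteness of the measures themselves is the case \<open>\<alpha> = 0\<close>.\<close>

definition moment_measures :: "(real ^ 'd::finite) measure set" where
  "moment_measures = {M. sets M = sets borel \<and> (\<forall>\<alpha>. integrable M (monomial \<alpha>))}"

definition represents :: "(real ^ 'd::finite) measure \<Rightarrow> (nat ^ 'd \<Rightarrow> complex) \<Rightarrow> bool" where
  "represents M s \<longleftrightarrow>
     M \<in> moment_measures \<and> (\<forall>\<alpha>. s \<alpha> = complex_of_real (\<integral>x. monomial \<alpha> x \<partial>M))"

definition moment_sequence :: "(nat ^ 'd::finite \<Rightarrow> complex) \<Rightarrow> bool" where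
  "moment_sequence s \<longleftrightarrow> (\<exists>M. represents M s)"

definition determinate :: "(nat ^ 'd::finite \<Rightarrow> complex) \<Rightarrow> bool" where
  "determinate s \<longleftrightarrow> (\<exists>!M. represents M s)"

text \<open>The case \<open>d = 1\<close>, with \<open>nat\<close> identified with \<open>nat ^ 1\<close>.\<close>

definition determinate1 :: "(nat \<Rightarrow> complex) \<Rightarrow> bool" where
  "determinate1 t \<longleftrightarrow> determinate (\<lambda>\<alpha> :: nat ^ 1. t (\<alpha> $ 1))"

definition upd :: "nat ^ 'd::finite \<Rightarrow> 'd \<Rightarrow> nat \<Rightarrow> nat ^ 'd" where
  "upd k j n = (\<chi> i. if i = j then n else k $ i)"

text \<open>
  \<open>shifted_sum s k l j\<close> is the 1-sequence whose \<open>n\<close>-th term is the sum of the values of \<open>s\<close> at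
  \<open>k\<close> with the \<open>j\<close>-th entry replaced by \<open>n\<close>, once with \<open>l\<close>-th entry \<open>k $ l + 2\<close> and once with
  \<open>l\<close>-th entry \<open>k $ l\<close>. It is used for \<open>j \<noteq> l\<close> only, and does not depend on \<open>k $ j\<close>.
\<close>

definition shifted_sum ::
    "(nat ^ 'd::finite \<Rightarrow> complex) \<Rightarrow> nat ^ 'd \<Rightarrow> 'd \<Rightarrow> 'd \<Rightarrow> nat \<Rightarrow> complex" where
  "shifted_sum s k l j n = s (upd (upd k l (k $ l + 2)) j n) + s (upd k j n)"

end

theory Submission
  imports Defs "HOL-Library.Poly_Mapping" "HOL-Computational_Algebra.Fundamental_Theorem_Algebra"
begin

text \<open>
  Let \<open>L\<close> be the functional on polynomials with \<open>L(x\<^sup>\<alpha>) = s\<^sub>\<alpha>\<close>, and let \<open>e\<close> be the last index. By a sharpened form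
  of M. Riesz' theorem, a determinate 1-sequence admits polynomials \<open>w\<close> with \<open>w(\<i>) = 1\<close> and arbitrarily
  small norm. The hypotheses therefore say that \<open>(X\<^sub>j + \<i>)\<close> has dense range in the graph norm of \<open>X\<^sub>e\<close>,
  and that \<open>(X\<^sub>j + \<i>)(X\<^sub>l + \<i>)\<close> has dense range, for \<open>j\<close>, \<open>l\<close> different from \<open>e\<close>. Hence the Cayley transforms
  \<open>U\<^sub>j\<close> of the \<open>X\<^sub>j\<close> with \<open>j \<noteq> e\<close> are commuting isometries which commute with \<open>X\<^sub>e\<close>. A nonnegative polynomial, divided
  by a power of \<open>\<Prod>\<^sub>j (1 + x\<^sub>j\<^sup>2)\<close>, is a trigonometric polynomial in the \<open>U\<^sub>j\<close> with coefficients in \<open>\<complex>[x\<^sub>e]\<close>; replacing it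
  by Fejer means over a finite grid of the torus turns it into a sum of squares, since at every node it is a
  nonnegative polynomial in \<open>x\<^sub>e\<close> alone. So \<open>L\<close> is nonnegative on nonnegative polynomials, and Haviland's theorem
  gives a representing measure. If moreover the last marginal is determinate, then every resolvent \<open>(x\<^sub>j + \<i>)\<^sup>-\<^sup>1\<close> is a
  limit of polynomials in \<open>L\<^sup>2\<close> of every representing measure, and Petersen's argument gives uniqueness.
\<close>

section \<open>A space filling curve\<close>

text \<open>For existence nothing is known about 1-sequences running in the direction
  \<open>e\<close>, so \<open>X_e\<close> is never inverted: only the other variables pass to Cayley
  transforms, while \<open>x_e\<close> stays a polynomial variable. This is affordable because a
  nonnegative polynomial in one real variable is \<open>\<tau> * conj_poly \<tau>\<close>; in
  several variables a nonnegative polynomial need not be a sum of squares. The first group of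
  hypotheses is used in the graph norm because density in the plain norm would define the
  \<open>U_j\<close> but would not yield their commutation with \<open>X_e\<close>. In the second
  group either alternative serves: both lead to density of the range of
  \<open>(X_j + i)(X_l + i)\<close>, which is symmetric in \<open>j\<close> and \<open>l\<close>,
  and on it \<open>U_j U_l = U_l U_j\<close> is an identity of polynomials. Averaging over a finite
  grid instead of the torus allows a factor \<open>\<tau>\<close> to be chosen at each node
  separately, without any question of measurability; a grid finer than the occurring frequencies
  keeps orthogonality exact. The measure is built on the line, from a distribution function, since
  the positive functional then has to be extended to countably many indicators only.\<close>

definition hat :: "real \<Rightarrow> real" where
  "hat t = max 0 (min 1 (1 / 2 - cos (pi * t)))"

lemma hat_bounds: "0 \<le> hat t" "hat t \<le> 1"
  by (auto simp: hat_def)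

lemma continuous_on_hat: "continuous_on S hat"
  unfolding hat_def by (intro continuous_intros)

lemma hat_add_even: "hat (2 * of_int m + t) = hat t"
proof -
  have "cos (pi * (2 * of_int m + t)) = cos (pi * t)"
    using cos_int_2pin[of m] sin_int_2pin[of m] by (simp add: distrib_left cos_add mult.assoc mult.left_commute)
  then show ?thesis by (simp add: hat_def)
qed

lemma hat_eq_0: assumes "0 \<le> t" "t \<le> 1 / 3" shows "hat t = 0"
proof -
  have "cos (pi / 3) \<le> cos (pi * t)"
    by (rule cos_monotone_0_pi_le) (use assms in \<open>auto simp: field_simps\<close>)
  then show ?thesis by (simp add: hat_def cos_60)
qed

lemma hat_eq_1: assumes "2 / 3 \<le> t" "t \<le> 1" shows "hat t = 1"
proof -
  have "cos (pi * t) \<le> cos (2 * pi / 3)"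
    by (rule cos_monotone_0_pi_le) (use assms in \<open>auto simp: field_simps\<close>)
  then show ?thesis by (simp add: hat_def cos_120)
qed

text \<open>The point of the Cantor set whose ternary digits are 0 and 2 in place of the binary
  digits \<open>b\<close>.\<close>

definition digit_stretch :: "(nat \<Rightarrow> bool) \<Rightarrow> real" where
  "digit_stretch b = suminf (\<lambda>i. of_bool (b i) * 2 / 3 ^ Suc i)"

lemma digit_stretch_sums: "summable (\<lambda>i. of_bool (b i) * 2 / 3 ^ Suc i :: real)"
proof (rule summable_comparison_test')
  show "summable (\<lambda>i. 2 / 3 * (1 / 3 :: real) ^ i)"
    by (intro summable_mult summable_geometric) simp
  show "norm (of_bool (b i) * 2 / 3 ^ Suc i :: real) \<le> 2 / 3 * (1 / 3) ^ i" if "0 \<le> i" for i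
    by (simp add: power_divide)
qed

lemma digit_stretch_bounds: "0 \<le> digit_stretch b" "digit_stretch b \<le> 1"
proof -
  show "0 \<le> digit_stretch b"
    unfolding digit_stretch_def by (intro suminf_nonneg digit_stretch_sums) auto
  have g: "(\<lambda>i. 2 / 3 * (1 / 3 :: real) ^ i) sums (2 / 3 * (1 / (1 - 1 / 3)))"
    by (intro sums_mult geometric_sums) simp
  have "digit_stretch b \<le> suminf (\<lambda>i. 2 / 3 * (1 / 3 :: real) ^ i)"
    unfolding digit_stretch_def
    by (intro suminf_le digit_stretch_sums sums_summable[OF g]) (auto simp: power_divide)
  also have "\<dots> = 1" using sums_unique[OF g] by simp
  finally show "digit_stretch b \<le> 1" .
qed

lemma digit_stretch_Suc:
  "3 * digit_stretch b = of_bool (b 0) * 2 + digit_stretch (\<lambda>i. b (Suc i))"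
proof -
  have "digit_stretch b = of_bool (b 0) * 2 / 3 + suminf (\<lambda>i. of_bool (b (Suc i)) * 2 / 3 ^ Suc (Suc i))"
    using suminf_split_head[OF digit_stretch_sums[of b]] unfolding digit_stretch_def by simp
  also have "suminf (\<lambda>i. of_bool (b (Suc i)) * 2 / 3 ^ Suc (Suc i) :: real) = suminf (\<lambda>i. (1/3) * (of_bool (b (Suc i)) * 2 / 3 ^ Suc i))"
    by (intro arg_cong[where f = suminf]) (auto simp: field_simps)
  also have "\<dots> = 1 / 3 * digit_stretch (\<lambda>i. b (Suc i))"
    unfolding digit_stretch_def by (rule suminf_mult[OF digit_stretch_sums])
  finally show ?thesis by simp
qed

text \<open>Multiplication by \<open>3 ^ k\<close> moves digit \<open>k\<close> to the front, up to
  an even integer, which \<open>hat\<close> ignores. A leading ternary digit 0 puts the rest into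
  [0, 1/3], a 2 into [2/3, 1]; these are the plateaus of \<open>hat\<close>.\<close>

lemma hat_digit_stretch: "hat (3 ^ k * digit_stretch b) = of_bool (b k)"
proof -
  have "\<exists>m::int. 3 ^ k * digit_stretch b = 2 * of_int m + digit_stretch (\<lambda>i. b (i + k))"
  proof (induction k)
    case (Suc k)
    then obtain m :: int where m: "3 ^ k * digit_stretch b = 2 * of_int m + digit_stretch (\<lambda>i. b (i + k))" by blast
    have "3 ^ Suc k * digit_stretch b = 3 * (3 ^ k * digit_stretch b)" by simp
    also have "\<dots> = 6 * of_int m + 3 * digit_stretch (\<lambda>i. b (i + k))" by (simp add: m)
    also have "\<dots> = 2 * of_int (3 * m + of_bool (b k)) + digit_stretch (\<lambda>i. b (i + Suc k))"
      by (subst digit_stretch_Suc) simp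
    finally show ?case by blast
  qed (auto intro: exI[of _ 0])
  then obtain m :: int where m: "3 ^ k * digit_stretch b = 2 * of_int m + digit_stretch (\<lambda>i. b (i + k))" by blast
  show ?thesis
    unfolding m hat_add_even
    using digit_stretch_Suc[of "\<lambda>i. b (i + k)"] digit_stretch_bounds[of "\<lambda>i. b (Suc i + k)"]
    by (cases "b k") (auto intro!: hat_eq_0 hat_eq_1)
qed

lemma ex_binary_digits:
  assumes "0 \<le> y" "y < (1::real)"
  shows "\<exists>b. (\<lambda>i. of_bool (b i) / 2 ^ Suc i) sums y"
proof
  let ?b = "\<lambda>i. odd \<lfloor>2 ^ Suc i * y\<rfloor>"
  \<comment> \<open>Truncation after \<open>n\<close> digits is the floor of
    \<open>2 ^ n * y\<close> over \<open>2 ^ n\<close>; the start \<open>n = 0\<close> is where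
    \<open>y < 1\<close> enters.\<close>
  have part: "(\<Sum>i<n. of_bool (?b i) / 2 ^ Suc i :: real) = of_int \<lfloor>2 ^ n * y\<rfloor> / 2 ^ n" for n
  proof (induction n)
    case (Suc n)
    have half: "\<lfloor>2 ^ Suc n * y\<rfloor> div 2 = \<lfloor>2 ^ n * y\<rfloor>"
      using floor_divide_real_eq_div[of 2 "2 ^ Suc n * y"] by simp
    have "real_of_int \<lfloor>2 ^ Suc n * y\<rfloor> = of_int (2 * (\<lfloor>2 ^ Suc n * y\<rfloor> div 2) + \<lfloor>2 ^ Suc n * y\<rfloor> mod 2)"
      by simp
    also have "\<dots> = 2 * of_int \<lfloor>2 ^ n * y\<rfloor> + of_bool (?b n)"
      unfolding half by (simp add: mod_2_eq_odd)
    finally have "real_of_int \<lfloor>2 ^ Suc n * y\<rfloor> = 2 * of_int \<lfloor>2 ^ n * y\<rfloor> + of_bool (?b n)" .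
    then show ?case unfolding sum.lessThan_Suc Suc by (simp add: add_divide_distrib)
  qed (use assms in \<open>simp add: floor_eq_iff\<close>)
  have "(\<lambda>n. of_int \<lfloor>2 ^ n * y\<rfloor> / 2 ^ n) \<longlonglongrightarrow> y"
  proof (rule tendsto_sandwich[where f = "\<lambda>n. y - (1/2) ^ n" and h = "\<lambda>n. y"])
    have "y - (1/2) ^ n \<le> of_int \<lfloor>2 ^ n * y\<rfloor> / 2 ^ n" for n
    proof -
      have "2 ^ n * y - 1 \<le> of_int \<lfloor>2 ^ n * y\<rfloor>" by linarith
      then have "(2 ^ n * y - 1) / 2 ^ n \<le> of_int \<lfloor>2 ^ n * y\<rfloor> / 2 ^ n" by (rule divide_right_mono) simp
      then show ?thesis by (simp add: diff_divide_distrib power_one_over)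
    qed
    then show "\<forall>\<^sub>F n in sequentially. y - (1/2) ^ n \<le> of_int \<lfloor>2 ^ n * y\<rfloor> / 2 ^ n" by simp
    have "of_int \<lfloor>2 ^ n * y\<rfloor> / 2 ^ n \<le> y" for n
      by (simp add: field_simps)
    then show "\<forall>\<^sub>F n in sequentially. of_int \<lfloor>2 ^ n * y\<rfloor> / 2 ^ n \<le> y" by simp
    have "(\<lambda>n. y - (1/2) ^ n) \<longlonglongrightarrow> y - 0"
      by (intro tendsto_intros LIMSEQ_power_zero) simp
    then show "(\<lambda>n. y - (1/2) ^ n) \<longlonglongrightarrow> y" by simp
  qed simp
  then show "(\<lambda>i. of_bool (?b i) / 2 ^ Suc i) sums y"
    unfolding sums_def part .
qed

text \<open>\<open>prod_encode\<close> distributes the ternary digits of one parameter over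
  countably many coordinates, so that these can be prescribed independently.\<close>

definition schoenberg :: "nat \<Rightarrow> real \<Rightarrow> real" where
  "schoenberg j t = suminf (\<lambda>i. hat (3 ^ prod_encode (i, j) * t) / 2 ^ Suc i)"

lemma continuous_on_schoenberg: "continuous_on UNIV (schoenberg j)"
proof -
  have "uniform_limit UNIV (\<lambda>n t. \<Sum>i<n. hat (3 ^ prod_encode (i, j) * t) / 2 ^ Suc i) (schoenberg j) sequentially"
    unfolding schoenberg_def[abs_def]
  proof (rule Weierstrass_m_test)
    show "norm (hat (3 ^ prod_encode (n, j) * x) / 2 ^ Suc n) \<le> (1/2) ^ Suc n" for n x
      using hat_bounds[of "3 ^ prod_encode (n, j) * x"] by (simp add: power_divide divide_simps)
    show "summable (\<lambda>n. (1/2 :: real) ^ Suc n)"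
      by (subst summable_Suc_iff) (intro summable_geometric, simp)
  qed
  then show ?thesis
    by (rule uniform_limit_theorem[rotated])
       (auto intro!: always_eventually continuous_intros continuous_on_compose2[OF continuous_on_hat[of UNIV]])
qed

lemma schoenberg_periodic: "schoenberg j (2 * of_nat n + t) = schoenberg j t"
proof -
  have "hat (3 ^ k * (2 * of_nat n + t)) = hat (3 ^ k * t)" for k
    using hat_add_even[of "3 ^ k * int n" "3 ^ k * t"] by (simp add: distrib_left mult.left_commute)
  then show ?thesis by (simp add: schoenberg_def)
qed

lemma schoenberg_surj:
  assumes "\<And>j. 0 \<le> y j \<and> y j < 1"
  shows "\<exists>t. 0 \<le> t \<and> t \<le> 1 \<and> (\<forall>j. schoenberg j t = y j)"
proof -
  have "\<forall>j. \<exists>b. (\<lambda>i. of_bool (b i) / 2 ^ Suc i) sums y j"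
    using ex_binary_digits assms by blast
  then obtain b where b: "\<And>j. (\<lambda>i. of_bool (b j i) / 2 ^ Suc i) sums y j" by metis
  define c where "c k = (case prod_decode k of (i, j) \<Rightarrow> b j i)" for k
  have "schoenberg j (digit_stretch c) = y j" for j
    unfolding schoenberg_def hat_digit_stretch using sums_unique[OF b[of j]]
    by (simp add: c_def)
  then show ?thesis using digit_stretch_bounds[of c] by blast
qed

text \<open>A continuous staircase: constantly \<open>n\<close> on [2n, 2n + 1], an interval on
  which the Schoenberg curve already reaches every point needed, and climbing to
  \<open>n + 1\<close> on [2n + 1, 2n + 2].\<close>

definition amplitude :: "real \<Rightarrow> real" where
  "amplitude s = s / 2 - arccos (cos (pi * s)) / (2 * pi)"

lemma continuous_on_amplitude: "continuous_on S amplitude"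
  unfolding amplitude_def by (intro continuous_intros) auto

lemma amplitude_eq: assumes "0 \<le> t" "t \<le> 1" shows "amplitude (2 * of_nat n + t) = of_nat n"
proof -
  have "cos (pi * (2 * of_nat n + t)) = cos (pi * t)"
    using cos_int_2pin[of n] sin_int_2pin[of n] by (simp add: distrib_left cos_add mult.assoc mult.left_commute)
  moreover have "arccos (cos (pi * t)) = pi * t"
    by (rule arccos_cos) (use assms in auto)
  ultimately show ?thesis by (simp add: amplitude_def field_simps)
qed

text \<open>The coefficient \<open>amplitude\<close> makes the periodic Schoenberg curve sweep larger and larger cubes,
  so that a point can be reached at a parameter comparable with its norm.\<close>

lemma space_filling:
  obtains \<Phi> :: "real \<Rightarrow> real ^ 'd::finite"
  where "continuous_on UNIV \<Phi>" "\<And>x. \<exists>s\<ge>0. s \<le> 2 * norm x + 5 \<and> \<Phi> s = x"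
proof
  define h :: "'d \<Rightarrow> nat" where "h = (SOME h. inj h)"
  have "\<exists>h :: 'd \<Rightarrow> nat. inj h" using finite_imp_inj_to_nat_seg[of "UNIV :: 'd set"] by auto
  then have h: "inj h" unfolding h_def by (rule someI_ex)
  define \<Phi> :: "real \<Rightarrow> real ^ 'd" where "\<Phi> s = (\<chi> j. amplitude s * (2 * schoenberg (h j) s - 1))" for s
  show "continuous_on UNIV \<Phi>" unfolding \<Phi>_def
    by (intro continuous_intros continuous_on_amplitude continuous_on_schoenberg)
  fix x :: "real ^ 'd"
  \<comment> \<open>Strictly larger than \<open>norm x\<close>, so that every rescaled coordinate is
    below 1 and has binary digits in the sense of \<open>ex_binary_digits\<close>.\<close>
  define r where "r = nat \<lfloor>norm x\<rfloor> + 1"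
  have r: "norm x < r" "r \<le> norm x + 1" "r > 0" unfolding r_def by (auto simp: floor_less_iff) linarith
  have xr: "\<bar>x $ j\<bar> < r" for j using component_le_norm_cart[of x j] r by linarith
  define y where "y k = (if k \<in> range h then (x $ (inv h k) / r + 1) / 2 else 0)" for k
  have "0 \<le> y k \<and> y k < 1" for k
    using xr[of "inv h k"] r by (auto simp: y_def field_simps abs_less_iff)
  then obtain t where t: "0 \<le> t" "t \<le> 1" "\<And>j. schoenberg j t = y j" using schoenberg_surj by blast
  have "\<Phi> (2 * of_nat r + t) = x"
  proof (rule vec_eq_iff[THEN iffD2], intro allI)
    fix i
    have "\<Phi> (2 * of_nat r + t) $ i = r * (2 * ((x $ i / r + 1) / 2) - 1)"
      unfolding \<Phi>_def vec_lambda_beta amplitude_eq[OF t(1,2)] schoenberg_periodic t(3)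
      using h by (simp add: y_def)
    then show "\<Phi> (2 * of_nat r + t) $ i = x $ i" using r by (simp add: field_simps)
  qed
  then show "\<exists>s\<ge>0. s \<le> 2 * norm x + 5 \<and> \<Phi> s = x"
    using t r by (intro exI[of _ "2 * of_nat r + t"]) auto
qed

section \<open>Positive linear functionals, given by their graphs\<close>

text \<open>A functional is kept as a set of pairs, so that extension is inclusion and a chain of
  extensions has its union as limit. Together with positivity the graph is single-valued, since two
  values at one function differ by a value at zero.\<close>

definition linear_graph :: "(('a \<Rightarrow> real) \<times> real) set \<Rightarrow> bool" where
  "linear_graph G \<longleftrightarrow> (\<forall>f a g b c d. (f, a) \<in> G \<longrightarrow> (g, b) \<in> G \<longrightarrow>
     ((\<lambda>x. c * f x + d * g x), c * a + d * b) \<in> G)"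

text \<open>The set \<open>C\<close> is the whole space for functionals on \<open>real ^ 'd\<close>;
  on the line it consists of the curve parameters that are comparable with the norm of the point
  reached.\<close>

definition positive_on :: "'a set \<Rightarrow> (('a \<Rightarrow> real) \<times> real) set \<Rightarrow> bool" where
  "positive_on C G \<longleftrightarrow> (\<forall>f a. (f, a) \<in> G \<longrightarrow> (\<forall>x\<in>C. 0 \<le> f x) \<longrightarrow> 0 \<le> a)"

definition adjoin :: "(('a \<Rightarrow> real) \<times> real) set \<Rightarrow> ('a \<Rightarrow> real) \<Rightarrow> real \<Rightarrow> (('a \<Rightarrow> real) \<times> real) set" where
  "adjoin G h \<alpha> = {((\<lambda>x. f x + t * h x), a + t * \<alpha>) |f a t. (f, a) \<in> G}"

lemma linear_graphD:
  "linear_graph G \<Longrightarrow> (f, a) \<in> G \<Longrightarrow> (g, b) \<in> G \<Longrightarrow> ((\<lambda>x. c * f x + d * g x), c * a + d * b) \<in> G"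
  by (simp add: linear_graph_def)

lemma linear_graph_scale:
  assumes "linear_graph G" "(f, a) \<in> G" shows "((\<lambda>x. c * f x), c * a) \<in> G"
  using linear_graphD[OF assms(1,2,2), of c 0] by simp

lemma linear_graph_diff:
  assumes "linear_graph G" "(f, a) \<in> G" "(g, b) \<in> G" shows "((\<lambda>x. f x - g x), a - b) \<in> G"
  using linear_graphD[OF assms, of 1 "-1"] by simp

lemma linear_graph_sum:
  assumes G: "linear_graph G" "G \<noteq> {}" and "finite I" "\<And>i. i \<in> I \<Longrightarrow> (f i, a i) \<in> G"
  shows "((\<lambda>x. \<Sum>i\<in>I. c i * f i x), \<Sum>i\<in>I. c i * a i) \<in> G"
  using assms(3,4)
proof (induction I)
  case empty
  obtain f a where "(f, a) \<in> G" using G(2) by auto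
  from linear_graph_scale[OF G(1) this, of 0] show ?case by simp
next
  case (insert i I)
  then show ?case using linear_graphD[OF G(1), of "f i" "a i" _ _ "c i" 1] by simp
qed

lemma positive_onD: "positive_on C G \<Longrightarrow> (f, a) \<in> G \<Longrightarrow> (\<And>x. x \<in> C \<Longrightarrow> 0 \<le> f x) \<Longrightarrow> 0 \<le> a"
  by (auto simp: positive_on_def)

lemma positive_on_mono:
  assumes "positive_on C G" "linear_graph G" "(f, a) \<in> G" "(g, b) \<in> G" "\<And>x. x \<in> C \<Longrightarrow> f x \<le> g x"
  shows "a \<le> b"
  using positive_onD[OF assms(1) linear_graph_diff[OF assms(2,4,3)]] assms(5) by auto

lemma subset_adjoin: "G \<subseteq> adjoin G h \<alpha>"
proof
  fix p assume "p \<in> G"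
  then show "p \<in> adjoin G h \<alpha>"
    unfolding adjoin_def by (cases p) (force intro: exI[of _ "0 :: real"])
qed

lemma adjoin_self: assumes "linear_graph G" "G \<noteq> {}" shows "(h, \<alpha>) \<in> adjoin G h \<alpha>"
proof -
  have "((\<lambda>_. 0), 0) \<in> G" using linear_graph_sum[OF assms, of "{}"] by simp
  then show ?thesis unfolding adjoin_def by (force intro: exI[of _ "1 :: real"])
qed

lemma linear_graph_adjoin: assumes "linear_graph G" shows "linear_graph (adjoin G h \<alpha>)"
  unfolding linear_graph_def
proof (intro allI impI)
  fix f a g b c d
  assume "(f, a) \<in> adjoin G h \<alpha>" "(g, b) \<in> adjoin G h \<alpha>"
  then obtain f' a' t g' b' u where f: "(f', a') \<in> G" "f = (\<lambda>x. f' x + t * h x)" "a = a' + t * \<alpha>"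
    and g: "(g', b') \<in> G" "g = (\<lambda>x. g' x + u * h x)" "b = b' + u * \<alpha>" unfolding adjoin_def by auto
  show "((\<lambda>x. c * f x + d * g x), c * a + d * b) \<in> adjoin G h \<alpha>"
    unfolding adjoin_def mem_Collect_eq
    by (rule exI[of _ "\<lambda>x. c * f' x + d * g' x"], rule exI[of _ "c * a' + d * b'"], rule exI[of _ "c * t + d * u"])
       (intro conjI linear_graphD[OF assms f(1) g(1)], simp_all add: f g algebra_simps)
qed

text \<open>Division by the modulus of \<open>t\<close> turns a nonnegative \<open>f + t * h\<close>
  into a minorant or a majorant of \<open>h\<close> from \<open>G\<close>, according to the sign of
  \<open>t\<close>; so \<open>\<alpha>\<close> only has to separate the two kinds of values.\<close>

lemma positive_on_adjoin:
  assumes G: "linear_graph G" "positive_on C G"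
    and low: "\<And>v a. (v, a) \<in> G \<Longrightarrow> (\<And>x. x \<in> C \<Longrightarrow> v x \<le> h x) \<Longrightarrow> a \<le> \<alpha>"
    and upp: "\<And>v a. (v, a) \<in> G \<Longrightarrow> (\<And>x. x \<in> C \<Longrightarrow> h x \<le> v x) \<Longrightarrow> \<alpha> \<le> a"
  shows "positive_on C (adjoin G h \<alpha>)"
  unfolding positive_on_def
proof (intro allI impI)
  fix f a assume "(f, a) \<in> adjoin G h \<alpha>" and nonneg: "\<forall>x\<in>C. 0 \<le> f x"
  then obtain f' a' t where f: "(f', a') \<in> G" "f = (\<lambda>x. f' x + t * h x)" "a = a' + t * \<alpha>"
    unfolding adjoin_def by auto
  have nn: "0 \<le> f' x + t * h x" if "x \<in> C" for x using nonneg f that by auto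
  have sc: "((\<lambda>x. - (1 / t) * f' x), - (1 / t) * a') \<in> G" by (rule linear_graph_scale[OF G(1) f(1)])
  consider "t = 0" | "t > 0" | "t < 0" by linarith
  then show "0 \<le> a"
  proof cases
    case 1 then show ?thesis using positive_onD[OF G(2) f(1)] nn f(3) by auto
  next
    case 2
    have "- (1 / t) * a' \<le> \<alpha>" by (rule low[OF sc]) (use 2 in \<open>simp add: field_simps\<close>, use nn in \<open>smt (verit, best)\<close>)
    then show ?thesis using 2 by (simp add: f(3) field_simps)
  next
    case 3
    have "\<alpha> \<le> - (1 / t) * a'" by (rule upp[OF sc]) (use 3 in \<open>simp add: field_simps\<close>, use nn in \<open>smt (verit, best)\<close>)
    then show ?thesis using 3 by (simp add: f(3) field_simps)
  qed
qed

text \<open>The supremum of the values at minorants will do: \<open>v\<close> makes the set nonempty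
  and \<open>w\<close> bounds it.\<close>

lemma ex_positive_adjoin:
  assumes G: "linear_graph G" "positive_on C G"
    and v: "(v, a) \<in> G" "\<And>x. x \<in> C \<Longrightarrow> v x \<le> h x" and w: "(w, b) \<in> G" "\<And>x. x \<in> C \<Longrightarrow> h x \<le> w x"
  shows "\<exists>\<alpha>. positive_on C (adjoin G h \<alpha>)"
proof
  let ?S = "{a. \<exists>v. (v, a) \<in> G \<and> (\<forall>x\<in>C. v x \<le> h x)}"
  have le: "a \<le> b" if "(v, a) \<in> G" "\<forall>x\<in>C. v x \<le> h x" "(w, b) \<in> G" "\<And>x. x \<in> C \<Longrightarrow> h x \<le> w x" for v a w b
    by (rule positive_on_mono[OF G(2,1) that(1,3)]) (use that in force)
  have bdd: "bdd_above ?S" using le[OF _ _ w] by (auto intro!: bdd_aboveI[of _ b])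
  show "positive_on C (adjoin G h (Sup ?S))"
  proof (rule positive_on_adjoin[OF G])
    show "a \<le> Sup ?S" if "(v, a) \<in> G" "\<And>x. x \<in> C \<Longrightarrow> v x \<le> h x" for v a
      using that by (intro cSup_upper bdd) auto
    show "Sup ?S \<le> a" if "(w, a) \<in> G" "\<And>x. x \<in> C \<Longrightarrow> h x \<le> w x" for w a
      using v le[OF _ _ that] by (intro cSup_least) auto
  qed
qed

text \<open>One adjunction for each \<open>n\<close>, then the union. The sandwich comes from the
  initial \<open>G\<close> and therefore stays available at every stage.\<close>

lemma ex_positive_extension:
  fixes h :: "nat \<Rightarrow> 'a \<Rightarrow> real"
  assumes G: "linear_graph G" "positive_on C G"
    and dom: "\<And>n. \<exists>v a w b. (v, a) \<in> G \<and> (w, b) \<in> G \<and> (\<forall>x\<in>C. v x \<le> h n x \<and> h n x \<le> w x)"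
  shows "\<exists>G'. G \<subseteq> G' \<and> linear_graph G' \<and> positive_on C G' \<and> (\<forall>n. \<exists>\<alpha>. (h n, \<alpha>) \<in> G')"
proof -
  define E where "E = rec_nat G (\<lambda>n H. adjoin H (h n) (SOME \<alpha>. positive_on C (adjoin H (h n) \<alpha>)))"
  have E0: "E 0 = G" by (simp add: E_def)
  have ES: "E (Suc n) = adjoin (E n) (h n) (SOME \<alpha>. positive_on C (adjoin (E n) (h n) \<alpha>))" for n
    by (simp add: E_def)
  have sub: "E n \<subseteq> E (Suc n)" for n unfolding ES by (rule subset_adjoin)
  have mono: "E m \<subseteq> E n" if "m \<le> n" for m n using lift_Suc_mono_le[of E, OF sub that] .
  have EG: "G \<subseteq> E n" for n using mono[of 0 n] by (simp add: E0)
  have lp: "linear_graph (E n) \<and> positive_on C (E n)" for n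
  proof (induction n)
    case (Suc n)
    have "\<exists>\<alpha>. positive_on C (adjoin (E n) (h n) \<alpha>)"
      using dom[of n] EG[of n] Suc ex_positive_adjoin[of "E n" C _ _ "h n"] by (smt (verit) subset_iff)
    then show ?case unfolding ES using Suc linear_graph_adjoin someI_ex by metis
  qed (simp add: E0 G)
  have ne: "E n \<noteq> {}" for n using dom[of n] EG[of n] by auto
  show ?thesis
  proof (intro exI[of _ "\<Union>n. E n"] conjI allI)
    show "G \<subseteq> (\<Union>n. E n)" using EG by auto
    show "linear_graph (\<Union>n. E n)"
      unfolding linear_graph_def
    proof (intro allI impI)
      fix f a g b c d assume "(f, a) \<in> (\<Union>n. E n)" "(g, b) \<in> (\<Union>n. E n)"
      then obtain m n where "(f, a) \<in> E m" "(g, b) \<in> E n" by auto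
      then have "(f, a) \<in> E (max m n)" "(g, b) \<in> E (max m n)" using mono[of m "max m n"] mono[of n "max m n"] by auto
      from linear_graphD[OF _ this] show "((\<lambda>x. c * f x + d * g x), c * a + d * b) \<in> (\<Union>n. E n)"
        using lp by blast
    qed
    show "positive_on C (\<Union>n. E n)" using lp unfolding positive_on_def by auto
    show "\<exists>\<alpha>. (h n, \<alpha>) \<in> (\<Union>n. E n)" for n
      using adjoin_self[of "E n" "h n"] lp ne ES[of n] by (metis UN_I UNIV_I)
  qed
qed

text \<open>Fatou's lemma supplies only an inequality, and only for nonnegative functions. For
  signed \<open>g\<close> it is applied to \<open>e * w + g + 1 / (4 * e)\<close>, where
  \<open>w\<close> majorises the square of \<open>g\<close>; the constants agree on both sides
  because the mass is 1, and the error \<open>e * (b - integral w)\<close> vanishes with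
  \<open>e\<close>. Using this for \<open>f\<close> and \<open>- f\<close> gives equality.\<close>

lemma nn_integral_le_imp_integral_eq:
  fixes M :: "'a measure"
  assumes M: "emeasure M (space M) = 1" and G: "linear_graph G" "((\<lambda>_. 1), 1) \<in> G"
    and le: "\<And>f a. (f, a) \<in> G \<Longrightarrow> (\<And>x. 0 \<le> f x) \<Longrightarrow> (\<integral>\<^sup>+x. ennreal (f x) \<partial>M) \<le> ennreal a"
    and meas: "\<And>f a. (f, a) \<in> G \<Longrightarrow> f \<in> borel_measurable M"
    and dom: "\<And>f a. (f, a) \<in> G \<Longrightarrow> \<exists>w b. (w, b) \<in> G \<and> (\<forall>x. (f x)\<^sup>2 \<le> w x)"
    and f: "(f, a) \<in> G"
  shows "integrable M f \<and> integral\<^sup>L M f = a"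
proof -
  interpret finite_measure M by standard (simp add: M)
  have m1: "measure M (space M) = 1" by (simp add: measure_def M)
  have int: "integrable M g \<and> integral\<^sup>L M g \<le> b" if "(g, b) \<in> G" "\<And>x. 0 \<le> g x" for g b
  proof -
    have *: "(\<integral>\<^sup>+x. ennreal (g x) \<partial>M) \<le> ennreal b" by (rule le[OF that])
    have i: "integrable M g"
      by (rule integrableI_bounded[OF meas[OF that(1)]])
         (use * that(2) in \<open>auto simp: ennreal_mult_less_top intro: le_less_trans\<close>)
    have "0 \<le> b \<or> (\<integral>\<^sup>+x. ennreal (g x) \<partial>M) = 0" using * by (cases "0 \<le> b") (auto simp: ennreal_neg)
    then have "integral\<^sup>L M g \<le> max b 0"
      using * nn_integral_eq_integral[OF i] that(2) by (auto simp: max_def ennreal_neg split: if_splits)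
    \<comment> \<open>For \<open>b < 0\<close> the function \<open>1 + g / (- b)\<close> would have
      value 0, yet its integral is at least the total mass 1.\<close>
    moreover have "0 \<le> b"
    proof (rule ccontr)
      assume "\<not> 0 \<le> b"
      then have pos: "((\<lambda>x. 1 + 1 / (- b) * g x), 1 + 1 / (- b) * b) \<in> G"
        using linear_graphD[OF G(1,2) that(1), of 1 "1 / (- b)"] by simp
      have "(\<integral>\<^sup>+x. ennreal (1 + 1 / (- b) * g x) \<partial>M) \<le> ennreal (1 + 1 / (- b) * b)"
        by (rule le[OF pos]) (use that(2) \<open>\<not> 0 \<le> b\<close> in \<open>auto simp: field_simps intro!: add_nonneg_nonneg\<close>, smt (verit))
      moreover have "1 + 1 / (- b) * b = 0" using \<open>\<not> 0 \<le> b\<close> by simp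
      moreover have "(\<integral>\<^sup>+x. 1 \<partial>M) \<le> (\<integral>\<^sup>+x. ennreal (1 + 1 / (- b) * g x) \<partial>M)"
        by (intro nn_integral_mono) (use that(2) \<open>\<not> 0 \<le> b\<close> in \<open>auto simp: field_simps\<close>)
      ultimately show False using M by simp
    qed
    ultimately show ?thesis using i by simp
  qed
  have sq: "integrable M g \<and> integral\<^sup>L M g \<le> c" if g: "(g, c) \<in> G" for g c
  proof -
    obtain w b where w: "(w, b) \<in> G" "\<And>x. (g x)\<^sup>2 \<le> w x" using dom[OF g] by blast
    have w0: "0 \<le> w x" for x using w(2)[of x] by (smt (verit) zero_le_power2)
    have iw: "integrable M w" using int[OF w(1) w0] by simp
    have ab: "\<bar>g x\<bar> \<le> 1 + w x" for x
    proof -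
      have "0 \<le> (\<bar>g x\<bar> - 1)\<^sup>2" by simp
      then show ?thesis using w(2)[of x] by (simp add: power2_diff)
    qed
    have ig: "integrable M g"
      by (rule Bochner_Integration.integrable_bound[of M "\<lambda>x. 1 + w x"])
         (use iw meas[OF g] ab w0 in \<open>auto simp: add_nonneg_nonneg intro!: AE_I2\<close>)
    have bound: "integral\<^sup>L M g \<le> c + e * (b - integral\<^sup>L M w)" if "e > 0" for e
    proof -
      have "((\<lambda>x. 1 * (e * w x + 1 * g x) + 1 / (4 * e) * 1), 1 * (e * b + 1 * c) + 1 / (4 * e) * 1) \<in> G"
        by (rule linear_graphD[OF G(1) linear_graphD[OF G(1) w(1) g] G(2)])
      moreover have "0 \<le> 1 * (e * w x + 1 * g x) + 1 / (4 * e) * 1" for x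
      proof -
        have "0 \<le> e * (g x + 1 / (2 * e))\<^sup>2" using that by simp
        also have "\<dots> = e * (g x)\<^sup>2 + g x + 1 / (4 * e)"
          using that by (simp add: power2_sum power2_eq_square field_simps)
        also have "\<dots> \<le> e * w x + g x + 1 / (4 * e)" using w(2)[of x] that by simp
        finally show ?thesis by simp
      qed
      ultimately have "integral\<^sup>L M (\<lambda>x. 1 * (e * w x + 1 * g x) + 1 / (4 * e) * 1) \<le> 1 * (e * b + 1 * c) + 1 / (4 * e) * 1"
        using int by blast
      then have "e * integral\<^sup>L M w + integral\<^sup>L M g \<le> e * b + c"
        using iw ig by (simp add: m1)
      then show ?thesis by (simp add: algebra_simps)
    qed
    have "integral\<^sup>L M g \<le> c"
    proof (rule field_le_epsilon)
      fix e :: real assume "e > 0"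
      define d where "d = e / (1 + \<bar>b - integral\<^sup>L M w\<bar>)"
      have "d > 0" using \<open>e > 0\<close> by (simp add: d_def add_pos_nonneg)
      have "d * (b - integral\<^sup>L M w) \<le> d * (1 + \<bar>b - integral\<^sup>L M w\<bar>)"
        using \<open>d > 0\<close> by (intro mult_left_mono) auto
      also have "\<dots> = e" by (simp add: d_def add_pos_nonneg add_nonneg_eq_0_iff)
      finally show "integral\<^sup>L M g \<le> c + e" using bound[OF \<open>d > 0\<close>] by simp
    qed
    then show ?thesis using ig by simp
  qed
  have "integral\<^sup>L M (\<lambda>x. - 1 * f x) \<le> - 1 * a"
    using sq[OF linear_graph_scale[OF G(1) f]] by blast
  then show ?thesis using sq[OF f] by simp
qed

section \<open>Measures on the line from distribution functions\<close>

lemma sum_step_le: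
  fixes x :: "nat \<Rightarrow> real"
  assumes x: "\<And>i j. i \<le> j \<Longrightarrow> x i \<le> x j" and f: "0 \<le> f s"
    and c: "\<And>i. i < n \<Longrightarrow> x i < s \<Longrightarrow> s \<le> x (Suc i) \<Longrightarrow> c i \<le> (f s :: real)"
  shows "(\<Sum>i<n. c i * (indicator {..x (Suc i)} s - indicator {..x i} s)) \<le> f s"
proof (cases "\<exists>i<n. x i < s \<and> s \<le> x (Suc i)")
  case True
  then obtain i where i: "i < n" "x i < s" "s \<le> x (Suc i)" by blast
  have "(\<Sum>j<n. c j * (indicator {..x (Suc j)} s - indicator {..x j} s)) = (\<Sum>j<n. if j = i then c i else 0)"
  proof (rule sum.cong[OF refl])
    fix j assume "j \<in> {..<n}"
    show "c j * (indicator {..x (Suc j)} s - indicator {..x j} s) = (if j = i then c i else 0)"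
      using i x[of "Suc j" i] x[of "Suc i" j] x[of j "Suc j"]
      by (cases j i rule: linorder_cases) (auto simp: indicator_def)
  qed
  also have "\<dots> \<le> f s" using c[OF i] i by simp
  finally show ?thesis .
next
  case False
  have "(\<Sum>j<n. c j * (indicator {..x (Suc j)} s - indicator {..x j} s)) = 0"
  proof (intro sum.neutral ballI)
    fix j assume "j \<in> {..<n}"
    then have "\<not> (x j < s \<and> s \<le> x (Suc j))" using False by auto
    then show "c j * (indicator {..x (Suc j)} s - indicator {..x j} s) = 0"
      using x[of j "Suc j"] by (auto simp: indicator_def)
  qed
  then show ?thesis using f by simp
qed

text \<open>Values for the indicators of \<open>{..r}\<close>, \<open>r\<close> rational, amount to
  a distribution function. The majorant \<open>w\<close> of the identity on \<open>C\<close>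
  prevents mass from escaping to infinity. Only an inequality results, because integrals are reached
  through step functions from below and Fatou's lemma.\<close>

lemma ex_measure_on_line:
  fixes G :: "((real \<Rightarrow> real) \<times> real) set"
  assumes G: "linear_graph G" "positive_on C G" and one: "((\<lambda>_. 1), 1) \<in> G"
    and C: "C \<subseteq> {0..}" and w: "(w, b) \<in> G" "\<And>s. s \<in> C \<Longrightarrow> s \<le> w s"
  shows "\<exists>N :: real measure. sets N = sets borel \<and> emeasure N UNIV = 1 \<and>
    (\<forall>f a. (f, a) \<in> G \<longrightarrow> continuous_on UNIV f \<longrightarrow> (\<forall>s. 0 \<le> f s) \<longrightarrow> (\<integral>\<^sup>+s. ennreal (f s) \<partial>N) \<le> ennreal a)"
proof -
  define q where "q n = real_of_rat (from_nat n)" for n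
  have rq: "\<exists>n. q n = r" if "r \<in> \<rat>" for r
    using that unfolding q_def by (metis Rats_cases from_nat_to_nat)
  have zero: "((\<lambda>_. 0), 0) \<in> G" using linear_graph_scale[OF G(1) one, of 0] by simp
  have "\<exists>G'. G \<subseteq> G' \<and> linear_graph G' \<and> positive_on C G' \<and> (\<forall>n. \<exists>\<alpha>. ((indicator {..q n} :: real \<Rightarrow> real), \<alpha>) \<in> G')"
    proof (rule ex_positive_extension[OF G])
    show "\<exists>v a w b. (v, a) \<in> G \<and> (w, b) \<in> G \<and> (\<forall>x\<in>C. v x \<le> indicator {..q n} x \<and> indicator {..q n} x \<le> w x)" for n
      by (intro exI[of _ "\<lambda>_. 0"] exI[of _ "0"] exI[of _ "\<lambda>_. 1"] exI[of _ "1"] conjI zero one) (auto simp: indicator_def)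
  qed
  then obtain G' where GG: "G \<subseteq> G'" and G': "linear_graph G'" "positive_on C G'"
    and "\<And>n. \<exists>\<alpha>. ((indicator {..q n} :: real \<Rightarrow> real), \<alpha>) \<in> G'" by blast
  then have "\<exists>\<alpha>. ((indicator {..r} :: real \<Rightarrow> real), \<alpha>) \<in> G'" if "r \<in> \<rat>" for r using rq[OF that] by metis
  then obtain g where g: "\<And>r. r \<in> \<rat> \<Longrightarrow> ((indicator {..r} :: real \<Rightarrow> real), g r) \<in> G'" by metis
  have g_mono: "g r \<le> g s" if "r \<in> \<rat>" "s \<in> \<rat>" "r \<le> s" for r s
    by (rule positive_on_mono[OF G'(2,1) g[OF that(1)] g[OF that(2)]]) (use that in \<open>auto simp: indicator_def\<close>)
  have g_ge: "0 \<le> g r" if "r \<in> \<rat>" for r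
    by (rule positive_onD[OF G'(2) g[OF that]]) auto
  have g_le: "g r \<le> 1" if "r \<in> \<rat>" for r
    by (rule positive_on_mono[OF G'(2,1) g[OF that] subsetD[OF GG one]]) (auto simp: indicator_def)
  have g_neg: "g r = 0" if "r \<in> \<rat>" "r < 0" for r
  proof -
    have "g r \<le> 0"
      by (rule positive_on_mono[OF G'(2,1) g[OF that(1)] subsetD[OF GG zero]]) (use that C in \<open>auto simp: indicator_def\<close>)
    then show ?thesis using g_ge[OF that(1)] by simp
  qed
  \<comment> \<open>Chebyshev's inequality: a point \<open>s\<close> of \<open>C\<close> beyond
    \<open>r\<close> satisfies \<open>r \<le> w s\<close>.\<close>
  have g_lim: "r * (1 - g r) \<le> b" if "r \<in> \<rat>" "r > 0" for r
  proof (rule positive_on_mono[OF G'(2,1) _ subsetD[OF GG w(1)]])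
    show "((\<lambda>s. r * (1 - indicator {..r} s)), r * (1 - g r)) \<in> G'"
      by (rule linear_graph_scale[OF G'(1) linear_graph_diff[OF G'(1) subsetD[OF GG one] g[OF that(1)]]])
    show "r * (1 - indicator {..r} s) \<le> w s" if "s \<in> C" for s
      using w(2)[OF that] C that \<open>r > 0\<close> by (auto simp: indicator_def)
  qed
  \<comment> \<open>The infimum over strictly larger rationals makes \<open>F\<close> right
    continuous; \<open>g\<close> itself need not be.\<close>
  define F where "F x = Inf (g ` {r \<in> \<rat>. x < r})" for x
  have ex_rat: "\<exists>r. r \<in> {r \<in> \<rat>. x < r}" for x :: real
    using Rats_dense_in_real[of x "x + 1"] by auto
  have bdd: "bdd_below (g ` {r \<in> \<rat>. x < r})" for x using g_ge by (auto intro!: bdd_belowI[of _ 0])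
  have F_le: "F x \<le> g r" if "r \<in> \<rat>" "x < r" for x r
    unfolding F_def by (rule cInf_lower[OF _ bdd]) (use that in auto)
  have F_ge: "c \<le> F x" if "\<And>r. r \<in> \<rat> \<Longrightarrow> x < r \<Longrightarrow> c \<le> g r" for c x
    unfolding F_def using ex_rat[of x] that by (intro cInf_greatest) auto
  have F_near: "\<exists>r\<in>\<rat>. x < r \<and> g r < F x + e" if "e > 0" for x e
  proof -
    have ne: "g ` {r \<in> \<rat>. x < r} \<noteq> {}" using ex_rat[of x] by blast
    have "F x < F x + e" using that by simp
    from cInf_lessD[OF ne this[unfolded F_def[of x]]] obtain z where
      "z \<in> g ` {r \<in> \<rat>. x < r}" "z < Inf (g ` {r \<in> \<rat>. x < r}) + e" by (rule bexE)
    then show ?thesis unfolding F_def by blast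
  qed
  have F_mono: "F x \<le> F y" if "x \<le> y" for x y by (rule F_ge, rule F_le) (use that in auto)
  have F_right: "continuous (at_right x) F" for x
  proof (subst continuous_at_right_real_increasing)
    show "F x \<le> F y" if "x \<le> y" for x y by (rule F_mono[OF that])
    show "\<forall>e>0. \<exists>d>0. F (x + d) - F x < e"
    proof (intro allI impI)
      fix e :: real assume "e > 0"
      then obtain r where r: "r \<in> \<rat>" "x < r" "g r < F x + e" using F_near by blast
      have "F (x + (r - x) / 2) \<le> g r" by (rule F_le) (use r in \<open>auto simp: field_simps\<close>)
      then show "\<exists>d>0. F (x + d) - F x < e" using r by (intro exI[of _ "(r - x) / 2"]) auto
    qed
  qed
  define N where "N = interval_measure F"
  have N_Ioc: "emeasure N {x<..y} = ennreal (F y - F x)" if "x \<le> y" for x y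
    unfolding N_def by (rule emeasure_interval_measure_Ioc[OF that F_mono F_right])
  have setsN: "sets N = sets borel" by (simp add: N_def)
  have F_bounds: "0 \<le> F x" "F x \<le> 1" for x
  proof -
    show "0 \<le> F x" by (rule F_ge) (rule g_ge)
    obtain r where "r \<in> \<rat>" "x < r" using ex_rat[of x] by blast
    then show "F x \<le> 1" using F_le[of r x] g_le[of r] by simp
  qed
  have F_neg: "F x = 0" if neg: "x < 0" for x
  proof -
    obtain r where "r \<in> \<rat>" "x < r" "r < 0" using Rats_dense_in_real[OF neg] by blast
    then show ?thesis using F_le[of r x] g_neg[of r] F_bounds[of x] by simp
  qed
  have F_top: "(\<lambda>n. F (real n)) \<longlonglongrightarrow> 1"
  proof (rule tendsto_sandwich[where f = "\<lambda>n. 1 - b / real n" and h = "\<lambda>n. 1"])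
    have "1 - b / real n \<le> F (real n)" if "n > 0" for n
    proof (rule F_ge)
      fix r assume r: "r \<in> \<rat>" "real n < r"
      have "1 - b / real n \<le> g (real n)" using g_lim[of "real n"] that by (simp add: field_simps)
      also have "\<dots> \<le> g r" by (rule g_mono) (use r in auto)
      finally show "1 - b / real n \<le> g r" .
    qed
    then show "\<forall>\<^sub>F n in sequentially. 1 - b / real n \<le> F (real n)"
      by (intro eventually_sequentiallyI[of 1]) auto
    have "(\<lambda>n. 1 - b / real n) \<longlonglongrightarrow> 1 - 0"
      by (intro tendsto_intros lim_const_over_n)
    then show "(\<lambda>n. 1 - b / real n) \<longlonglongrightarrow> 1" by simp
  qed (use F_bounds in auto)
  have N_UNIV: "emeasure N UNIV = 1"
  proof -
    \<comment> \<open>The left ends start at -1 and not at 0 because \<open>F\<close> is only known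
      to vanish at negative points; there may be mass at 0.\<close>
    have "(\<lambda>n. emeasure N {- 1 - real n<..real n}) \<longlonglongrightarrow> emeasure N (\<Union>n. {- 1 - real n<..real n})"
      by (rule Lim_emeasure_incseq) (auto simp: setsN incseq_def)
    moreover have "(\<Union>n. {- 1 - real n<..real n}) = UNIV"
    proof -
      have "\<exists>n. - 1 - real n < x \<and> x \<le> real n" for x
      proof -
        obtain n where "\<bar>x\<bar> \<le> real n" using real_arch_simple by blast
        then show ?thesis by (intro exI[of _ n]) auto
      qed
      then show ?thesis by auto
    qed
    moreover have "(\<lambda>n. emeasure N {- 1 - real n<..real n}) = (\<lambda>n. ennreal (F (real n)))"
      by (subst N_Ioc) (auto simp: F_neg)
    moreover have "(\<lambda>n. ennreal (F (real n))) \<longlonglongrightarrow> ennreal 1" by (rule tendsto_ennrealI[OF F_top])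
    ultimately show ?thesis using LIMSEQ_unique by fastforce
  qed
  \<comment> \<open>Recovers \<open>F\<close> from \<open>g\<close> along rationals decreasing to
    \<open>x\<close>, where the functional \<open>G'\<close> has values.\<close>
  have g_tendsto: "(\<lambda>m. g (x + h / (real m + 1))) \<longlonglongrightarrow> F x" if "x \<in> \<rat>" "h \<in> \<rat>" "h > 0" for x h
  proof (rule LIMSEQ_I)
    fix e :: real assume "e > 0"
    then obtain r where r: "r \<in> \<rat>" "x < r" "g r < F x + e" using F_near by blast
    obtain m0 where m0: "h / (r - x) < real m0" using reals_Archimedean2 by blast
    show "\<exists>m0. \<forall>m\<ge>m0. norm (g (x + h / (real m + 1)) - F x) < e"
    proof (intro exI[of _ m0] allI impI)
      fix m assume "m0 \<le> m"
      then have "h / (r - x) < real m + 1" using m0 by linarith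
      then have "h / (real m + 1) < r - x" using r that by (simp add: field_simps)
      moreover have Q: "x + h / (real m + 1) \<in> \<rat>" using that by simp
      ultimately have "g (x + h / (real m + 1)) \<le> g r" using r by (intro g_mono) auto
      moreover have "F x \<le> g (x + h / (real m + 1))" by (rule F_le) (use Q that in auto)
      ultimately show "norm (g (x + h / (real m + 1)) - F x) < e" using r by auto
    qed
  qed
  have main: "(\<integral>\<^sup>+s. ennreal (f s) \<partial>N) \<le> ennreal a"
    if f: "(f, a) \<in> G" "continuous_on UNIV f" "\<And>s. 0 \<le> f s" for f a
  proof -
    \<comment> \<open>Cells of width \<open>1 / (k + 1)\<close> cover (-k, k], hence their number
      \<open>2 * k * Suc k\<close>. The infimum in \<open>c\<close> is taken over a cell prolonged
      by \<open>h k\<close>, so that it still bounds \<open>f\<close> from below after the cell is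
      shifted to the right by \<open>h k / (m + 1)\<close>.\<close>
    define h where "h k = 1 / (real k + 1)" for k
    define x where "x k i = - real k + real i * h k" for k i
    define c where "c k i = Inf (f ` {x k i .. x k (Suc i) + h k})" for k i
    define S where "S k s = (\<Sum>i<2 * k * Suc k. c k i * (indicator {..x k (Suc i)} s - indicator {..x k i} s))" for k s
    have h: "h k > 0" "h k \<in> \<rat>" for k by (auto simp: h_def)
    have xQ: "x k i \<in> \<rat>" for k i using h by (auto simp: x_def)
    have x_mono: "x k i \<le> x k j" if "i \<le> j" for k i j using that h(1)[of k] by (simp add: x_def)
    have x_Suc: "x k (Suc i) = x k i + h k" for k i by (simp add: x_def algebra_simps)
    have c_le: "c k i \<le> f s" if "x k i \<le> s" "s \<le> x k (Suc i) + h k" for k i s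
      unfolding c_def by (rule cInf_lower) (use that f(3) in \<open>auto intro!: bdd_belowI[of _ 0]\<close>)
    have c_ge: "d \<le> c k i" if "\<And>s. x k i \<le> s \<Longrightarrow> s \<le> x k (Suc i) + h k \<Longrightarrow> d \<le> f s" for k i d
    proof -
      have "x k i \<le> x k (Suc i) + h k" using h(1)[of k] by (simp add: x_Suc)
      then show ?thesis unfolding c_def by (intro cInf_greatest) (use that in auto)
    qed
    have c0: "0 \<le> c k i" for k i by (rule c_ge) (rule f(3))
    have lower: "(\<Sum>i<2 * k * Suc k. c k i * (F (x k (Suc i)) - F (x k i))) \<le> a" for k
    proof (rule LIMSEQ_le_const2)
      show "(\<lambda>m. \<Sum>i<2 * k * Suc k. c k i * (g (x k (Suc i) + h k / (real m + 1)) - g (x k i + h k / (real m + 1))))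
        \<longlonglongrightarrow> (\<Sum>i<2 * k * Suc k. c k i * (F (x k (Suc i)) - F (x k i)))"
        by (intro tendsto_intros g_tendsto xQ h)
      show "\<exists>N. \<forall>m\<ge>N. (\<Sum>i<2 * k * Suc k. c k i * (g (x k (Suc i) + h k / (real m + 1)) - g (x k i + h k / (real m + 1)))) \<le> a"
      proof (intro exI[of _ 0] allI impI)
        fix m
        define y where "y i = x k i + h k / (real m + 1)" for i
        have hm: "0 < h k / (real m + 1)" "h k / (real m + 1) \<le> h k" using h(1)[of k] by (auto simp: field_simps)
        have yQ: "y i \<in> \<rat>" for i using xQ h by (auto simp: y_def)
        have "(\<Sum>i<2 * k * Suc k. c k i * (g (y (Suc i)) - g (y i))) \<le> a"
        proof (rule positive_on_mono[OF G'(2,1) _ subsetD[OF GG f(1)]])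
          show "((\<lambda>s. \<Sum>i<2 * k * Suc k. c k i * (indicator {..y (Suc i)} s - indicator {..y i} s)),
              \<Sum>i<2 * k * Suc k. c k i * (g (y (Suc i)) - g (y i))) \<in> G'"
            by (rule linear_graph_sum[OF G'(1)]) (use GG one in \<open>auto intro!: linear_graph_diff[OF G'(1)] g yQ\<close>)
          show "(\<Sum>i<2 * k * Suc k. c k i * (indicator {..y (Suc i)} s - indicator {..y i} s)) \<le> f s" for s
          proof (rule sum_step_le)
            show "y i \<le> y j" if "i \<le> j" for i j using x_mono[OF that, of k] by (simp add: y_def)
            show "c k i \<le> f s" if "y i < s" "s \<le> y (Suc i)" for i
              by (rule c_le) (use that hm in \<open>auto simp: y_def\<close>)
          qed (rule f(3))
        qed
        then show "(\<Sum>i<2 * k * Suc k. c k i * (g (x k (Suc i) + h k / (real m + 1)) - g (x k i + h k / (real m + 1)))) \<le> a"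
          by (simp add: y_def)
      qed
    qed
    have a0: "0 \<le> a" by (rule positive_onD[OF G(2) f(1)]) (rule f(3))
    have ind: "indicator {..x k (Suc i)} s - indicator {..x k i} s = (indicator {x k i<..x k (Suc i)} s :: real)" for k i s
      using x_mono[of i "Suc i" k] by (auto simp: indicator_def)
    have S0: "0 \<le> S k s" for k s unfolding S_def ind by (intro sum_nonneg mult_nonneg_nonneg c0) auto
    have int_S: "(\<integral>\<^sup>+s. ennreal (S k s) \<partial>N) \<le> ennreal a" for k
    proof -
      have "(\<integral>\<^sup>+s. ennreal (S k s) \<partial>N) = (\<integral>\<^sup>+s. (\<Sum>i<2 * k * Suc k. ennreal (c k i) * indicator {x k i<..x k (Suc i)} s) \<partial>N)"
      proof (intro nn_integral_cong)
        fix s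
        have "ennreal (S k s) = (\<Sum>i<2 * k * Suc k. ennreal (c k i * indicator {x k i<..x k (Suc i)} s))"
          unfolding S_def ind by (rule sum_ennreal[symmetric]) (simp add: c0)
        also have "\<dots> = (\<Sum>i<2 * k * Suc k. ennreal (c k i) * indicator {x k i<..x k (Suc i)} s)"
          by (intro sum.cong refl) (simp add: indicator_def c0)
        finally show "ennreal (S k s) = (\<Sum>i<2 * k * Suc k. ennreal (c k i) * indicator {x k i<..x k (Suc i)} s)" .
      qed
      also have "\<dots> = (\<Sum>i<2 * k * Suc k. \<integral>\<^sup>+s. ennreal (c k i) * indicator {x k i<..x k (Suc i)} s \<partial>N)"
        by (rule nn_integral_sum) (simp add: measurable_cong_sets[OF setsN refl])
      also have "\<dots> = (\<Sum>i<2 * k * Suc k. ennreal (c k i) * ennreal (F (x k (Suc i)) - F (x k i)))"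
        by (intro sum.cong refl, subst nn_integral_cmult_indicator) (simp_all add: setsN N_Ioc x_mono)
      also have "\<dots> = ennreal (\<Sum>i<2 * k * Suc k. c k i * (F (x k (Suc i)) - F (x k i)))"
        using F_mono[OF x_mono] by (subst sum_ennreal[symmetric]) (simp_all add: c0 ennreal_mult' del: sum_ennreal)
      also have "\<dots> \<le> ennreal a" by (rule ennreal_leI[OF lower])
      finally show ?thesis .
    qed
    have S_lim: "(\<lambda>k. S k s) \<longlonglongrightarrow> f s" for s
    proof (rule LIMSEQ_I)
      fix e :: real assume "e > 0"
      have "isCont f s" using f(2) by (simp add: continuous_on_eq_continuous_at)
      then have "\<exists>d>0. \<forall>t. norm (t - s) < d \<longrightarrow> \<bar>f t - f s\<bar> < e / 2"
        using half_gt_zero[OF \<open>e > 0\<close>] unfolding continuous_at_real_range by blast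
      then obtain d where d: "d > 0" "\<And>t. \<bar>t - s\<bar> < d \<Longrightarrow> \<bar>f t - f s\<bar> < e / 2" by auto
      obtain k0 where k0: "\<bar>s\<bar> + 2 / d < real k0" using reals_Archimedean2 by blast
      show "\<exists>k0. \<forall>k\<ge>k0. norm (S k s - f s) < e"
      proof (intro exI[of _ k0] allI impI)
        fix k assume "k0 \<le> k"
        then have "real k0 \<le> real k" by simp
        moreover have "0 < 2 / d" using d(1) by simp
        ultimately have k: "\<bar>s\<bar> < real k" "2 / d < real k + 1" using k0 by linarith+
        then have hd: "2 * h k < d" using d(1) by (simp add: h_def field_simps)
        define z where "z = (s + real k) * (real k + 1)"
        have z: "0 < z" "z < 2 * real k * (real k + 1)" using k by (auto simp: z_def)
        \<comment> \<open>For half-open cells that contain their right end the index is the ceiling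
          minus 1.\<close>
        define i where "i = nat (\<lceil>z\<rceil> - 1)"
        have i: "real i < z" "z \<le> real (Suc i)" using z(1) by (auto simp: i_def) linarith+
        have "real i < real (2 * k * Suc k)" using i(1) z(2) by (simp add: algebra_simps)
        then have iN: "i < 2 * k * Suc k" by (simp only: of_nat_less_iff)
        have xs: "x k i < s" "s \<le> x k (Suc i)"
          using i unfolding z_def x_def h_def by (auto simp: field_simps)
        have "S k s = (\<Sum>j<2 * k * Suc k. if j = i then c k i else 0)"
          unfolding S_def ind
        proof (rule sum.cong[OF refl])
          fix j
          show "c k j * indicator {x k j<..x k (Suc j)} s = (if j = i then c k i else 0)"
            using xs x_mono[of "Suc j" i k] x_mono[of "Suc i" j k]
            by (cases j i rule: linorder_cases) (auto simp: indicator_def)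
        qed
        then have "S k s = c k i" using iN by simp
        moreover have "f s - e / 2 \<le> c k i"
        proof (rule c_ge)
          fix t assume "x k i \<le> t" "t \<le> x k (Suc i) + h k"
          then have "\<bar>t - s\<bar> < d" using xs hd h(1)[of k] unfolding x_Suc by auto
          then show "f s - e / 2 \<le> f t" using d(2)[of t] by linarith
        qed
        moreover have "c k i \<le> f s" by (rule c_le) (use xs h(1)[of k] in auto)
        ultimately show "norm (S k s - f s) < e" using \<open>e > 0\<close> by auto
      qed
    qed
    have "(\<integral>\<^sup>+s. ennreal (f s) \<partial>N) = (\<integral>\<^sup>+s. liminf (\<lambda>k. ennreal (S k s)) \<partial>N)"
      by (intro nn_integral_cong lim_imp_Liminf[symmetric] tendsto_ennrealI S_lim) simp
    also have "\<dots> \<le> liminf (\<lambda>k. \<integral>\<^sup>+s. ennreal (S k s) \<partial>N)"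
    proof (rule nn_integral_liminf)
      show "(\<lambda>s. ennreal (S k s)) \<in> borel_measurable N" for k
        unfolding S_def ind measurable_cong_sets[OF setsN refl] by measurable
    qed
    also have "\<dots> \<le> ennreal a"
      using int_S by (intro Liminf_le) auto
    finally show ?thesis .
  qed
  show ?thesis using setsN N_UNIV main by blast
qed

text \<open>M. Riesz' extension argument on the line, transported to \<open>real ^ 'd\<close> by a space filling curve.\<close>

theorem ex_representing_measure:
  fixes G :: "((real ^ 'd::finite \<Rightarrow> real) \<times> real) set"
  assumes G: "linear_graph G" "positive_on UNIV G" and one: "((\<lambda>_. 1), 1) \<in> G"
    and w: "(w, b) \<in> G" "\<And>x. norm x \<le> w x"
    and cont: "\<And>f a. (f, a) \<in> G \<Longrightarrow> continuous_on UNIV f"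
    and dom: "\<And>f a. (f, a) \<in> G \<Longrightarrow> \<exists>v c. (v, c) \<in> G \<and> (\<forall>x. (f x)\<^sup>2 \<le> v x)"
  shows "\<exists>M. sets M = sets borel \<and> (\<forall>f a. (f, a) \<in> G \<longrightarrow> integrable M f \<and> integral\<^sup>L M f = a)"
proof -
  obtain \<Phi> :: "real \<Rightarrow> real ^ 'd" where \<Phi>: "continuous_on UNIV \<Phi>" "\<And>x. \<exists>s\<ge>0. s \<le> 2 * norm x + 5 \<and> \<Phi> s = x"
    using space_filling by blast
  define H where "H = (\<lambda>(f, a). (f \<circ> \<Phi>, a)) ` G"
  \<comment> \<open>Every point of \<open>real ^ 'd\<close> has a parameter in \<open>C\<close>, so
    nonnegativity on \<open>C\<close> is nonnegativity everywhere; and on \<open>C\<close> the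
    parameter is dominated by \<open>2 * w + 5\<close> along the curve, which is the majorant
    demanded on the line.\<close>
  define C where "C = {s. 0 \<le> s \<and> s \<le> 2 * norm (\<Phi> s) + 5}"
  have H_I: "(\<lambda>s. f (\<Phi> s), a) \<in> H" if "(f, a) \<in> G" for f a
    using that unfolding H_def by (force simp: o_def)
  have H_E: "\<exists>f. (f, a) \<in> G \<and> u = (\<lambda>s. f (\<Phi> s))" if "(u, a) \<in> H" for u a
    using that unfolding H_def by (auto simp: o_def)
  have lin: "linear_graph H"
    unfolding linear_graph_def
  proof (intro allI impI)
    fix f a g b c d assume "(f, a) \<in> H" "(g, b) \<in> H"
    then obtain f' g' where *: "(f', a) \<in> G" "f = (\<lambda>s. f' (\<Phi> s))" "(g', b) \<in> G" "g = (\<lambda>s. g' (\<Phi> s))"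
      using H_E by metis
    show "((\<lambda>x. c * f x + d * g x), c * a + d * b) \<in> H"
      using H_I[OF linear_graphD[OF G(1) *(1,3), of c d]] unfolding *(2,4) .
  qed
  have pos: "positive_on C H"
    unfolding positive_on_def
  proof (intro allI impI)
    fix f a assume "(f, a) \<in> H" "\<forall>x\<in>C. 0 \<le> f x"
    then obtain f' where *: "(f', a) \<in> G" "\<And>s. s \<in> C \<Longrightarrow> 0 \<le> f' (\<Phi> s)" using H_E by metis
    have "0 \<le> f' x" for x using \<Phi>(2)[of x] *(2) unfolding C_def by auto
    then show "0 \<le> a" using positive_onD[OF G(2) *(1)] by blast
  qed
  have w': "((\<lambda>s. 2 * w (\<Phi> s) + 5 * 1), 2 * b + 5 * 1) \<in> H"
    by (rule H_I[OF linear_graphD[OF G(1) w(1) one]])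
  obtain N :: "real measure" where N: "sets N = sets borel" "emeasure N UNIV = 1"
    and le: "\<And>f a. (f, a) \<in> H \<Longrightarrow> continuous_on UNIV f \<Longrightarrow> (\<And>s. 0 \<le> f s) \<Longrightarrow> (\<integral>\<^sup>+s. ennreal (f s) \<partial>N) \<le> ennreal a"
  proof -
    have sub: "C \<subseteq> {0..}" by (auto simp: C_def)
    have "s \<le> 2 * w (\<Phi> s) + 5 * 1" if "s \<in> C" for s using that w(2)[of "\<Phi> s"] by (auto simp: C_def)
    from ex_measure_on_line[OF lin pos H_I[OF one] sub w' this] that show thesis by blast
  qed
  define M where "M = distr N borel \<Phi>"
  have meas\<Phi>: "\<Phi> \<in> N \<rightarrow>\<^sub>M borel"
    using borel_measurable_continuous_onI[OF \<Phi>(1)] by (simp add: measurable_cong_sets[OF N(1) refl])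
  have spN: "space N = UNIV" using sets_eq_imp_space_eq[OF N(1)] by simp
  have measM: "f \<in> borel_measurable M" if "(f, a) \<in> G" for f a
    using borel_measurable_continuous_onI[OF cont[OF that]] by (simp add: M_def)
  have "integrable M f \<and> integral\<^sup>L M f = a" if f: "(f, a) \<in> G" for f a
  proof (rule nn_integral_le_imp_integral_eq[OF _ G(1) one _ measM dom f])
    show "emeasure M (space M) = 1" using N(2) by (simp add: M_def emeasure_distr[OF meas\<Phi>] spN)
    show "(\<integral>\<^sup>+x. ennreal (f x) \<partial>M) \<le> ennreal a" if "(f, a) \<in> G" "\<And>x. 0 \<le> f x" for f a
    proof -
      have "(\<integral>\<^sup>+x. ennreal (f x) \<partial>M) = (\<integral>\<^sup>+s. ennreal (f (\<Phi> s)) \<partial>N)"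
        unfolding M_def using measM[OF that(1)] by (intro nn_integral_distr[OF meas\<Phi>]) (auto simp: M_def)
      also have "\<dots> \<le> ennreal a"
        by (rule le[OF H_I[OF that(1)]]) (use that(2) cont[OF that(1)] \<Phi>(1) in \<open>auto intro: continuous_on_compose2\<close>)
      finally show ?thesis .
    qed
  qed
  moreover have "sets M = sets borel" by (simp add: M_def)
  ultimately show ?thesis by blast
qed

section \<open>Nonnegative polynomials in one variable\<close>

abbreviation conj_poly :: "complex poly \<Rightarrow> complex poly" where
  "conj_poly \<equiv> map_poly cnj"

lemma coeff_conj_poly: "coeff (conj_poly p) n = cnj (coeff p n)"
  by (simp add: coeff_map_poly)

lemma poly_conj_poly: "poly (conj_poly p) z = cnj (poly p (cnj z))"
  using poly_cnj[of p "cnj z"] by simp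

lemma conj_poly_mult: "conj_poly (p * q) = conj_poly p * conj_poly q"
  by (intro poly_eqI) (simp add: coeff_conj_poly coeff_mult cnj_sum)

lemma nonneg_Reals_limit_poly:
  assumes "\<And>t::real. t \<noteq> a \<Longrightarrow> poly H (of_real t) \<in> \<real>\<^sub>\<ge>\<^sub>0"
  shows "poly H (complex_of_real t) \<in> \<real>\<^sub>\<ge>\<^sub>0"
proof (cases "t = a")
  case True
  have "((\<lambda>t. poly H (complex_of_real t)) \<longlongrightarrow> poly H (of_real a)) (at a)"
    by (intro tendsto_intros)
  then have "poly H (of_real a) \<in> \<real>\<^sub>\<ge>\<^sub>0"
    by (intro Lim_in_closed_set[OF closed_nonneg_Reals_complex]) (use assms in \<open>auto simp: eventually_at intro!: exI[of _ 1]\<close>)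
  then show ?thesis by (simp add: True)
qed (use assms in auto)

text \<open>The cofactor \<open>K\<close> is nonnegative to the right of \<open>a\<close> and
  nonpositive to its left, so continuity leaves it only the value 0 at \<open>a\<close>.\<close>

lemma nonneg_root_double:
  fixes G K :: "complex poly" and a :: real
  assumes G: "\<And>t::real. poly G (of_real t) \<in> \<real>\<^sub>\<ge>\<^sub>0" and K: "G = [:- of_real a, 1:] * K"
  shows "poly K (of_real a) = 0"
proof -
  have val: "poly G (of_real t) = of_real (t - a) * poly K (of_real t)" for t :: real
    by (simp add: K algebra_simps)
  have im: "Im (poly K (of_real t)) = 0" and re: "(t - a) * Re (poly K (of_real t)) \<ge> 0" if "t \<noteq> a" for t
    using G[of t] that by (auto simp: val complex_nonneg_Reals_iff)
  have lim: "((\<lambda>t. Re (poly K (complex_of_real t))) \<longlongrightarrow> Re (poly K (of_real a))) (at a within S)"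
    "((\<lambda>t. Im (poly K (complex_of_real t))) \<longlongrightarrow> Im (poly K (of_real a))) (at a within S)" for S
    by (intro tendsto_intros)+
  have "Im (poly K (of_real a)) = 0"
    by (rule tendsto_unique[OF _ lim(2)[of UNIV]], simp, rule tendsto_eventually)
       (use im in \<open>auto simp: eventually_at intro!: exI[of _ 1]\<close>)
  moreover have "\<forall>t>a. 0 \<le> Re (poly K (of_real t))" "\<forall>t<a. Re (poly K (of_real t)) \<le> 0"
    using re by (force simp: zero_le_mult_iff)+
  then have "\<forall>\<^sub>F t in at_right a. 0 \<le> Re (poly K (of_real t))" "\<forall>\<^sub>F t in at_left a. Re (poly K (of_real t)) \<le> 0"
    by (simp_all add: eventually_at_filter)
  then have "0 \<le> Re (poly K (of_real a))" "Re (poly K (of_real a)) \<le> 0"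
    using tendsto_lowerbound[OF lim(1)[of "{a<..}"]] tendsto_upperbound[OF lim(1)[of "{..<a}"]] by simp_all
  ultimately show ?thesis by (simp add: complex_eq_iff)
qed

text \<open>Roots off the real axis come in conjugate pairs and real ones are at least double, so in
  either case a factor \<open>(x - z) * (x - cnj z)\<close> splits off, which is positive on the
  line except possibly at \<open>Re z\<close>. The quotient is again nonnegative, and the degree
  drops by 2.\<close>

lemma nonneg_poly_eq_mult_conj:
  fixes G :: "complex poly"
  assumes "\<And>t::real. poly G (of_real t) \<in> \<real>\<^sub>\<ge>\<^sub>0"
  shows "\<exists>\<tau>. G = \<tau> * conj_poly \<tau>"
  using assms
proof (induction "degree G" arbitrary: G rule: less_induct)
  case less
  show ?case
  proof (cases "degree G = 0")
    case True
    then obtain c where c: "G = [:c:]" by (rule degree_eq_zeroE)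
    then obtain r where r: "c = of_real r" "r \<ge> 0"
      using less.prems[of 0] by (auto simp: nonneg_Reals_def)
    have "of_real (sqrt r) * of_real (sqrt r) = complex_of_real r"
      using r by (simp flip: of_real_mult)
    then show ?thesis by (intro exI[of _ "[:of_real (sqrt r):]"]) (simp add: c r map_poly_pCons)
  next
    case False
    then have "\<not> constant (poly G)" by (simp add: constant_degree)
    then obtain z where z: "poly G z = 0" using fundamental_theorem_of_algebra by blast
    have G0: "G \<noteq> 0" using False by auto
    \<comment> \<open>A polynomial that is real on the real line has real coefficients, since this
      difference has infinitely many roots.\<close>
    have "conj_poly G - G = 0"
    proof (rule ccontr)
      assume "conj_poly G - G \<noteq> 0"
      then have "finite {x. poly (conj_poly G - G) x = 0}" by (rule poly_roots_finite)
      moreover have "of_real t \<in> {x. poly (conj_poly G - G) x = 0}" for t :: real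
        using less.prems[of t] by (auto simp: poly_conj_poly complex_nonneg_Reals_iff complex_eq_iff)
      then have "range complex_of_real \<subseteq> {x. poly (conj_poly G - G) x = 0}" by auto
      ultimately have "finite (range complex_of_real)" using finite_subset by blast
      then show False using finite_imageD[of complex_of_real UNIV] infinite_UNIV_char_0 by (auto simp: inj_on_def)
    qed
    then have self: "conj_poly G = G" by simp
    have "poly G (cnj z) = 0" using poly_conj_poly[of G "cnj z"] z by (simp add: self)
    obtain K where K: "G = [:- z, 1:] * K" using z by (auto simp: poly_eq_0_iff_dvd elim: dvdE)
    have "poly K (cnj z) = 0"
    proof (cases "z \<in> \<real>")
      case True
      then obtain a where a: "z = of_real a" by (auto elim: Reals_cases)
      show ?thesis using nonneg_root_double[of G a K] less.prems K a by simp
    next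
      case False
      then have "cnj z \<noteq> z" by (auto simp: complex_eq_iff complex_is_Real_iff)
      then show ?thesis using \<open>poly G (cnj z) = 0\<close> by (simp add: K)
    qed
    then obtain H where H: "K = [:- cnj z, 1:] * H" by (auto simp: poly_eq_0_iff_dvd elim: dvdE)
    have GH: "G = [:- z, 1:] * [:- cnj z, 1:] * H" by (simp only: K H mult.assoc)
    have H0: "H \<noteq> 0" using G0 GH by auto
    have "degree G = Suc (Suc (degree H))"
      unfolding GH using H0 by (simp add: degree_mult_eq del: mult_pCons_left)
    moreover have "poly H (of_real t) \<in> \<real>\<^sub>\<ge>\<^sub>0" for t :: real
    proof (rule nonneg_Reals_limit_poly)
      fix t assume t: "t \<noteq> Re z"
      have "(of_real t - z) * (of_real t - cnj z) = of_real ((cmod (of_real t - z))\<^sup>2)"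
        using complex_norm_square[of "of_real t - z"] by simp
      then have "poly G (of_real t) = of_real ((cmod (of_real t - z))\<^sup>2) * poly H (of_real t)"
        unfolding GH poly_mult by simp
      moreover have "of_real t - z \<noteq> 0" using t by (auto simp: complex_eq_iff)
      ultimately have "poly H (of_real t) = of_real (inverse ((cmod (of_real t - z))\<^sup>2)) * poly G (of_real t)"
        by (simp add: field_simps)
      then show "poly H (of_real t) \<in> \<real>\<^sub>\<ge>\<^sub>0"
        using less.prems[of t] by (auto simp: complex_nonneg_Reals_iff)
    qed
    ultimately obtain \<sigma> where "H = \<sigma> * conj_poly \<sigma>" using less.hyps[of H] by auto
    moreover have "conj_poly [:- z, 1:] = [:- cnj z, 1:]" by (simp add: map_poly_pCons)
    ultimately show ?thesis
      by (intro exI[of _ "[:- z, 1:] * \<sigma>"]) (simp only: GH conj_poly_mult ac_simps)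
  qed
qed

section \<open>Determinate sequences in one variable\<close>

text \<open>Positive total mass is scaled to 1. For mass 0 the functional vanishes, and the null
  measure represents it: with \<open>v\<close> majorising the square of \<open>f\<close>, positivity
  at \<open>e * v + f + 1 / (4 * e)\<close> says \<open>0 \<le> e * c + a\<close> for all
  \<open>e > 0\<close>.\<close>

lemma ex_representing_measure_unnormalized:
  fixes G :: "((real ^ 'd::finite \<Rightarrow> real) \<times> real) set"
  assumes G: "linear_graph G" "positive_on UNIV G" and one: "((\<lambda>_. 1), m) \<in> G"
    and w: "(w, b) \<in> G" "\<And>x. norm x \<le> w x"
    and cont: "\<And>f a. (f, a) \<in> G \<Longrightarrow> continuous_on UNIV f"
    and dom: "\<And>f a. (f, a) \<in> G \<Longrightarrow> \<exists>v c. (v, c) \<in> G \<and> (\<forall>x. (f x)\<^sup>2 \<le> v x)"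
  shows "\<exists>M. sets M = sets borel \<and> (\<forall>f a. (f, a) \<in> G \<longrightarrow> integrable M f \<and> integral\<^sup>L M f = a)"
proof (cases "m = 0")
  case True
  have nonneg: "0 \<le> a" if fa: "(f, a) \<in> G" for f a
  proof -
    obtain v c where v: "(v, c) \<in> G" "\<And>x. (f x)\<^sup>2 \<le> v x" using dom[OF fa] by blast
    have "0 \<le> 1 * (e * c + 1 * a) + 1 / (4 * e) * m" if "e > 0" for e
    proof (rule positive_onD[OF G(2) linear_graphD[OF G(1) linear_graphD[OF G(1) v(1) fa] one]])
      fix x
      have "0 \<le> e * (f x + 1 / (2 * e))\<^sup>2" using that by simp
      also have "\<dots> = e * (f x)\<^sup>2 + f x + 1 / (4 * e)"
        using that by (simp add: power2_sum power2_eq_square field_simps)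
      also have "\<dots> \<le> e * v x + f x + 1 / (4 * e)" using v(2)[of x] that by simp
      finally show "0 \<le> 1 * (e * v x + 1 * f x) + 1 / (4 * e) * 1" by simp
    qed
    then have *: "- a \<le> e * c" if "e > 0" for e using that True by force
    have "- a \<le> 0"
    proof (rule field_le_epsilon)
      fix e :: real assume "e > 0"
      define d where "d = e / (1 + \<bar>c\<bar>)"
      have "d > 0" using \<open>e > 0\<close> by (simp add: d_def add_pos_nonneg)
      have "d * c \<le> d * (1 + \<bar>c\<bar>)" using \<open>d > 0\<close> by (intro mult_left_mono) auto
      also have "\<dots> = e" by (simp add: d_def add_pos_nonneg add_nonneg_eq_0_iff)
      finally show "- a \<le> 0 + e" using *[OF \<open>d > 0\<close>] by simp
    qed
    then show ?thesis by simp
  qed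
  have "a = 0" if "(f, a) \<in> G" for f a
    using nonneg[OF that] nonneg[OF linear_graph_scale[OF G(1) that, of "-1"]] by simp
  moreover have "f \<in> borel_measurable borel" if "(f, a) \<in> G" for f a
    by (rule borel_measurable_continuous_onI[OF cont[OF that]])
  ultimately have "integrable (null_measure borel) f \<and> integral\<^sup>L (null_measure borel) f = a" if "(f, a) \<in> G" for f a
    using that by (simp add: integrable_null_measure_iff)
  then show ?thesis by (intro exI[of _ "null_measure borel"] conjI allI impI) simp_all
next
  case False
  have "0 \<le> m" by (rule positive_onD[OF G(2) one]) simp
  then have m: "m > 0" using False by simp
  define H where "H = {(f, a / m) |f a. (f, a) \<in> G}"
  have H: "(f, a / m) \<in> H" if "(f, a) \<in> G" for f a using that unfolding H_def by blast
  have H_E: "(f, m * a) \<in> G" if "(f, a) \<in> H" for f a using that m unfolding H_def by auto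
  have lin: "linear_graph H"
    unfolding linear_graph_def
  proof (intro allI impI)
    fix f a g b c d assume "(f, a) \<in> H" "(g, b) \<in> H"
    from H[OF linear_graphD[OF G(1) H_E[OF this(1)] H_E[OF this(2)], of c d]]
    have "((\<lambda>x. c * f x + d * g x), (c * (m * a) + d * (m * b)) / m) \<in> H" .
    moreover have "(c * (m * a) + d * (m * b)) / m = c * a + d * b" using m by (simp add: field_simps)
    ultimately show "((\<lambda>x. c * f x + d * g x), c * a + d * b) \<in> H" by simp
  qed
  have pos: "positive_on UNIV H"
    unfolding positive_on_def
  proof (intro allI impI)
    fix f a assume "(f, a) \<in> H" "\<forall>x\<in>UNIV. 0 \<le> f x"
    then have "0 \<le> m * a" using positive_onD[OF G(2) H_E] by blast
    then show "0 \<le> a" using m by (simp add: zero_le_mult_iff)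
  qed
  have one': "((\<lambda>_. 1), 1) \<in> H" using H[OF one] m by simp
  have dom': "\<exists>v c. (v, c) \<in> H \<and> (\<forall>x. (f x)\<^sup>2 \<le> v x)" if "(f, a) \<in> H" for f a
    using dom[OF H_E[OF that]] H by blast
  have cont': "continuous_on UNIV f" if "(f, a) \<in> H" for f a by (rule cont[OF H_E[OF that]])
  have "\<exists>M. sets M = sets borel \<and> (\<forall>f a. (f, a) \<in> H \<longrightarrow> integrable M f \<and> integral\<^sup>L M f = a)"
  proof (rule ex_representing_measure[OF lin pos one' H[OF w(1)] w(2)])
    show "continuous_on UNIV f" if "(f, a) \<in> H" for f a by (rule cont'[OF that])
    show "\<exists>v c. (v, c) \<in> H \<and> (\<forall>x. (f x)\<^sup>2 \<le> v x)" if "(f, a) \<in> H" for f a by (rule dom'[OF that])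
  qed
  then obtain M where M1: "sets M = sets borel" and "\<forall>f a. (f, a) \<in> H \<longrightarrow> integrable M f \<and> integral\<^sup>L M f = a"
    by (elim exE conjE)
  note M = M1 this(2)[rule_format]
  show ?thesis
  proof (intro exI[of _ "density M (\<lambda>_. ennreal m)"] conjI allI impI)
    show "sets (density M (\<lambda>_. ennreal m)) = sets borel" using M(1) by simp
    fix f a assume fa: "(f, a) \<in> G"
    have meas: "f \<in> borel_measurable M"
      using borel_measurable_continuous_onI[OF cont[OF fa]] by (simp add: measurable_cong_sets[OF M(1) refl])
    show "integrable (density M (\<lambda>_. ennreal m)) f"
      using M(2)[OF H[OF fa]] m meas by (subst integrable_density) auto
    show "integral\<^sup>L (density M (\<lambda>_. ennreal m)) f = a"
      using M(2)[OF H[OF fa]] m meas by (subst integral_density) auto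
  qed
qed

section \<open>Determinacy as polynomial approximation of \<open>1 / (1 + x^2)\<close>\<close>

lemma monomial_1: "monomial \<alpha> (x :: real ^ 1) = (x $ 1) ^ (\<alpha> $ 1)"
  by (simp add: monomial_def UNIV_1)

lemma norm_real_1: "norm (x :: real ^ 1) = \<bar>x $ 1\<bar>"
  by (simp add: norm_vec_def L2_set_def UNIV_1)

text \<open>Otherwise two different values could be prescribed for the integral of \<open>1 / (1 + x\<^sup>2)\<close>.\<close>

lemma determinate1_sandwich:
  fixes t :: "nat \<Rightarrow> complex"
  assumes det: "determinate1 t" and M: "represents M (\<lambda>\<alpha> :: nat ^ 1. t (\<alpha> $ 1))" and e: "e > 0"
  shows "\<exists>P Q :: real poly. (\<forall>x. poly Q x \<le> 1 / (1 + x\<^sup>2) \<and> 1 / (1 + x\<^sup>2) \<le> poly P x) \<and>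
    (\<integral>x. poly (P - Q) (x $ 1) \<partial>M) < e"
proof (rule ccontr)
  assume no: "\<not> ?thesis"
  let ?f = "\<lambda>x :: real ^ 1. 1 / (1 + (x $ 1)\<^sup>2)"
  have setsM: "sets M = sets borel" and monint: "integrable M (monomial \<alpha>)" for \<alpha>
    using M by (auto simp: represents_def moment_measures_def)
  have powint: "integrable M (\<lambda>x. (x $ 1) ^ n)" for n
    using monint[of "\<chi> i. n"] by (simp add: monomial_1[abs_def])
  have polyint: "integrable M (\<lambda>x. poly P (x $ 1))" for P
    unfolding poly_altdef by (intro Bochner_Integration.integrable_sum integrable_mult_right powint)
  define G :: "((real ^ 1 \<Rightarrow> real) \<times> real) set" where "G = {((\<lambda>x. poly P (x $ 1)), \<integral>x. poly P (x $ 1) \<partial>M) |P. True}"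
  have G_I: "((\<lambda>x. poly P (x $ 1)), \<integral>x. poly P (x $ 1) \<partial>M) \<in> G" for P by (auto simp: G_def)
  have lin: "linear_graph G"
    unfolding linear_graph_def
  proof (intro allI impI)
    fix f a g b c d assume "(f, a) \<in> G" "(g, b) \<in> G"
    then obtain P Q where *: "f = (\<lambda>x. poly P (x $ 1))" "a = (\<integral>x. poly P (x $ 1) \<partial>M)"
      "g = (\<lambda>x. poly Q (x $ 1))" "b = (\<integral>x. poly Q (x $ 1) \<partial>M)" by (auto simp: G_def)
    show "((\<lambda>x. c * f x + d * g x), c * a + d * b) \<in> G"
      using G_I[of "smult c P + smult d Q"] polyint by (simp add: *)
  qed
  have Gne: "G \<noteq> {}" using G_I[of 0] by (rule ex_in_conv[THEN iffD1, OF exI])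
  have pos: "positive_on UNIV G" unfolding positive_on_def G_def by (auto intro!: integral_nonneg)
  let ?L = "{\<integral>x. poly Q (x $ 1) \<partial>M |Q. \<forall>x. poly Q (x $ 1) \<le> ?f x}"
  have x1: "\<exists>x :: real ^ 1. x $ 1 = y" for y by (rule exI[of _ "\<chi> i. y"]) simp
  \<comment> \<open>The negated claim leaves a gap of width \<open>e\<close> between the values of
    lower and upper polynomials, so every \<open>\<beta>\<close> from \<open>Sup ?L\<close> to
    \<open>Sup ?L + e\<close> is admissible as a value at \<open>?f\<close>.\<close>
  have gap: "(\<integral>x. poly Q (x $ 1) \<partial>M) + e \<le> (\<integral>x. poly P (x $ 1) \<partial>M)"
    if "\<forall>x. poly Q (x $ 1) \<le> ?f x" "\<forall>x. ?f x \<le> poly P (x $ 1)" for P Q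
  proof -
    have "poly Q y \<le> 1 / (1 + y\<^sup>2) \<and> 1 / (1 + y\<^sup>2) \<le> poly P y" for y
    proof -
      obtain x :: "real ^ 1" where "x $ 1 = y" using x1 by blast
      then show ?thesis using that(1)[rule_format, of x] that(2)[rule_format, of x] by simp
    qed
    then have "\<not> (\<integral>x. poly (P - Q) (x $ 1) \<partial>M) < e" using no by blast
    then show ?thesis using polyint by (simp add: poly_diff)
  qed
  have one: "\<forall>x. ?f x \<le> poly 1 (x $ 1)" "\<forall>x. poly 0 (x $ 1) \<le> ?f x"
    by (auto simp: field_simps add_pos_nonneg)
  have bdd: "bdd_above ?L"
  proof (rule bdd_aboveI)
    fix c assume "c \<in> ?L"
    then obtain Q where Q: "c = (\<integral>x. poly Q (x $ 1) \<partial>M)" "\<forall>x. poly Q (x $ 1) \<le> ?f x" by blast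
    show "c \<le> (\<integral>x. poly 1 (x $ 1) \<partial>M)" using gap[OF Q(2) one(1)] e unfolding Q(1) by linarith
  qed
  have ne: "?L \<noteq> {}" using one(2) by blast
  have rep: "\<exists>M'. represents M' (\<lambda>\<alpha> :: nat ^ 1. t (\<alpha> $ 1)) \<and> (\<integral>x. ?f x \<partial>M') = \<beta>"
    if \<beta>: "Sup ?L \<le> \<beta>" "\<beta> \<le> Sup ?L + e" for \<beta>
  proof -
    let ?H = "adjoin G ?f \<beta>"
    have sub: "G \<subseteq> ?H" by (rule subset_adjoin)
    have "\<exists>M'. sets M' = sets borel \<and> (\<forall>f a. (f, a) \<in> ?H \<longrightarrow> integrable M' f \<and> integral\<^sup>L M' f = a)"
    proof (rule ex_representing_measure_unnormalized)
      show "linear_graph ?H" by (rule linear_graph_adjoin[OF lin])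
      show "positive_on UNIV ?H"
      proof (rule positive_on_adjoin[OF lin pos])
        fix v a assume va: "(v, a) \<in> G"
        then obtain P where P: "v = (\<lambda>x. poly P (x $ 1))" "a = (\<integral>x. poly P (x $ 1) \<partial>M)" by (auto simp: G_def)
        show "a \<le> \<beta>" if "\<And>x. x \<in> UNIV \<Longrightarrow> v x \<le> ?f x"
        proof -
          have "a \<in> ?L" unfolding P(2) using that by (auto simp: P(1))
          then have "a \<le> Sup ?L" by (rule cSup_upper[OF _ bdd])
          then show ?thesis using \<beta>(1) by simp
        qed
        show "\<beta> \<le> a" if up: "\<And>x. x \<in> UNIV \<Longrightarrow> ?f x \<le> v x"
        proof -
          have "Sup ?L \<le> a - e"
          proof (rule cSup_least[OF ne])
            fix c assume "c \<in> ?L"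
            then obtain Q where Q: "c = (\<integral>x. poly Q (x $ 1) \<partial>M)" "\<forall>x. poly Q (x $ 1) \<le> ?f x" by blast
            show "c \<le> a - e" using gap[OF Q(2), of P] up unfolding P Q(1) by auto
          qed
          then show ?thesis using \<beta>(2) by simp
        qed
      qed
      show "((\<lambda>_. 1), \<integral>x. poly 1 (x $ 1) \<partial>M) \<in> ?H" using sub G_I[of 1] by auto
      show "((\<lambda>x. poly [:1, 0, 1:] (x $ 1)), \<integral>x. poly [:1, 0, 1:] (x $ 1) \<partial>M) \<in> ?H"
        using sub G_I[of "[:1, 0, 1:]"] by auto
      show "norm x \<le> poly [:1, 0, 1:] (x $ 1)" for x :: "real ^ 1"
      proof -
        have "0 \<le> (\<bar>x $ 1\<bar> - 1)\<^sup>2 + (x $ 1)\<^sup>2" by simp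
        then show ?thesis by (simp add: norm_real_1 power2_diff) (simp add: power2_eq_square)
      qed
      fix f a assume "(f, a) \<in> ?H"
      then obtain P c where P: "f = (\<lambda>x. poly P (x $ 1) + c * ?f x)" unfolding adjoin_def G_def by auto
      show "continuous_on UNIV f" unfolding P
        by (intro continuous_intros) (auto simp: add_nonneg_eq_0_iff)
      have "(f x)\<^sup>2 \<le> poly (2 * P\<^sup>2 + [:2 * c\<^sup>2:]) (x $ 1)" for x
      proof -
        have "(c * ?f x)\<^sup>2 \<le> c\<^sup>2"
        proof -
          have "0 \<le> ?f x" "?f x \<le> 1" by (auto simp: field_simps add_pos_nonneg)
          then have "c\<^sup>2 * (?f x)\<^sup>2 \<le> c\<^sup>2 * 1" by (intro mult_left_mono power_le_one) auto
          then show ?thesis by (simp only: power_mult_distrib mult_1_right)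
        qed
        moreover have "(f x)\<^sup>2 \<le> 2 * (poly P (x $ 1))\<^sup>2 + 2 * (c * ?f x)\<^sup>2"
          using sum_squares_bound[of "poly P (x $ 1)" "c * ?f x"] unfolding P power2_sum by linarith
        ultimately show ?thesis by simp
      qed
      then show "\<exists>v c. (v, c) \<in> ?H \<and> (\<forall>x. (f x)\<^sup>2 \<le> v x)" using sub G_I by blast
    qed
    then obtain M' where M'1: "sets M' = sets borel"
      and "\<forall>f a. (f, a) \<in> ?H \<longrightarrow> integrable M' f \<and> integral\<^sup>L M' f = a" by (elim exE conjE)
    note M' = this(1) this(2)[rule_format]
    have mono: "((\<lambda>x. monomial \<alpha> x), \<integral>x. monomial \<alpha> x \<partial>M) \<in> ?H" for \<alpha>
      using subsetD[OF sub G_I[of "monom 1 (\<alpha> $ 1)"]] unfolding monomial_1 by (simp only: poly_monom mult_1)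
    have "represents M' (\<lambda>\<alpha> :: nat ^ 1. t (\<alpha> $ 1))"
      unfolding represents_def
    proof (intro conjI allI)
      show "M' \<in> moment_measures"
        unfolding moment_measures_def mem_Collect_eq
        by (intro conjI allI M'(1) M'(2)[OF mono, THEN conjunct1])
      fix \<alpha> :: "nat ^ 1"
      have 1: "t (\<alpha> $ 1) = complex_of_real (integral\<^sup>L M (monomial \<alpha>))"
        by (rule M[unfolded represents_def, THEN conjunct2, THEN spec])
      have 2: "integral\<^sup>L M' (monomial \<alpha>) = integral\<^sup>L M (monomial \<alpha>)"
        by (rule M'(2)[OF mono[of \<alpha>], THEN conjunct2])
      show "t (\<alpha> $ 1) = complex_of_real (\<integral>x. monomial \<alpha> x \<partial>M')" 
        by (rule trans[OF 1 arg_cong[OF 2[symmetric], of complex_of_real]])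
    qed
    moreover have "(\<integral>x. ?f x \<partial>M') = \<beta>"
      by (rule M'(2)[OF adjoin_self[OF lin Gne], THEN conjunct2])
    ultimately show ?thesis by blast
  qed
  \<comment> \<open>The two ends of the gap give representing measures with different integrals of
    \<open>?f\<close>, against determinacy.\<close>
  obtain M1 where M1: "represents M1 (\<lambda>\<alpha> :: nat ^ 1. t (\<alpha> $ 1))" "(\<integral>x. ?f x \<partial>M1) = Sup ?L"
    using rep[of "Sup ?L"] e by auto
  obtain M2 where M2: "represents M2 (\<lambda>\<alpha> :: nat ^ 1. t (\<alpha> $ 1))" "(\<integral>x. ?f x \<partial>M2) = Sup ?L + e"
    using rep[of "Sup ?L + e"] e by auto
  have unique: "\<exists>!N. represents N (\<lambda>\<alpha> :: nat ^ 1. t (\<alpha> $ 1))"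
    using det unfolding determinate1_def determinate_def .
  have "M1 = M2" by (rule trans[OF the1_equality[OF unique M1(1), symmetric] the1_equality[OF unique M2(1)]])
  then have "(\<integral>x. ?f x \<partial>M2) = Sup ?L" using M1(2) by (rule subst)
  then show False using M2(2) e by linarith
qed

text \<open>
  Sandwiching gives \<open>(1 + x\<^sup>2) P - 1 = \<bar>\<tau>\<bar>\<^sup>2\<close> and \<open>1 - (1 + x\<^sup>2) Q = \<bar>\<rho>\<bar>\<^sup>2\<close> with \<open>\<integral> (\<bar>\<tau>\<bar>\<^sup>2 + \<bar>\<rho>\<bar>\<^sup>2) / (1 + x\<^sup>2)\<close> small. The combination
  \<open>u\<close> of \<open>\<tau>\<close> and \<open>\<rho>\<close> that vanishes at \<open>-\<i>\<close> is \<open>(x + \<i>) w\<close>. The products \<open>\<tau>(\<i>) cnj (\<tau>(-\<i>))\<close> and \<open>\<rho>(\<i>) cnj (\<rho>(-\<i>))\<close> have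
  modulus 1, so once \<open>\<bar>\<tau>(-\<i>)\<bar> \<le> 1\<close>, which can be had by passing to the conjugate polynomial, \<open>w(\<i>)\<close> is not
  small compared to the norm of \<open>w\<close>.
\<close>

lemma determinate1_small_polynomial:
  fixes t :: "nat \<Rightarrow> complex"
  assumes det: "determinate1 t" and e: "e > 0"
  shows "\<exists>w :: complex poly. poly w \<i> = 1 \<and>
    Re (\<Sum>a\<le>degree w. \<Sum>b\<le>degree w. coeff w a * cnj (coeff w b) * t (a + b)) < e"
proof -
  obtain M where M: "represents M (\<lambda>\<alpha> :: nat ^ 1. t (\<alpha> $ 1))"
    using det by (auto simp: determinate1_def determinate_def)
  have monint: "integrable M (monomial \<alpha>)" for \<alpha> using M by (auto simp: represents_def moment_measures_def)
  have powint: "integrable M (\<lambda>x. (x $ 1) ^ n)" for n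
    using monint[of "\<chi> i. n"] by (simp add: monomial_1[abs_def])
  have polyint: "integrable M (\<lambda>x. poly P (x $ 1))" for P
    unfolding poly_altdef by (intro Bochner_Integration.integrable_sum integrable_mult_right powint)
  have t: "t n = of_real (\<integral>x. (x $ 1) ^ n \<partial>M)" for n
  proof -
    have "t ((\<chi> i. n) $ (1 :: 1)) = of_real (\<integral>x. monomial (\<chi> i. n) x \<partial>M)"
      using M unfolding represents_def by blast
    then show ?thesis by (simp add: monomial_1)
  qed
  \<comment> \<open>The quarter anticipates the factor 4 lost when \<open>w\<close> is normalised to
    the value 1 at \<open>\<i>\<close>.\<close>
  obtain P Q :: "real poly" where PQ: "\<And>x. poly Q x \<le> 1 / (1 + x\<^sup>2)" "\<And>x. 1 / (1 + x\<^sup>2) \<le> poly P x"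
    and small: "(\<integral>x. poly (P - Q) (x $ 1) \<partial>M) < e / 4"
    using determinate1_sandwich[OF det M, of "e / 4"] e by auto
  let ?c = "map_poly complex_of_real"
  let ?d = "[:1, 0, 1:] :: complex poly"
  have cpoly: "poly (?c R) (of_real x) = of_real (poly R x)" for R x
    by (simp add: poly_altdef degree_map_poly coeff_map_poly)
  have d: "poly ?d (of_real x) = of_real (1 + x\<^sup>2)" for x by (simp add: power2_eq_square)
  have pos: "1 + x\<^sup>2 > 0" for x :: real by (simp add: add_pos_nonneg)
  have "\<exists>\<tau>. ?d * ?c P - 1 = \<tau> * conj_poly \<tau>"
  proof (rule nonneg_poly_eq_mult_conj)
    fix x
    have "poly (?d * ?c P - 1) (of_real x) = of_real ((1 + x\<^sup>2) * poly P x - 1)"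
      by (simp only: poly_diff poly_mult d cpoly of_real_diff of_real_mult poly_1 of_real_1)
    moreover have "(1 + x\<^sup>2) * poly P x - 1 \<ge> 0" using PQ(2)[of x] pos[of x] by (simp add: field_simps)
    ultimately show "poly (?d * ?c P - 1) (of_real x) \<in> \<real>\<^sub>\<ge>\<^sub>0" by (simp only: nonneg_Reals_of_real_iff)
  qed
  then obtain \<tau>0 where \<tau>0: "?d * ?c P - 1 = \<tau>0 * conj_poly \<tau>0" ..
  have "\<exists>\<rho>. 1 - ?d * ?c Q = \<rho> * conj_poly \<rho>"
  proof (rule nonneg_poly_eq_mult_conj)
    fix x
    have "poly (1 - ?d * ?c Q) (of_real x) = of_real (1 - (1 + x\<^sup>2) * poly Q x)"
      by (simp only: poly_diff poly_mult d cpoly of_real_diff of_real_mult poly_1 of_real_1)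
    moreover have "1 - (1 + x\<^sup>2) * poly Q x \<ge> 0" using PQ(1)[of x] pos[of x] by (simp add: field_simps)
    ultimately show "poly (1 - ?d * ?c Q) (of_real x) \<in> \<real>\<^sub>\<ge>\<^sub>0" by (simp only: nonneg_Reals_of_real_iff)
  qed
  then obtain \<rho> where \<rho>: "1 - ?d * ?c Q = \<rho> * conj_poly \<rho>" ..
  have di: "poly ?d \<i> = 0" by simp
  have \<tau>0i: "poly \<tau>0 \<i> * cnj (poly \<tau>0 (- \<i>)) = - 1"
    using arg_cong[OF \<tau>0, of "\<lambda>p. poly p \<i>"] by (simp only: poly_diff poly_mult di poly_conj_poly) simp
  have \<rho>i: "poly \<rho> \<i> * cnj (poly \<rho> (- \<i>)) = 1"
    using arg_cong[OF \<rho>, of "\<lambda>p. poly p \<i>"] by (simp only: poly_diff poly_mult di poly_conj_poly) simp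
  \<comment> \<open>The moduli at \<open>\<i>\<close> and \<open>- \<i>\<close> have product 1, so
    one of them is at most 1; conjugating the coefficients interchanges them.\<close>
  obtain \<tau> where \<tau>: "?d * ?c P - 1 = \<tau> * conj_poly \<tau>" "cmod (poly \<tau> (- \<i>)) \<le> 1"
  proof (cases "cmod (poly \<tau>0 (- \<i>)) \<le> 1")
    case True then show ?thesis using \<tau>0 that by blast
  next
    case False
    have "cmod (poly \<tau>0 \<i>) * cmod (poly \<tau>0 (- \<i>)) = 1"
      using arg_cong[OF \<tau>0i, of cmod] by (simp add: norm_mult)
    then have "cmod (poly \<tau>0 \<i>) \<le> 1" using False
      by (smt (verit) mult_le_cancel_left1 mult_left_le norm_ge_zero)
    then have "cmod (poly (conj_poly \<tau>0) (- \<i>)) \<le> 1" by (simp add: poly_conj_poly)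
    moreover have "conj_poly (conj_poly \<tau>0) = \<tau>0" by (intro poly_eqI) (simp add: coeff_conj_poly)
    ultimately show ?thesis using that[of "conj_poly \<tau>0"] \<tau>0 by (simp add: mult.commute)
  qed
  have \<tau>i: "poly \<tau> \<i> * cnj (poly \<tau> (- \<i>)) = - 1"
    using arg_cong[OF \<tau>(1), of "\<lambda>p. poly p \<i>"] by (simp only: poly_diff poly_mult di poly_conj_poly) simp
  define a b where "a = poly \<tau> (- \<i>)" and "b = poly \<rho> (- \<i>)"
  have ab0: "a \<noteq> 0" "b \<noteq> 0" using \<tau>i \<rho>i unfolding a_def b_def by auto
  \<comment> \<open>The values at \<open>- \<i>\<close> are used crosswise as coefficients, which
    forces the root \<open>- \<i>\<close>.\<close>
  define u where "u = smult b \<tau> - smult a \<rho>"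
  have "poly u (- \<i>) = 0" by (simp add: u_def a_def b_def)
  then obtain w where w: "u = [:\<i>, 1:] * w" using poly_eq_0_iff_dvd[of u "- \<i>"] by (auto elim: dvdE)
  define N where "N = (cmod a)\<^sup>2 + (cmod b)\<^sup>2"
  have N: "N > 0" using ab0 by (simp add: N_def add_pos_pos)
  \<comment> \<open>From \<open>u = (x + \<i>) * w\<close> one has
    \<open>u(\<i>) = 2 * \<i> * w(\<i>)\<close>, and the product identities at \<open>\<i>\<close>
    express \<open>u(\<i>)\<close> through \<open>a\<close> and \<open>b\<close> alone.\<close>
  have wi: "cmod (poly w \<i>) = N / (2 * cmod a * cmod b)"
  proof -
    have 1: "poly \<tau> \<i> = - 1 / cnj a" "poly \<rho> \<i> = 1 / cnj b"
      using \<tau>i \<rho>i ab0 unfolding a_def[symmetric] b_def[symmetric] by (simp_all add: field_simps)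
    have "2 * \<i> * poly w \<i> = b * (- 1 / cnj a) - a * (1 / cnj b)"
      using arg_cong[OF w, of "\<lambda>p. poly p \<i>"] by (simp add: u_def 1 algebra_simps)
    also have "\<dots> = - (b * cnj b + a * cnj a) / (cnj a * cnj b)" using ab0 by (simp add: field_simps)
    also have "b * cnj b + a * cnj a = of_real N"
      by (simp add: N_def complex_norm_square[symmetric] del: of_real_power)
    finally have "cmod (2 * \<i> * poly w \<i>) = N / (cmod a * cmod b)"
      using N by (simp add: norm_mult norm_divide)
    then show ?thesis by (simp add: norm_mult field_simps)
  qed
  then have wi0: "poly w \<i> \<noteq> 0" using N ab0 by auto
  define v where "v = smult (1 / poly w \<i>) w"
  have sumsq: "(cmod (poly \<tau> (of_real x)))\<^sup>2 + (cmod (poly \<rho> (of_real x)))\<^sup>2 = (1 + x\<^sup>2) * poly (P - Q) x" for x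
  proof -
    have "complex_of_real ((cmod (poly \<tau> (of_real x)))\<^sup>2 + (cmod (poly \<rho> (of_real x)))\<^sup>2)
      = poly (\<tau> * conj_poly \<tau> + \<rho> * conj_poly \<rho>) (of_real x)"
      unfolding of_real_add complex_norm_square by (simp add: poly_conj_poly)
    also have "\<dots> = poly (?d * (?c P - ?c Q)) (of_real x)"
      unfolding \<tau>(1)[symmetric] \<rho>[symmetric] by (simp add: algebra_simps)
    also have "\<dots> = of_real ((1 + x\<^sup>2) * poly (P - Q) x)"
      by (simp only: poly_mult d poly_diff cpoly of_real_mult of_real_diff)
    finally show ?thesis by (simp only: of_real_eq_iff)
  qed
  \<comment> \<open>Cauchy-Schwarz for \<open>b * \<tau> - a * \<rho>\<close> produces
    \<open>N\<close> times the sum in \<open>sumsq\<close>; the factor \<open>1 + x^2\<close> then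
    cancels.\<close>
  have w_le: "(cmod (poly w (of_real x)))\<^sup>2 \<le> N * poly (P - Q) x" for x
  proof -
    define T R where "T = cmod (poly \<tau> (of_real x))" and "R = cmod (poly \<rho> (of_real x))"
    have "(1 + x\<^sup>2) * (cmod (poly w (of_real x)))\<^sup>2 = (cmod (poly u (of_real x)))\<^sup>2"
    proof -
      have "(cmod (\<i> + of_real x))\<^sup>2 = 1 + x\<^sup>2" by (simp add: cmod_power2)
      then show ?thesis unfolding w by (simp add: norm_mult power_mult_distrib flip: distrib_right)
    qed
    also have "\<dots> \<le> (cmod b * T + cmod a * R)\<^sup>2"
      unfolding u_def T_def R_def
      by (intro power_mono) (use norm_triangle_ineq4[of "b * poly \<tau> (of_real x)" "a * poly \<rho> (of_real x)"] in \<open>simp_all add: norm_mult\<close>)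
    also have "\<dots> \<le> N * (T\<^sup>2 + R\<^sup>2)"
      using zero_le_power2[of "cmod b * R - cmod a * T"] by (simp add: N_def power2_eq_square algebra_simps)
    also have "\<dots> = (1 + x\<^sup>2) * (N * poly (P - Q) x)" using sumsq[of x] by (simp add: T_def R_def)
    finally show ?thesis using pos[of x] by simp
  qed
  have v_le: "(cmod (poly v (of_real x)))\<^sup>2 \<le> 4 * poly (P - Q) x" for x
  proof -
    have PQ0: "0 \<le> poly (P - Q) x" using PQ[of x] by simp
    have "(cmod (poly v (of_real x)))\<^sup>2 = (cmod (poly w (of_real x)))\<^sup>2 / (cmod (poly w \<i>))\<^sup>2"
      by (simp add: v_def norm_mult norm_divide power_divide)
    also have "\<dots> \<le> N * poly (P - Q) x / (cmod (poly w \<i>))\<^sup>2"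
      by (intro divide_right_mono w_le) simp
    also have "\<dots> = 4 * poly (P - Q) x * ((cmod a)\<^sup>2 * (cmod b)\<^sup>2 / N)"
      unfolding wi using N ab0 by (simp add: field_simps power2_eq_square)
    also have "\<dots> \<le> 4 * poly (P - Q) x * 1"
    proof (intro mult_left_mono)
      have "(cmod a)\<^sup>2 * (cmod b)\<^sup>2 \<le> 1 * (cmod b)\<^sup>2"
        using \<tau>(2) by (intro mult_right_mono) (auto simp: a_def power_le_one)
      also have "\<dots> \<le> N" by (simp add: N_def)
      finally show "(cmod a)\<^sup>2 * (cmod b)\<^sup>2 / N \<le> 1" using N by simp
    qed (use PQ0 in simp)
    finally show ?thesis by simp
  qed
  have vx: "(cmod (poly v (of_real x)))\<^sup>2 =
      (\<Sum>a\<le>degree v. \<Sum>b\<le>degree v. Re (coeff v a * cnj (coeff v b)) * x ^ (a + b))" for x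
  proof -
    have "complex_of_real ((cmod (poly v (of_real x)))\<^sup>2) =
       (\<Sum>a\<le>degree v. \<Sum>b\<le>degree v. coeff v a * cnj (coeff v b) * of_real (x ^ (a + b)))"
      unfolding complex_norm_square poly_altdef cnj_sum sum_product
      by (intro sum.cong refl) (simp add: power_add)
    from arg_cong[OF this, of Re] show ?thesis
      by (simp only: Re_complex_of_real Re_sum times_complex.sel Im_complex_of_real mult_zero_right diff_zero)
  qed
  have "Re (\<Sum>a\<le>degree v. \<Sum>b\<le>degree v. coeff v a * cnj (coeff v b) * t (a + b)) =
     (\<Sum>a\<le>degree v. \<Sum>b\<le>degree v. Re (coeff v a * cnj (coeff v b)) * (\<integral>x. (x $ 1) ^ (a + b) \<partial>M))"
    unfolding t by (simp only: Re_complex_of_real Re_sum times_complex.sel Im_complex_of_real mult_zero_right diff_zero)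
  also have "\<dots> = (\<integral>x. (cmod (poly v (of_real (x $ 1))))\<^sup>2 \<partial>M)"
    unfolding vx using powint by simp
  also have "\<dots> \<le> (\<integral>x. 4 * poly (P - Q) (x $ 1) \<partial>M)"
  proof (rule integral_mono)
    show "integrable M (\<lambda>x. (cmod (poly v (of_real (x $ 1))))\<^sup>2)"
      unfolding vx by (intro Bochner_Integration.integrable_sum integrable_mult_right powint)
    show "integrable M (\<lambda>x. 4 * poly (P - Q) (x $ 1))"
      by (intro integrable_mult_right polyint)
  qed (rule v_le)
  also have "\<dots> = 4 * (\<integral>x. poly (P - Q) (x $ 1) \<partial>M)" by (rule integral_mult_right_zero)
  also have "\<dots> < e" using small by linarith
  finally have "Re (\<Sum>a\<le>degree v. \<Sum>b\<le>degree v. coeff v a * cnj (coeff v b) * t (a + b)) < e" .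
  moreover have "poly v \<i> = 1" using wi0 by (simp add: v_def)
  ultimately show ?thesis by blast
qed

section \<open>Polynomials in several variables and the inner product of a positive semi-definite sequence\<close>

type_synonym 'd mpoly = "(nat ^ 'd) \<Rightarrow>\<^sub>0 complex"

lemma poly_mapping_sum_single:
  fixes p :: "'a \<Rightarrow>\<^sub>0 'b::comm_monoid_add"
  shows "p = (\<Sum>\<alpha>\<in>Poly_Mapping.keys p. Poly_Mapping.single \<alpha> (Poly_Mapping.lookup p \<alpha>))"
  by (rule poly_mapping_eqI) (auto simp: lookup_sum lookup_single when_def in_keys_iff)

lemma poly_mapping_add_induct [case_names zero single add]:
  fixes p :: "'a \<Rightarrow>\<^sub>0 'b::comm_monoid_add"
  assumes zero: "P 0" and single: "\<And>\<alpha> c. P (Poly_Mapping.single \<alpha> c)" and add: "\<And>p q. P p \<Longrightarrow> P q \<Longrightarrow> P (p + q)"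
  shows "P p"
proof -
  have "P (\<Sum>\<alpha>\<in>A. Poly_Mapping.single \<alpha> (Poly_Mapping.lookup p \<alpha>))" if "finite A" for A
    using that by (induction A) (auto intro: assms)
  then show ?thesis by (subst poly_mapping_sum_single) simp
qed

text \<open>Serves for the functional \<open>L\<close>, with \<open>\<phi> = s\<close>, as well as
  for evaluation at a point, with \<open>\<phi>\<close> the values of the monomials.\<close>

definition lin_ext :: "('a \<Rightarrow> complex) \<Rightarrow> ('a \<Rightarrow>\<^sub>0 complex) \<Rightarrow> complex" where
  "lin_ext \<phi> p = (\<Sum>\<alpha>\<in>Poly_Mapping.keys p. Poly_Mapping.lookup p \<alpha> * \<phi> \<alpha>)"

lemma lin_ext_superset:
  assumes "finite S" "Poly_Mapping.keys p \<subseteq> S"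
  shows "lin_ext \<phi> p = (\<Sum>\<alpha>\<in>S. Poly_Mapping.lookup p \<alpha> * \<phi> \<alpha>)"
  unfolding lin_ext_def by (rule sum.mono_neutral_left) (use assms in \<open>auto simp: in_keys_iff\<close>)

lemma lin_ext_add: "lin_ext \<phi> (p + q) = lin_ext \<phi> p + lin_ext \<phi> q"
proof -
  let ?S = "Poly_Mapping.keys p \<union> Poly_Mapping.keys q"
  have "finite ?S" "Poly_Mapping.keys (p + q) \<subseteq> ?S" by (simp, rule Poly_Mapping.keys_add)
  then show ?thesis
    by (simp add: lin_ext_superset[of ?S] lookup_add distrib_right sum.distrib)
qed

lemma lin_ext_single [simp]: "lin_ext \<phi> (Poly_Mapping.single \<alpha> c) = c * \<phi> \<alpha>"
  by (simp add: lin_ext_def)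

lemma lin_ext_0 [simp]: "lin_ext \<phi> 0 = 0"
  by (simp add: lin_ext_def)

lemma lin_ext_uminus: "lin_ext \<phi> (- p) = - lin_ext \<phi> p"
  using lin_ext_add[of \<phi> p "- p"] by (simp add: eq_neg_iff_add_eq_0 add.commute)

lemma lin_ext_diff: "lin_ext \<phi> (p - q) = lin_ext \<phi> p - lin_ext \<phi> q"
  using lin_ext_add[of \<phi> p "- q"] by (simp add: lin_ext_uminus)

lemma lin_ext_sum: "lin_ext \<phi> (\<Sum>i\<in>I. f i) = (\<Sum>i\<in>I. lin_ext \<phi> (f i))"
  by (induction I rule: infinite_finite_induct) (auto simp: lin_ext_add)

abbreviation const :: "complex \<Rightarrow> 'd::finite mpoly" where
  "const c \<equiv> Poly_Mapping.single 0 c"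

lemma const_mult: "const a * const b = const (a * b)"
  by (simp add: mult_single)

lemma lin_ext_const_mult: "lin_ext \<phi> (const c * p) = c * lin_ext \<phi> p"
  by (induction p rule: poly_mapping_add_induct) (auto simp: lin_ext_add mult_single algebra_simps)

definition star :: "'d::finite mpoly \<Rightarrow> 'd mpoly" where
  "star p = Poly_Mapping.map cnj p"

lemma lookup_star: "Poly_Mapping.lookup (star p) \<alpha> = cnj (Poly_Mapping.lookup p \<alpha>)"
  by (simp add: star_def Poly_Mapping.map.rep_eq when_def)

lemma star_simps [simp]:
  "star 0 = 0" "star (p + q) = star p + star q" "star (- p) = - star p" "star (p - q) = star p - star q"
  "star (star p) = p" "star (Poly_Mapping.single \<alpha> c) = Poly_Mapping.single \<alpha> (cnj c)" "star 1 = 1"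
  by (auto intro!: poly_mapping_eqI simp: lookup_star lookup_add lookup_minus lookup_single when_def lookup_one)

lemma star_mult [simp]: "star (p * q) = star p * star q"
proof (induction p rule: poly_mapping_add_induct)
  case (single \<alpha> c)
  show ?case by (induction q rule: poly_mapping_add_induct) (auto simp: mult_single distrib_left)
qed (auto simp: distrib_right)

lemma star_sum: "star (\<Sum>i\<in>I. f i) = (\<Sum>i\<in>I. star (f i))"
  by (induction I rule: infinite_finite_induct) auto

lemma star_power [simp]: "star (p ^ n) = star p ^ n"
  by (induction n) auto

lemma star_prod: "star (\<Prod>i\<in>I. f i) = (\<Prod>i\<in>I. star (f i))"
  by (induction I rule: infinite_finite_induct) auto

definition ev :: "'d::finite mpoly \<Rightarrow> real ^ 'd \<Rightarrow> complex" where
  "ev p x = lin_ext (\<lambda>\<alpha>. complex_of_real (monomial \<alpha> x)) p"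

lemma monomial_add: "monomial (\<alpha> + \<beta>) x = monomial \<alpha> x * monomial \<beta> x"
  by (simp add: monomial_def power_add prod.distrib)

lemma monomial_0 [simp]: "monomial 0 x = 1"
  by (simp add: monomial_def)

lemma ev_simps [simp]:
  "ev 0 x = 0" "ev (p + q) x = ev p x + ev q x" "ev (- p) x = - ev p x" "ev (p - q) x = ev p x - ev q x"
  "ev (Poly_Mapping.single \<alpha> c) x = c * of_real (monomial \<alpha> x)"
  by (simp_all add: ev_def lin_ext_add lin_ext_uminus lin_ext_diff)

lemma ev_1 [simp]: "ev 1 x = 1"
  using ev_simps(5)[of 0 1 x] by simp

lemma ev_mult [simp]: "ev (p * q) x = ev p x * ev q x"
proof (induction p rule: poly_mapping_add_induct)
  case (single \<alpha> c)
  show ?case by (induction q rule: poly_mapping_add_induct) (auto simp: mult_single distrib_left monomial_add)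
qed (auto simp: distrib_right)

lemma ev_star [simp]: "ev (star p) x = cnj (ev p x)"
  by (induction p rule: poly_mapping_add_induct) auto

lemma ev_power [simp]: "ev (p ^ n) x = ev p x ^ n"
  by (induction n) auto

lemma ev_sum: "ev (\<Sum>i\<in>I. f i) x = (\<Sum>i\<in>I. ev (f i) x)"
  by (induction I rule: infinite_finite_induct) auto

lemma ev_prod: "ev (\<Prod>i\<in>I. f i) x = (\<Prod>i\<in>I. ev (f i) x)"
  by (induction I rule: infinite_finite_induct) auto

definition var :: "'d::finite \<Rightarrow> 'd mpoly" where
  "var j = Poly_Mapping.single (axis j 1) 1"

definition var_plus :: "'d::finite \<Rightarrow> 'd mpoly" where
  "var_plus j = var j + const \<i>"

definition var_minus :: "'d::finite \<Rightarrow> 'd mpoly" where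
  "var_minus j = var j - const \<i>"

lemma monomial_axis: "monomial (axis j n) x = (x $ j) ^ n"
proof -
  have "monomial (axis j n) x = (\<Prod>i\<in>UNIV. if i = j then (x $ j) ^ n else 1)"
    unfolding monomial_def by (intro prod.cong refl) (auto simp: axis_def)
  then show ?thesis by simp
qed

lemma ev_var [simp]: "ev (var j) x = of_real (x $ j)"
  by (simp add: var_def monomial_axis)

lemma ev_var_plus [simp]: "ev (var_plus j) x = of_real (x $ j) + \<i>"
  and ev_var_minus [simp]: "ev (var_minus j) x = of_real (x $ j) - \<i>"
  by (simp_all add: var_plus_def var_minus_def)

lemma star_var [simp]: "star (var j) = var j" "star (var_plus j) = var_minus j" "star (var_minus j) = var_plus j"
  by (simp_all add: var_def var_plus_def var_minus_def single_uminus)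

lemma const_i_sq: "const \<i> * const \<i> = (- 1 :: 'd::finite mpoly)"
  by (simp add: mult_single single_uminus)

lemma var_plus_times_var_minus: "var_plus j * var_minus j = var j * var j + 1"
  by (simp add: var_plus_def var_minus_def algebra_simps const_i_sq)

section \<open>The semi-inner product of a positive semi-definite sequence\<close>

locale psd_sequence =
  fixes s :: "nat ^ 'd::finite \<Rightarrow> complex"
  assumes psd: "positive_semidefinite s"
begin

abbreviation L :: "'d mpoly \<Rightarrow> complex" where "L \<equiv> lin_ext s"

definition ip :: "'d mpoly \<Rightarrow> 'd mpoly \<Rightarrow> complex" where "ip p q = L (p * star q)"

text \<open>Only a seminorm: \<open>ip\<close> may be degenerate, and null vectors are never
  factored out.\<close>

definition nm :: "'d mpoly \<Rightarrow> real" where "nm p = sqrt (Re (ip p p))"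

lemma ip_eq_sum:
  "ip p q = (\<Sum>\<alpha>\<in>Poly_Mapping.keys p. \<Sum>\<beta>\<in>Poly_Mapping.keys q. s (\<alpha> + \<beta>) * Poly_Mapping.lookup p \<alpha> * cnj (Poly_Mapping.lookup q \<beta>))"
proof -
  have "p * star q = (\<Sum>\<alpha>\<in>Poly_Mapping.keys p. \<Sum>\<beta>\<in>Poly_Mapping.keys q.
      Poly_Mapping.single (\<alpha> + \<beta>) (Poly_Mapping.lookup p \<alpha> * cnj (Poly_Mapping.lookup q \<beta>)))"
  proof -
    have "p * star q = (\<Sum>\<alpha>\<in>Poly_Mapping.keys p. Poly_Mapping.single \<alpha> (Poly_Mapping.lookup p \<alpha>)) *
        star (\<Sum>\<beta>\<in>Poly_Mapping.keys q. Poly_Mapping.single \<beta> (Poly_Mapping.lookup q \<beta>))"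
      by (rule arg_cong2[of p _ q _ "\<lambda>a b. a * star b", OF poly_mapping_sum_single poly_mapping_sum_single])
    then show ?thesis by (simp add: star_sum sum_product mult_single)
  qed
  then show ?thesis unfolding ip_def by (simp add: lin_ext_sum ac_simps)
qed

lemma ip_self: "ip p p \<in> \<real>\<^sub>\<ge>\<^sub>0"
proof -
  have "{\<alpha>. Poly_Mapping.lookup p \<alpha> \<noteq> 0} = Poly_Mapping.keys p" by (auto simp: in_keys_iff)
  moreover from this have "finite {\<alpha>. Poly_Mapping.lookup p \<alpha> \<noteq> 0}" by simp
  ultimately show ?thesis
    using psd[unfolded positive_semidefinite_def, rule_format, of "Poly_Mapping.lookup p"] by (simp add: ip_eq_sum)
qed

lemma ip_nm: "ip p p = of_real ((nm p)\<^sup>2)"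
  using ip_self[of p] by (simp add: nm_def complex_nonneg_Reals_iff complex_eq_iff)

lemma nm_nonneg [simp]: "0 \<le> nm p"
  using ip_self[of p] by (simp add: nm_def complex_nonneg_Reals_iff)

text \<open>A priori the terms of \<open>s\<close> may be complex. But the form is real at 1, at
  \<open>x^\<gamma>\<close> and at their sum, and the mixed terms add up to
  \<open>2 * s \<gamma>\<close>.\<close>

lemma L_real: "Im (L p) = 0" if "star p = p" for p
proof -
  have "Im (s \<gamma>) = 0" for \<gamma>
  proof -
    let ?x = "Poly_Mapping.single \<gamma> (1 :: complex)"
    have "Im (ip (1 + ?x) (1 + ?x)) = 0" "Im (ip 1 1) = 0" "Im (ip ?x ?x) = 0"
      by (simp_all add: ip_nm del: of_real_power)
    moreover have "(1 + ?x) * star (1 + ?x) = 1 * star 1 + ?x * star ?x + (?x + ?x)"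
      by (simp add: algebra_simps)
    then have "ip (1 + ?x) (1 + ?x) = ip 1 1 + ip ?x ?x + (L ?x + L ?x)"
      by (simp only: ip_def lin_ext_add)
    ultimately show ?thesis by simp
  qed
  then have s: "cnj (s \<gamma>) = s \<gamma>" for \<gamma> by (simp add: complex_eq_iff)
  have "L (star q) = cnj (L q)" for q
    by (induction q rule: poly_mapping_add_induct) (auto simp: lin_ext_add s)
  from this[of p] that show ?thesis by (simp add: complex_eq_iff)
qed

lemma s_real: "Im (s \<alpha>) = 0"
  using L_real[of "Poly_Mapping.single \<alpha> 1"] by simp

lemma L_star: "L (star q) = cnj (L q)"
  by (induction q rule: poly_mapping_add_induct) (auto simp: lin_ext_add complex_eq_iff s_real)

lemma ip_sym: "ip q p = cnj (ip p q)"
  by (simp add: ip_def flip: L_star) (simp add: mult.commute)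

lemma ip_add_left: "ip (p + q) r = ip p r + ip q r"
  and ip_add_right: "ip r (p + q) = ip r p + ip r q"
  and ip_diff_left: "ip (p - q) r = ip p r - ip q r"
  and ip_diff_right: "ip r (p - q) = ip r p - ip r q"
  and ip_const_left: "ip (const c * p) r = c * ip p r"
  and ip_const_right: "ip r (const c * p) = cnj c * ip r p"
  by (simp_all add: ip_def distrib_left distrib_right left_diff_distrib right_diff_distrib lin_ext_add lin_ext_diff
      lin_ext_const_mult mult.assoc mult.left_commute[of _ "const _"])

lemma ip_0 [simp]: "ip 0 q = 0" "ip q 0 = 0"
  by (simp_all add: ip_def)

lemma ip_sum_left: "ip (\<Sum>i\<in>I. f i) q = (\<Sum>i\<in>I. ip (f i) q)"
  and ip_sum_right: "ip q (\<Sum>i\<in>I. f i) = (\<Sum>i\<in>I. ip q (f i))"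
  by (induction I rule: infinite_finite_induct) (simp_all add: ip_add_left ip_add_right ip_0)

lemma ip_mult_left: "ip (r * p) q = ip p (star r * q)"
  by (simp add: ip_def ac_simps)

text \<open>The discriminant argument with \<open>t * ip p q\<close> as coefficient; since
  \<open>nm q\<close> may be 0 without \<open>q = 0\<close>, that case is settled by a large
  \<open>t\<close>.\<close>

lemma cauchy_schwarz: "cmod (ip p q) \<le> nm p * nm q"
proof -
  define a b c where "a = (nm p)\<^sup>2" and "b = (nm q)\<^sup>2" and "c = ip p q"
  have pos: "0 \<le> a - 2 * t * (cmod c)\<^sup>2 + t\<^sup>2 * (cmod c)\<^sup>2 * b" for t :: real
  proof -
    let ?r = "p - const (of_real t * c) * q"
    have "ip ?r ?r = ip p p - of_real t * (c * cnj c) - of_real t * (c * cnj c) + (of_real t)\<^sup>2 * (c * cnj c) * ip q q"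
      unfolding ip_diff_left ip_diff_right ip_const_left ip_const_right ip_sym[of q p] c_def[symmetric]
      by (simp add: power2_eq_square algebra_simps)
    also have "\<dots> = of_real (a - 2 * t * (cmod c)\<^sup>2 + t\<^sup>2 * (cmod c)\<^sup>2 * b)"
      by (simp add: ip_nm a_def b_def complex_norm_square[symmetric] del: of_real_power) (simp add: algebra_simps)
    finally have "(nm ?r)\<^sup>2 = a - 2 * t * (cmod c)\<^sup>2 + t\<^sup>2 * (cmod c)\<^sup>2 * b"
      unfolding ip_nm of_real_eq_iff .
    then show ?thesis by (metis zero_le_power2)
  qed
  have "(cmod c)\<^sup>2 \<le> a * b"
  proof (cases "b = 0")
    case True
    have "(cmod c)\<^sup>2 = 0"
    proof (rule ccontr)
      assume "(cmod c)\<^sup>2 \<noteq> 0"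
      \<comment> \<open>At this \<open>t\<close> the inequality reads
        \<open>0 \<le> - 1\<close>.\<close>
      then show False using pos[of "(a + 1) / (2 * (cmod c)\<^sup>2)"] True by (simp add: field_simps)
    qed
    then show ?thesis using True by simp
  next
    case False
    then have "b > 0" by (simp add: b_def)
    then show ?thesis using pos[of "1 / b"] by (simp add: field_simps power2_eq_square)
  qed
  then have "(cmod c)\<^sup>2 \<le> (nm p * nm q)\<^sup>2" by (simp add: a_def b_def power_mult_distrib)
  then show ?thesis unfolding c_def by (rule power2_le_imp_le) simp
qed

lemma nm_triangle: "nm (p + q) \<le> nm p + nm q"
proof -
  have "complex_of_real ((nm (p + q))\<^sup>2) = ip (p + q) (p + q)" by (rule ip_nm[symmetric])
  also have "\<dots> = of_real ((nm p)\<^sup>2) + of_real ((nm q)\<^sup>2) + (ip p q + cnj (ip p q))"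
    unfolding ip_add_left ip_add_right ip_nm[symmetric] ip_sym[of q p] by (simp only: ac_simps)
  also have "\<dots> = of_real ((nm p)\<^sup>2 + (nm q)\<^sup>2 + 2 * Re (ip p q))"
    by (simp add: complex_eq_iff)
  finally have "(nm (p + q))\<^sup>2 = (nm p)\<^sup>2 + (nm q)\<^sup>2 + 2 * Re (ip p q)" unfolding of_real_eq_iff .
  also have "\<dots> \<le> (nm p + nm q)\<^sup>2"
    using complex_Re_le_cmod[of "ip p q"] cauchy_schwarz[of p q] by (simp add: power2_sum)
  finally show ?thesis by (rule power2_le_imp_le) simp
qed

lemma nm_eqI: "ip p p = ip q q \<Longrightarrow> nm p = nm q"
  by (simp add: nm_def)

lemma nm_uminus [simp]: "nm (- p) = nm p"
  by (rule nm_eqI) (simp add: ip_def)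

lemma nm_minus_commute: "nm (p - q) = nm (q - p)"
  using nm_uminus[of "p - q"] by simp

lemma nm_0 [simp]: "nm 0 = 0"
  by (simp add: nm_def ip_def)

lemma nm_const: "nm (const c * p) = cmod c * nm p"
proof -
  have "complex_of_real ((nm (const c * p))\<^sup>2) = c * (cnj c * ip p p)"
    by (simp only: ip_nm[symmetric] ip_const_left ip_const_right mult.left_commute[of "cnj c"])
  also have "\<dots> = of_real ((cmod c * nm p)\<^sup>2)"
    unfolding ip_nm power_mult_distrib of_real_mult complex_norm_square[symmetric]
    by (simp only: complex_norm_square ac_simps)
  finally have "(nm (const c * p))\<^sup>2 = (cmod c * nm p)\<^sup>2" unfolding of_real_eq_iff .
  then show ?thesis by (simp add: power2_eq_iff_nonneg)
qed

lemma nm_star [simp]: "nm (star p) = nm p"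
  by (rule nm_eqI) (simp add: ip_def mult.commute)

text \<open>The isometry behind the Cayley transform: \<open>star\<close> interchanges
  \<open>x_j + i\<close> and \<open>x_j - i\<close>, so both sides contain the same product.\<close>

lemma ip_var_plus: "ip (var_plus j * p) (var_plus j * q) = ip (var_minus j * p) (var_minus j * q)"
  by (simp add: ip_def ac_simps)

lemma nm_var_plus: "nm (var_plus j * p) = nm (var_minus j * p)"
  by (rule nm_eqI) (rule ip_var_plus)

text \<open>So \<open>nm (var_plus j * p)\<close> is the graph norm of multiplication by
  \<open>x_j\<close>, and graph norms are always written in this way.\<close>

lemma nm_var_plus_sq: "(nm (var_plus j * p))\<^sup>2 = (nm (var j * p))\<^sup>2 + (nm p)\<^sup>2"
proof -
  have "(var_plus j * p) * star (var_plus j * p) = (var_plus j * var_minus j) * (p * star p)"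
    by (simp add: ac_simps)
  also have "\<dots> = (var j * p) * star (var j * p) + p * star p"
    unfolding var_plus_times_var_minus by (simp add: algebra_simps)
  finally have "ip (var_plus j * p) (var_plus j * p) = ip (var j * p) (var j * p) + ip p p"
    by (simp only: ip_def lin_ext_add)
  then show ?thesis unfolding ip_nm of_real_add[symmetric] of_real_eq_iff .
qed

lemma nm_le_var_plus: "nm p \<le> nm (var_plus j * p)" "nm (var j * p) \<le> nm (var_plus j * p)"
  by (rule power2_le_imp_le; simp add: nm_var_plus_sq)+

end

section \<open>Dense ranges from determinate 1-sequences\<close>

lemma const_power: "const c ^ n = (const (c ^ n) :: 'd::finite mpoly)"
  by (induction n) (simp_all add: mult_single)

lemma const_sum: "const (\<Sum>i\<in>I. f i) = (\<Sum>i\<in>I. const (f i))"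
  by (induction I rule: infinite_finite_induct) (simp_all add: single_add)

lemma var_power: "var j ^ n = Poly_Mapping.single (axis j n) 1"
proof (induction n)
  case 0
  have "axis j 0 = (0 :: nat ^ 'a)" by (simp add: axis_def vec_eq_iff)
  then show ?case by (metis power_0 single_one)
next
  case (Suc n)
  have "axis j 1 + axis j n = (axis j (Suc n) :: nat ^ 'a)" by (simp add: axis_def vec_eq_iff)
  then show ?case by (simp only: power_Suc Suc) (simp add: var_def mult_single)
qed

lemma var_minus_dvd: "var_minus j dvd var j ^ n - const (\<i> ^ n)"
  unfolding const_power[symmetric] var_minus_def
  by (simp add: power_diff_sumr2)

lemma single_split:
  "Poly_Mapping.single \<beta> c = const c * (var j ^ (\<beta> $ j) * Poly_Mapping.single (upd \<beta> j 0) 1)"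
proof -
  have "axis j (\<beta> $ j) + upd \<beta> j 0 = \<beta>" by (simp add: axis_def upd_def vec_eq_iff)
  then show ?thesis by (simp add: var_power mult_single)
qed

context psd_sequence
begin

text \<open>By \<open>nm_var_plus_sq\<close> this is density of the range of \<open>X_j + i\<close>
  in the graph norm of \<open>X_l\<close>.\<close>

definition graph_dense :: "'d \<Rightarrow> 'd \<Rightarrow> bool" where
  "graph_dense l j \<longleftrightarrow> (\<forall>a e. 0 < e \<longrightarrow> (\<exists>c. nm (var_plus l * (a - var_plus j * c)) < e))"

definition range_dense :: "'d \<Rightarrow> bool" where
  "range_dense j \<longleftrightarrow> (\<forall>a e. 0 < e \<longrightarrow> (\<exists>c. nm (a - var_plus j * c) < e))"

lemma graph_dense_imp_range_dense: "graph_dense l j \<Longrightarrow> range_dense j"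
  unfolding graph_dense_def range_dense_def using nm_le_var_plus(1) le_less_trans by metis

lemma nm_add_less: "nm p < e / 2 \<Longrightarrow> nm q < e / 2 \<Longrightarrow> nm (p + q) < e"
  using nm_triangle[of p q] by linarith

text \<open>Approximate \<open>a\<close> by \<open>(X_l + i) b\<close>, then \<open>b\<close> by
  \<open>(X_j + i) q\<close> in the graph norm of \<open>X_l\<close>, so that the outer factor does
  not spoil the second error.\<close>

lemma double_range_dense:
  assumes "graph_dense l j" "range_dense l" "0 < e"
  shows "\<exists>q. nm (a - var_plus l * (var_plus j * q)) < e"
proof -
  obtain b where b: "nm (a - var_plus l * b) < e / 2"
    using assms(2) \<open>0 < e\<close> unfolding range_dense_def by (meson half_gt_zero)
  obtain q where q: "nm (var_plus l * (b - var_plus j * q)) < e / 2"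
    using assms(1) \<open>0 < e\<close> unfolding graph_dense_def by (meson half_gt_zero)
  have "a - var_plus l * (var_plus j * q) = (a - var_plus l * b) + var_plus l * (b - var_plus j * q)"
    by (simp add: algebra_simps)
  then show ?thesis using nm_add_less[OF b q] by metis
qed

text \<open>A polynomial with \<open>w(\<i>) = 1\<close> is congruent to 1 modulo
  \<open>x_j - i\<close>, so \<open>r * w(x_j)\<close> has the required form; its squared norm is
  the quadratic form of \<open>t\<close> at the coefficients of \<open>w\<close>, which
  \<open>determinate1_small_polynomial\<close> makes small.\<close>

lemma determinate1_small_element:
  assumes det: "determinate1 t" and t: "\<And>n. t n = L (var j ^ n * (r * star r))" and e: "0 < e"
  shows "\<exists>Q. nm (r * (1 - var_minus j * Q)) < e"
proof -
  obtain w where w: "poly w \<i> = 1"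
    "Re (\<Sum>a\<le>degree w. \<Sum>b\<le>degree w. coeff w a * cnj (coeff w b) * t (a + b)) < e\<^sup>2"
    using determinate1_small_polynomial[OF det, of "e\<^sup>2"] e by auto
  define W where "W = (\<Sum>a\<le>degree w. const (coeff w a) * var j ^ a)"
  have "var_minus j dvd (\<Sum>a\<le>degree w. const (coeff w a) * (var j ^ a - const (\<i> ^ a)))"
    by (intro dvd_sum dvd_mult var_minus_dvd)
  also have "\<dots> = W - (\<Sum>a\<le>degree w. const (coeff w a * \<i> ^ a))"
    by (simp add: W_def right_diff_distrib sum_subtractf const_mult)
  also have "(\<Sum>a\<le>degree w. const (coeff w a * \<i> ^ a)) = const (poly w \<i>)"
    unfolding poly_altdef const_sum ..
  finally obtain Q where Q: "W - 1 = var_minus j * Q" using w(1) by (auto simp: dvd_def)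
  have sW: "star W = (\<Sum>a\<le>degree w. const (cnj (coeff w a)) * var j ^ a)"
    by (simp add: W_def star_sum)
  have "ip (r * W) (r * W) = L (W * star W * (r * star r))" by (simp add: ip_def ac_simps)
  also have "W * star W = (\<Sum>a\<le>degree w. \<Sum>b\<le>degree w. const (coeff w a * cnj (coeff w b)) * var j ^ (a + b))"
    unfolding sW unfolding W_def sum_product
    by (intro sum.cong refl) (simp add: power_add const_mult[symmetric] ac_simps)
  finally have "ip (r * W) (r * W) = (\<Sum>a\<le>degree w. \<Sum>b\<le>degree w. coeff w a * cnj (coeff w b) * t (a + b))"
    by (simp add: sum_distrib_right lin_ext_sum mult.assoc lin_ext_const_mult t)
  with w(2) have "Re (complex_of_real ((nm (r * W))\<^sup>2)) < e\<^sup>2" unfolding ip_nm by simp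
  then have "nm (r * W) < e" using e power2_less_imp_less[of "nm (r * W)" e] by simp
  moreover have "W = 1 - var_minus j * (- Q)"
    using Q by (simp add: algebra_simps)
  ultimately show ?thesis by metis
qed

text \<open>The polynomials that can be approximated by multiples of \<open>x_j - i\<close> form a
  subspace containing the ideal of \<open>x_j - i\<close>. Modulo this ideal \<open>x_j\<close>
  becomes a constant, so monomials \<open>x^\<alpha>\<close> without \<open>x_j\<close> suffice. For
  these take \<open>r = (x_l + i) x^\<alpha>\<close>: then \<open>r * star r\<close> is
  \<open>(x_l^2 + 1) x^(2 \<alpha>)\<close>, whence the shifted sums and the even indices.\<close>

lemma determinate_imp_graph_dense:
  assumes jl: "j \<noteq> l" and det: "\<And>k. (\<forall>i. even (k $ i)) \<Longrightarrow> determinate1 (shifted_sum s k l j)"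
  shows "graph_dense l j"
proof -
  let ?P = "\<lambda>a. \<forall>e>0. \<exists>c. nm (var_plus l * (a - var_minus j * c)) < e"
  have add: "?P (a + b)" if "?P a" "?P b" for a b
  proof (intro allI impI)
    fix e :: real assume e: "e > 0"
    obtain c d where c: "nm (var_plus l * (a - var_minus j * c)) < e / 2"
      and d: "nm (var_plus l * (b - var_minus j * d)) < e / 2" using \<open>?P a\<close> \<open>?P b\<close> e by (meson half_gt_zero)
    have "var_plus l * (a + b - var_minus j * (c + d)) =
      var_plus l * (a - var_minus j * c) + var_plus l * (b - var_minus j * d)" by (simp add: algebra_simps)
    then show "\<exists>c. nm (var_plus l * (a + b - var_minus j * c)) < e" using nm_add_less[OF c d] by metis
  qed
  have scale: "?P (const z * a)" if "?P a" for z a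
  proof (intro allI impI)
    fix e :: real assume e: "e > 0"
    then have "e / (1 + cmod z) > 0" by (simp add: add_pos_nonneg)
    then obtain c where c: "nm (var_plus l * (a - var_minus j * c)) < e / (1 + cmod z)" using \<open>?P a\<close> by blast
    have "var_plus l * (const z * a - var_minus j * (const z * c)) = const z * (var_plus l * (a - var_minus j * c))"
      by (simp add: algebra_simps)
    then have "nm (var_plus l * (const z * a - var_minus j * (const z * c))) = cmod z * nm (var_plus l * (a - var_minus j * c))"
      by (simp add: nm_const)
    also have "\<dots> \<le> (1 + cmod z) * nm (var_plus l * (a - var_minus j * c))"
      by (intro mult_right_mono) auto
    also have "\<dots> < e" using c by (simp add: field_simps add_pos_nonneg)
    finally show "\<exists>c. nm (var_plus l * (const z * a - var_minus j * c)) < e" by blast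
  qed
  have range: "?P (var_minus j * a)" for a by (intro allI impI exI[of _ a]) simp
  have base: "?P (Poly_Mapping.single \<alpha> 1)" if \<alpha>: "\<alpha> $ j = 0" for \<alpha>
  proof (intro allI impI)
    fix e :: real assume e: "e > 0"
    let ?r = "var_plus l * Poly_Mapping.single \<alpha> 1"
    have r: "?r * star ?r = (var l ^ 2 + 1) * Poly_Mapping.single (\<alpha> + \<alpha>) 1"
    proof -
      have "?r * star ?r = (var_plus l * var_minus l) * (Poly_Mapping.single \<alpha> 1 * Poly_Mapping.single \<alpha> 1)"
        by (simp add: ac_simps)
      then show ?thesis unfolding var_plus_times_var_minus by (simp add: mult_single power2_eq_square)
    qed
    have "\<exists>Q. nm (?r * (1 - var_minus j * Q)) < e"
    proof (rule determinate1_small_element[OF _ _ e])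
      show "determinate1 (shifted_sum s (\<alpha> + \<alpha>) l j)" by (rule det) simp
      fix n
      have "axis j n + (axis l 2 + (\<alpha> + \<alpha>)) = upd (upd (\<alpha> + \<alpha>) l ((\<alpha> + \<alpha>) $ l + 2)) j n"
        "axis j n + (\<alpha> + \<alpha>) = upd (\<alpha> + \<alpha>) j n"
        using \<alpha> jl by (auto simp: upd_def axis_def vec_eq_iff)
      then show "shifted_sum s (\<alpha> + \<alpha>) l j n = L (var j ^ n * (?r * star ?r))"
        unfolding r by (simp add: distrib_left distrib_right var_power mult_single lin_ext_add shifted_sum_def)
    qed
    then obtain Q where Q: "nm (?r * (1 - var_minus j * Q)) < e" ..
    have "?r * (1 - var_minus j * Q) = var_plus l * (Poly_Mapping.single \<alpha> 1 - var_minus j * (Poly_Mapping.single \<alpha> 1 * Q))"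
      by (simp add: algebra_simps)
    then show "\<exists>c. nm (var_plus l * (Poly_Mapping.single \<alpha> 1 - var_minus j * c)) < e" using Q by metis
  qed
  have all: "?P a" for a
  proof (induction a rule: poly_mapping_add_induct)
    case zero
    show ?case using range[of 0] by simp
  next
    case (single \<beta> c)
    let ?m = "Poly_Mapping.single (upd \<beta> j 0) (1 :: complex)"
    obtain R where R: "var j ^ (\<beta> $ j) - const (\<i> ^ (\<beta> $ j)) = var_minus j * R"
      using var_minus_dvd by (blast elim: dvdE)
    have "var j ^ (\<beta> $ j) * ?m = var_minus j * (R * ?m) + const (\<i> ^ (\<beta> $ j)) * ?m"
      using R by (simp add: algebra_simps)
    moreover have "?P ?m" by (rule base) (simp add: upd_def)
    ultimately have "?P (var j ^ (\<beta> $ j) * ?m)" using add[OF range scale] by simp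
    then show ?case unfolding single_split[of \<beta> c j] by (rule scale)
  qed (rule add)
  show ?thesis
    unfolding graph_dense_def
  proof (intro allI impI)
    fix a and e :: real assume "0 < e"
    then obtain c where "nm (var_plus l * (star a - var_minus j * c)) < e" using all by blast
    \<comment> \<open>Conjugation exchanges \<open>x_j - i\<close> for \<open>x_j + i\<close>; it
      also flips the sign in the factor of \<open>l\<close>, which the norm does not see.\<close>
    moreover have "star (var_plus l * (star a - var_minus j * c)) = var_minus l * (a - var_plus j * star c)"
      by simp
    ultimately have "nm (var_plus l * (a - var_plus j * star c)) < e"
      by (metis nm_star nm_var_plus)
    then show "\<exists>c. nm (var_plus l * (a - var_plus j * c)) < e" by blast
  qed
qed

end

section \<open>Commuting Cayley transforms\<close>

locale commuting_resolvents = psd_sequence s for s :: "nat ^ 'd::finite \<Rightarrow> complex" +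
  fixes e :: 'd
  assumes dense_graph: "\<And>j. j \<noteq> e \<Longrightarrow> graph_dense e j"
    and dense_double: "\<And>j l a d. j \<noteq> e \<Longrightarrow> l \<noteq> e \<Longrightarrow> j \<noteq> l \<Longrightarrow> 0 < d \<Longrightarrow>
      \<exists>q. nm (a - var_plus j * (var_plus l * q)) < d"
begin

definition eqv :: "(nat \<Rightarrow> 'd mpoly) \<Rightarrow> (nat \<Rightarrow> 'd mpoly) \<Rightarrow> bool" (infix "\<doteq>" 50) where
  "a \<doteq> b \<longleftrightarrow> (\<lambda>n. nm (a n - b n)) \<longlonglongrightarrow> 0"

definition bdd :: "(nat \<Rightarrow> 'd mpoly) \<Rightarrow> bool" where
  "bdd a \<longleftrightarrow> (\<exists>B. \<forall>n. nm (a n) \<le> B)"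

lemma eqv_refl [simp]: "a \<doteq> a"
  by (simp add: eqv_def)

lemma eqv_sym: "a \<doteq> b \<Longrightarrow> b \<doteq> a"
  by (simp add: eqv_def nm_minus_commute)

lemma eqv_dominated:
  assumes "X \<longlonglongrightarrow> 0" "\<And>n. nm (a n - b n) \<le> X n" shows "a \<doteq> b"
  unfolding eqv_def by (rule tendsto_sandwich[OF _ _ tendsto_const assms(1)]) (use assms(2) in auto)

lemma eqv_trans [trans]: assumes "a \<doteq> b" "b \<doteq> c" shows "a \<doteq> c"
proof (rule eqv_dominated)
  show "(\<lambda>n. nm (a n - b n) + nm (b n - c n)) \<longlonglongrightarrow> 0"
    using tendsto_add[OF assms[unfolded eqv_def]] by simp
  show "nm (a n - c n) \<le> nm (a n - b n) + nm (b n - c n)" for n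
    using nm_triangle[of "a n - b n" "b n - c n"] by simp
qed

lemma eqv_eq_trans [trans]: "a \<doteq> b \<Longrightarrow> b = c \<Longrightarrow> a \<doteq> c" "a = b \<Longrightarrow> b \<doteq> c \<Longrightarrow> a \<doteq> c"
  by simp_all

lemma bdd_const [simp]: "bdd (\<lambda>_. f)"
  by (auto simp: bdd_def)

text \<open>Boundedness is asked of \<open>a'\<close> and \<open>b\<close> because the difference
  telescopes as \<open>ip (a - a') b + ip a' (b - b')\<close>.\<close>

lemma ip_eqv:
  assumes "a \<doteq> a'" "b \<doteq> b'" "bdd a'" "bdd b"
  shows "(\<lambda>n. ip (a n) (b n) - ip (a' n) (b' n)) \<longlonglongrightarrow> 0"
proof -
  obtain A B where A: "\<And>n. nm (a' n) \<le> A" and B: "\<And>n. nm (b n) \<le> B"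
    using assms unfolding bdd_def by blast
  have "(\<lambda>n. nm (a n - a' n) * B + A * nm (b n - b' n)) \<longlonglongrightarrow> 0 * B + A * 0"
    using assms unfolding eqv_def by (intro tendsto_intros)
  then have lim: "(\<lambda>n. nm (a n - a' n) * B + A * nm (b n - b' n)) \<longlonglongrightarrow> 0" by simp
  show ?thesis
  proof (rule Lim_null_comparison[OF always_eventually lim], intro allI)
    fix n
    have "ip (a n) (b n) - ip (a' n) (b' n) = ip (a n - a' n) (b n) + ip (a' n) (b n - b' n)"
      by (simp add: ip_diff_left ip_diff_right)
    also have "cmod \<dots> \<le> nm (a n - a' n) * nm (b n) + nm (a' n) * nm (b n - b' n)"
      by (rule order_trans[OF norm_triangle_ineq add_mono[OF cauchy_schwarz cauchy_schwarz]])
    also have "\<dots> \<le> nm (a n - a' n) * B + A * nm (b n - b' n)"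
      by (intro add_mono mult_mono mult_left_mono mult_right_mono A B) auto
    finally show "norm (ip (a n) (b n) - ip (a' n) (b' n)) \<le> nm (a n - a' n) * B + A * nm (b n - b' n)" .
  qed
qed

text \<open>Termwise approximation of the Cayley transform \<open>(X\<^sub>j - \<i>)(X\<^sub>j + \<i>)\<^sup>-\<^sup>1\<close>; working modulo null
  sequences replaces the completion of the space of polynomials.\<close>

definition cayley :: "'d \<Rightarrow> (nat \<Rightarrow> 'd mpoly) \<Rightarrow> nat \<Rightarrow> 'd mpoly" where
  "cayley j a n = var_minus j * (SOME w. nm (var_plus e * (a n - var_plus j * w)) < 1 / real (Suc n))"

lemma cayley_obtain:
  assumes "j \<noteq> e"
  obtains w where "cayley j a = (\<lambda>n. var_minus j * w n)"
    "\<And>n. nm (var_plus e * (a n - var_plus j * w n)) < 1 / real (Suc n)"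
proof
  let ?w = "\<lambda>n. SOME w. nm (var_plus e * (a n - var_plus j * w)) < 1 / real (Suc n)"
  show "cayley j a = (\<lambda>n. var_minus j * ?w n)" by (simp add: cayley_def fun_eq_iff)
  fix n
  have "\<exists>w. nm (var_plus e * (a n - var_plus j * w)) < 1 / real (Suc n)"
    using dense_graph[OF assms] unfolding graph_dense_def by (metis of_nat_0_less_iff zero_less_Suc zero_less_divide_1_iff)
  then show "nm (var_plus e * (a n - var_plus j * ?w n)) < 1 / real (Suc n)" by (rule someI_ex)
qed

lemma inverse_Suc_tendsto: "(\<lambda>n. 1 / real (Suc n)) \<longlonglongrightarrow> 0"
  using LIMSEQ_inverse_real_of_nat by (simp add: inverse_eq_divide)

text \<open>The approximant chosen in \<open>cayley\<close> is immaterial: by isometry,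
  \<open>(X_j - i) w\<close> and \<open>(X_j - i) c\<close> are equivalent as soon as
  \<open>(X_j + i) w\<close> and \<open>(X_j + i) c\<close> are.\<close>

lemma cayley_range:
  assumes j: "j \<noteq> e" and c: "a \<doteq> (\<lambda>n. var_plus j * c n)"
  shows "cayley j a \<doteq> (\<lambda>n. var_minus j * c n)"
proof -
  obtain w where w: "cayley j a = (\<lambda>n. var_minus j * w n)"
    "\<And>n. nm (var_plus e * (a n - var_plus j * w n)) < 1 / real (Suc n)" using cayley_obtain[OF j] by blast
  show ?thesis unfolding w(1)
  proof (rule eqv_dominated)
    show "(\<lambda>n. 1 / real (Suc n) + nm (a n - var_plus j * c n)) \<longlonglongrightarrow> 0"
      using tendsto_add[OF inverse_Suc_tendsto c[unfolded eqv_def]] by simp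
    fix n
    have "nm (var_minus j * w n - var_minus j * c n) = nm (var_plus j * (w n - c n))"
      by (simp only: right_diff_distrib[symmetric] nm_var_plus)
    also have "\<dots> = nm ((var_plus j * w n - a n) + (a n - var_plus j * c n))" by (simp add: algebra_simps)
    also have "\<dots> \<le> nm (var_plus j * w n - a n) + nm (a n - var_plus j * c n)" by (rule nm_triangle)
    also have "nm (var_plus j * w n - a n) \<le> 1 / real (Suc n)"
      using w(2)[of n] nm_le_var_plus(1)[of "a n - var_plus j * w n" e] by (simp add: nm_minus_commute)
    finally show "nm (var_minus j * w n - var_minus j * c n) \<le> 1 / real (Suc n) + nm (a n - var_plus j * c n)" by simp
  qed
qed

text \<open>Since the defining approximation is in the graph norm of \<open>X_e\<close>, it survives
  multiplication by \<open>x_e\<close>. The uniform bound 1 is for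
  \<open>bdd_cayley\<close>.\<close>

lemma cayley_preimage:
  assumes "j \<noteq> e"
  obtains w where "a \<doteq> (\<lambda>n. var_plus j * w n)" "(\<lambda>n. var e * a n) \<doteq> (\<lambda>n. var e * (var_plus j * w n))"
    "cayley j a = (\<lambda>n. var_minus j * w n)" "\<And>n. nm (a n - var_plus j * w n) \<le> 1"
proof -
  obtain w where w: "cayley j a = (\<lambda>n. var_minus j * w n)"
    "\<And>n. nm (var_plus e * (a n - var_plus j * w n)) < 1 / real (Suc n)" using cayley_obtain[OF assms] by blast
  have "nm (a n - var_plus j * w n) \<le> 1 / real (Suc n)" for n
    using w(2)[of n] nm_le_var_plus(1)[of "a n - var_plus j * w n" e] by simp
  moreover have "nm (var e * a n - var e * (var_plus j * w n)) \<le> 1 / real (Suc n)" for n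
    using w(2)[of n] nm_le_var_plus(2)[of e "a n - var_plus j * w n"] by (simp add: right_diff_distrib)
  moreover have "nm (a n - var_plus j * w n) \<le> 1" for n
    by (rule order_trans[OF calculation(1)]) simp
  ultimately show thesis
    by (intro that[OF eqv_dominated[OF inverse_Suc_tendsto] eqv_dominated[OF inverse_Suc_tendsto] w(1)])
qed

lemma cayley_cong: assumes "j \<noteq> e" "a \<doteq> b" shows "cayley j a \<doteq> cayley j b"
proof -
  obtain w where w: "b \<doteq> (\<lambda>n. var_plus j * w n)" "cayley j b = (\<lambda>n. var_minus j * w n)"
    using cayley_preimage[OF assms(1)] by metis
  show ?thesis unfolding w(2) by (rule cayley_range[OF assms(1) eqv_trans[OF assms(2) w(1)]])
qed

lemma bdd_cayley: assumes "j \<noteq> e" "bdd a" shows "bdd (cayley j a)"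
proof -
  obtain w where w: "cayley j a = (\<lambda>n. var_minus j * w n)" "\<And>n. nm (a n - var_plus j * w n) \<le> 1"
    using cayley_preimage[OF assms(1)] by metis
  obtain B where B: "\<And>n. nm (a n) \<le> B" using assms(2) by (auto simp: bdd_def)
  have "nm (var_minus j * w n) \<le> 1 + B" for n
    using nm_triangle[of "var_plus j * w n - a n" "a n"] w(2)[of n] B[of n]
    by (simp add: nm_var_plus nm_minus_commute[of "a n"])
  then show ?thesis unfolding w(1) bdd_def by blast
qed

lemma ip_cayley:
  assumes j: "j \<noteq> e" and "bdd a" "bdd b"
  shows "(\<lambda>n. ip (cayley j a n) (cayley j b n) - ip (a n) (b n)) \<longlonglongrightarrow> 0"
proof -
  obtain w where w: "a \<doteq> (\<lambda>n. var_plus j * w n)" "cayley j a = (\<lambda>n. var_minus j * w n)"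
    using cayley_preimage[OF j] by metis
  obtain v where v: "b \<doteq> (\<lambda>n. var_plus j * v n)" "cayley j b = (\<lambda>n. var_minus j * v n)"
    using cayley_preimage[OF j] by metis
  have "bdd (\<lambda>n. var_plus j * v n)" using bdd_cayley[OF j assms(3)] unfolding v(2) bdd_def nm_var_plus .
  from ip_eqv[OF eqv_sym[OF w(1)] eqv_sym[OF v(1)] assms(2) this]
  show ?thesis unfolding w(2) v(2) ip_var_plus .
qed

text \<open>On \<open>(X_j + i)(X_l + i) q\<close> both orders give
  \<open>(X_j - i)(X_l - i) q\<close>, and such elements are dense.\<close>

lemma cayley_commute:
  assumes "j \<noteq> e" "l \<noteq> e"
  shows "cayley j (cayley l a) \<doteq> cayley l (cayley j a)"
proof (cases "j = l")
  case False
  have "\<exists>q. nm (a n - var_plus j * (var_plus l * q)) < 1 / real (Suc n)" for n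
    by (rule dense_double[OF assms False]) simp
  then obtain q where q: "\<And>n. nm (a n - var_plus j * (var_plus l * q n)) < 1 / real (Suc n)" by metis
  have 1: "a \<doteq> (\<lambda>n. var_plus j * (var_plus l * q n))"
    by (rule eqv_dominated[OF inverse_Suc_tendsto less_imp_le[OF q]])
  then have 2: "a \<doteq> (\<lambda>n. var_plus l * (var_plus j * q n))" by (simp only: mult.left_commute)
  have "cayley l a \<doteq> (\<lambda>n. var_plus j * (var_minus l * q n))"
    using cayley_range[OF assms(2) 2] by (simp only: mult.left_commute)
  note 3 = cayley_range[OF assms(1) this]
  have "cayley j a \<doteq> (\<lambda>n. var_plus l * (var_minus j * q n))"
    using cayley_range[OF assms(1) 1] by (simp only: mult.left_commute)
  note 4 = cayley_range[OF assms(2) this]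
  have "(\<lambda>n. var_minus j * (var_minus l * q n)) = (\<lambda>n. var_minus l * (var_minus j * q n))"
    by (simp only: mult.left_commute)
  from eqv_trans[OF 3[unfolded this] eqv_sym[OF 4]] show ?thesis .
qed simp

text \<open>If \<open>(X_j + i) w\<close> approximates \<open>a\<close> even after multiplication by
  \<open>x_e\<close>, then \<open>x_e w\<close> is a preimage for \<open>x_e a\<close>.\<close>

lemma cayley_var:
  assumes "j \<noteq> e" shows "cayley j (\<lambda>n. var e * a n) \<doteq> (\<lambda>n. var e * cayley j a n)"
proof -
  obtain w where w: "(\<lambda>n. var e * a n) \<doteq> (\<lambda>n. var e * (var_plus j * w n))" "cayley j a = (\<lambda>n. var_minus j * w n)"
    using cayley_preimage[OF assms] by metis
  have "(\<lambda>n. var e * a n) \<doteq> (\<lambda>n. var_plus j * (var e * w n))"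
    using w(1) by (simp only: mult.left_commute)
  from cayley_range[OF assms this] show ?thesis unfolding w(2) by (simp only: mult.left_commute)
qed

section \<open>Powers and products of Cayley transforms\<close>

lemma funpow_cayley_cong:
  assumes "j \<noteq> e" "a \<doteq> b" shows "(cayley j ^^ n) a \<doteq> (cayley j ^^ n) b"
  by (induction n) (simp_all add: assms cayley_cong)

lemma funpow_cayley_bdd: "j \<noteq> e \<Longrightarrow> bdd a \<Longrightarrow> bdd ((cayley j ^^ n) a)"
  by (induction n) (simp_all add: bdd_cayley)

lemma funpow_cayley_commute:
  assumes "j \<noteq> e" "l \<noteq> e"
  shows "(cayley j ^^ n) (cayley l a) \<doteq> cayley l ((cayley j ^^ n) a)"
proof (induction n)
  case (Suc n)
  have "(cayley j ^^ Suc n) (cayley l a) = cayley j ((cayley j ^^ n) (cayley l a))" by simp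
  also have "\<dots> \<doteq> cayley j (cayley l ((cayley j ^^ n) a))" by (rule cayley_cong[OF assms(1) Suc])
  also have "\<dots> \<doteq> cayley l (cayley j ((cayley j ^^ n) a))" by (rule cayley_commute[OF assms])
  finally show ?case by simp
qed simp

lemma funpow_cayley_var:
  assumes "j \<noteq> e"
  shows "(cayley j ^^ n) (\<lambda>i. var e * a i) \<doteq> (\<lambda>i. var e * (cayley j ^^ n) a i)"
proof (induction n)
  case (Suc n)
  have "(cayley j ^^ Suc n) (\<lambda>i. var e * a i) = cayley j ((cayley j ^^ n) (\<lambda>i. var e * a i))" by simp
  also have "\<dots> \<doteq> cayley j (\<lambda>i. var e * (cayley j ^^ n) a i)" by (rule cayley_cong[OF assms Suc])
  also have "\<dots> \<doteq> (\<lambda>i. var e * cayley j ((cayley j ^^ n) a) i)" by (rule cayley_var[OF assms])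
  finally show ?case by simp
qed simp

lemma funpow_cayley_ip:
  assumes "j \<noteq> e" "bdd a" "bdd b"
  shows "(\<lambda>i. ip ((cayley j ^^ n) a i) ((cayley j ^^ n) b i) - ip (a i) (b i)) \<longlonglongrightarrow> 0"
proof (induction n)
  case (Suc n)
  from tendsto_add[OF ip_cayley[OF assms(1) funpow_cayley_bdd[OF assms(1,2), of n] funpow_cayley_bdd[OF assms(1,3), of n]] Suc]
  show ?case by simp
qed simp

text \<open>Each application turns one factor \<open>x_j + i\<close> into \<open>x_j - i\<close>;
  the supply of \<open>m\<close> factors bounds the exponent.\<close>

lemma funpow_cayley_value:
  assumes "j \<noteq> e" "k \<le> m"
  shows "(cayley j ^^ k) (\<lambda>_. var_plus j ^ m * f) \<doteq> (\<lambda>_. var_minus j ^ k * var_plus j ^ (m - k) * f)"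
  using assms(2)
proof (induction k)
  case (Suc k)
  have "(cayley j ^^ Suc k) (\<lambda>_. var_plus j ^ m * f) = cayley j ((cayley j ^^ k) (\<lambda>_. var_plus j ^ m * f))" by simp
  also have "\<dots> \<doteq> cayley j (\<lambda>_. var_minus j ^ k * var_plus j ^ (m - k) * f)"
    using Suc by (intro cayley_cong[OF assms(1)]) simp
  also have "\<dots> \<doteq> (\<lambda>_. var_minus j * (var_minus j ^ k * var_plus j ^ (m - Suc k) * f))"
  proof (rule cayley_range[OF assms(1)])
    have "m - k = Suc (m - Suc k)" using Suc.prems by simp
    then have "var_minus j ^ k * var_plus j ^ (m - k) * f = var_plus j * (var_minus j ^ k * var_plus j ^ (m - Suc k) * f)"
      by (simp add: ac_simps)
    then show "(\<lambda>_. var_minus j ^ k * var_plus j ^ (m - k) * f) \<doteq> (\<lambda>_. var_plus j * (var_minus j ^ k * var_plus j ^ (m - Suc k) * f))"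
      by simp
  qed
  finally show ?case by (simp add: mult.assoc)
qed simp

primrec cayleys :: "'d list \<Rightarrow> ('d \<Rightarrow> nat) \<Rightarrow> (nat \<Rightarrow> 'd mpoly) \<Rightarrow> nat \<Rightarrow> 'd mpoly" where
  "cayleys [] k a = a"
| "cayleys (j # js) k a = (cayley j ^^ k j) (cayleys js k a)"

lemma cayleys_bdd: "e \<notin> set js \<Longrightarrow> bdd a \<Longrightarrow> bdd (cayleys js k a)"
  by (induction js) (auto intro: funpow_cayley_bdd)

lemma cayleys_commute:
  assumes "l \<noteq> e" "e \<notin> set js" shows "cayleys js k (cayley l a) \<doteq> cayley l (cayleys js k a)"
  using assms(2)
proof (induction js)
  case (Cons j js)
  have "cayleys (j # js) k (cayley l a) \<doteq> (cayley j ^^ k j) (cayley l (cayleys js k a))"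
    unfolding cayleys.simps using Cons by (intro funpow_cayley_cong) auto
  also have "\<dots> \<doteq> cayley l ((cayley j ^^ k j) (cayleys js k a))"
    using Cons.prems by (intro funpow_cayley_commute assms(1)) auto
  finally show ?case by simp
qed simp

lemma cayleys_funpow_commute:
  assumes "l \<noteq> e" "e \<notin> set js" shows "cayleys js k ((cayley l ^^ n) a) \<doteq> (cayley l ^^ n) (cayleys js k a)"
proof (induction n)
  case (Suc n)
  have "cayleys js k ((cayley l ^^ Suc n) a) \<doteq> cayley l (cayleys js k ((cayley l ^^ n) a))"
    using cayleys_commute[OF assms] by simp
  also have "\<dots> \<doteq> cayley l ((cayley l ^^ n) (cayleys js k a))" by (rule cayley_cong[OF assms(1) Suc])
  finally show ?case by simp
qed simp

text \<open>The list fixes the order of the transforms, so merging two products coordinate by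
  coordinate rests on commutativity.\<close>

lemma cayleys_add:
  assumes "e \<notin> set js" shows "cayleys js (\<lambda>j. k j + h j) a \<doteq> cayleys js h (cayleys js k a)"
  using assms
proof (induction js)
  case (Cons j js)
  then have j: "j \<noteq> e" "e \<notin> set js" by auto
  have "cayleys (j # js) (\<lambda>j. k j + h j) a = (cayley j ^^ (h j + k j)) (cayleys js (\<lambda>j. k j + h j) a)"
    by (simp add: add.commute)
  also have "\<dots> \<doteq> (cayley j ^^ (h j + k j)) (cayleys js h (cayleys js k a))"
    using Cons j by (intro funpow_cayley_cong) auto
  also have "\<dots> = (cayley j ^^ h j) ((cayley j ^^ k j) (cayleys js h (cayleys js k a)))"
    by (simp add: funpow_add)
  also have "\<dots> \<doteq> (cayley j ^^ h j) (cayleys js h ((cayley j ^^ k j) (cayleys js k a)))"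
    by (intro funpow_cayley_cong eqv_sym[OF cayleys_funpow_commute] j)
  finally show ?case by simp
qed simp

lemma cayleys_var:
  assumes "e \<notin> set js" shows "cayleys js k (\<lambda>i. var e * a i) \<doteq> (\<lambda>i. var e * cayleys js k a i)"
  using assms
proof (induction js)
  case (Cons j js)
  then have j: "j \<noteq> e" "e \<notin> set js" by auto
  have "cayleys (j # js) k (\<lambda>i. var e * a i) \<doteq> (cayley j ^^ k j) (\<lambda>i. var e * cayleys js k a i)"
    unfolding cayleys.simps using Cons j by (intro funpow_cayley_cong) auto
  also have "\<dots> \<doteq> (\<lambda>i. var e * (cayley j ^^ k j) (cayleys js k a) i)" by (rule funpow_cayley_var[OF j(1)])
  finally show ?case by simp
qed simp

lemma cayleys_ip:
  assumes "e \<notin> set js" "bdd a" "bdd b"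
  shows "(\<lambda>i. ip (cayleys js k a i) (cayleys js k b i) - ip (a i) (b i)) \<longlonglongrightarrow> 0"
  using assms(1)
proof (induction js)
  case (Cons j js)
  then have j: "j \<noteq> e" "e \<notin> set js" by auto
  from tendsto_add[OF funpow_cayley_ip[OF j(1) cayleys_bdd[OF j(2) assms(2)] cayleys_bdd[OF j(2) assms(3)], of "k j" k k] Cons.IH[OF j(2)]]
  show ?case by simp
qed simp

lemma cayleys_value:
  assumes "e \<notin> set js" "distinct js" "\<And>j. j \<in> set js \<Longrightarrow> k j \<le> m"
  shows "cayleys js k (\<lambda>_. (\<Prod>j\<in>set js. var_plus j ^ m) * f) \<doteq>
    (\<lambda>_. (\<Prod>j\<in>set js. var_minus j ^ k j * var_plus j ^ (m - k j)) * f)"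
  using assms
proof (induction js arbitrary: f)
  case (Cons j js)
  then have j: "j \<noteq> e" "e \<notin> set js" "j \<notin> set js" "distinct js" "k j \<le> m" by auto
  let ?B = "\<Prod>j\<in>set js. var_minus j ^ k j * var_plus j ^ (m - k j)"
  have "cayleys (j # js) k (\<lambda>_. (\<Prod>j\<in>set (j # js). var_plus j ^ m) * f) =
    (cayley j ^^ k j) (cayleys js k (\<lambda>_. (\<Prod>j\<in>set js. var_plus j ^ m) * (var_plus j ^ m * f)))"
    using j by (simp add: ac_simps)
  also have "\<dots> \<doteq> (cayley j ^^ k j) (\<lambda>_. ?B * (var_plus j ^ m * f))"
    using Cons j by (intro funpow_cayley_cong) auto
  also have "\<dots> = (cayley j ^^ k j) (\<lambda>_. var_plus j ^ m * (?B * f))" by (simp only: ac_simps)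
  also have "\<dots> \<doteq> (\<lambda>_. var_minus j ^ k j * var_plus j ^ (m - k j) * (?B * f))"
    by (rule funpow_cayley_value[OF j(1,5)])
  finally show ?case using j by (simp add: ac_simps)
qed simp

text \<open>Asymptotic Gram matrix of the vectors \<open>U\<^sup>k X\<^sub>e\<^sup>p b\<close>, where \<open>U\<close> is the tuple of Cayley transforms.\<close>

definition base :: "'d list \<Rightarrow> nat \<Rightarrow> 'd mpoly" where
  "base js m = (\<Prod>j\<in>set js. var_plus j ^ m)"

definition vec_seq :: "'d list \<Rightarrow> nat \<Rightarrow> ('d \<Rightarrow> nat) \<Rightarrow> nat \<Rightarrow> nat \<Rightarrow> 'd mpoly" where
  "vec_seq js m k p = cayleys js k (\<lambda>_. base js m * var e ^ p)"

definition gram :: "'d list \<Rightarrow> nat \<Rightarrow> nat \<Rightarrow> ('d \<Rightarrow> nat) \<Rightarrow> nat \<Rightarrow> ('d \<Rightarrow> nat) \<Rightarrow> nat \<Rightarrow> complex" where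
  "gram js m n k p k' q = ip (vec_seq js m k p n) (vec_seq js m k' q n)"

text \<open>Multiplication by \<open>x_e\<close> is symmetric and commutes with all
  \<open>U_j\<close>, so powers of \<open>x_e\<close> move from one side to the other and only
  \<open>p + q\<close> matters.\<close>

lemma gram_hankel:
  assumes "e \<notin> set js"
  shows "(\<lambda>n. gram js m n k p k' q - gram js m n k (p + q) k' 0) \<longlonglongrightarrow> 0"
proof (induction q arbitrary: p)
  case (Suc q)
  have var: "vec_seq js m k (Suc p) \<doteq> (\<lambda>n. var e * vec_seq js m k p n)" for k p
    using cayleys_var[OF assms, of k "\<lambda>_. base js m * var e ^ p"]
    by (simp add: vec_seq_def mult.left_commute)
  have bdd: "bdd (vec_seq js m k p)" for k p
    unfolding vec_seq_def by (intro cayleys_bdd assms) simp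
  \<comment> \<open>Multiplication by \<open>x_e\<close> need not preserve boundedness; this
    sequence is bounded because it is equivalent to the one with exponent
    \<open>p + 1\<close>.\<close>
  have bdd': "bdd (\<lambda>n. var e * vec_seq js m k p n)" for k p
  proof -
    obtain B where B: "\<And>n. nm (vec_seq js m k (Suc p) n) \<le> B"
      using bdd[of k "Suc p"] unfolding bdd_def by blast
    obtain C where C: "\<And>n. nm (vec_seq js m k (Suc p) n - var e * vec_seq js m k p n) \<le> C"
      using Bseq_eq_bounded convergent_imp_Bseq[OF convergentI[OF var[unfolded eqv_def]]] unfolding Bseq_def by force
    have "nm (var e * vec_seq js m k p n) \<le> C + B" for n
      using nm_triangle[of "var e * vec_seq js m k p n - vec_seq js m k (Suc p) n" "vec_seq js m k (Suc p) n"] B[of n] C[of n]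
      by (simp add: nm_minus_commute[of "var e * _"])
    then show ?thesis unfolding bdd_def by blast
  qed
  have "(\<lambda>n. ip (vec_seq js m k p n) (vec_seq js m k' (Suc q) n) - ip (vec_seq js m k p n) (var e * vec_seq js m k' q n)) \<longlonglongrightarrow> 0"
    by (rule ip_eqv[OF eqv_refl var bdd bdd])
  moreover have "(\<lambda>n. ip (var e * vec_seq js m k p n) (vec_seq js m k' q n) - ip (vec_seq js m k (Suc p) n) (vec_seq js m k' q n)) \<longlonglongrightarrow> 0"
    by (rule ip_eqv[OF eqv_sym[OF var] eqv_refl bdd bdd])
  moreover have "ip (var e * a) b = ip a (var e * b)" for a b
    by (simp add: ip_mult_left)
  ultimately have "(\<lambda>n. gram js m n k p k' (Suc q) - gram js m n k (Suc p) k' q) \<longlonglongrightarrow> 0"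
    unfolding gram_def using tendsto_add by fastforce
  from tendsto_add[OF this Suc[of "Suc p"]] show ?case by simp
qed simp

text \<open>The common part \<open>h = min k k'\<close> is removed by isometry. What remains has
  exponents at most \<open>m\<close>, where \<open>cayleys_value\<close> gives the vectors
  explicitly; the limit depends only on \<open>k - k'\<close>.\<close>

lemma gram_value:
  assumes js: "e \<notin> set js" "distinct js" and kk: "\<And>j. j \<in> set js \<Longrightarrow> k j \<le> m + k' j \<and> k' j \<le> m + k j"
  shows "(\<lambda>n. gram js m n k p k' 0) \<longlonglongrightarrow>
    L ((\<Prod>j\<in>set js. var_minus j ^ (m + k j - k' j) * var_plus j ^ (m + k' j - k j)) * var e ^ p)"
proof -
  define h where "h j = min (k j) (k' j)" for j
  define \<kappa> where "\<kappa> j = k j - h j" for j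
  define \<kappa>' where "\<kappa>' j = k' j - h j" for j
  have dec: "k = (\<lambda>j. \<kappa> j + h j)" "k' = (\<lambda>j. \<kappa>' j + h j)" by (auto simp: \<kappa>_def \<kappa>'_def h_def)
  have le: "\<kappa> j \<le> m" "\<kappa>' j \<le> m" if "j \<in> set js" for j using kk[OF that] by (auto simp: \<kappa>_def \<kappa>'_def h_def)
  have bdd: "bdd (vec_seq js m k p)" for k p
    unfolding vec_seq_def by (intro cayleys_bdd js) simp
  have bdd2: "bdd (cayleys js h (vec_seq js m k p))" for k p
    by (intro cayleys_bdd js bdd)
  have add: "vec_seq js m (\<lambda>j. \<kappa> j + h j) p \<doteq> cayleys js h (vec_seq js m \<kappa> p)" for \<kappa> p
    unfolding vec_seq_def by (rule cayleys_add[OF js(1)])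
  define W where "W \<kappa> p = (\<Prod>j\<in>set js. var_minus j ^ \<kappa> j * var_plus j ^ (m - \<kappa> j)) * var e ^ p" for \<kappa> p
  have val: "vec_seq js m \<kappa> p \<doteq> (\<lambda>_. W \<kappa> p)" if "\<And>j. j \<in> set js \<Longrightarrow> \<kappa> j \<le> m" for \<kappa> p
    unfolding vec_seq_def base_def W_def by (rule cayleys_value[OF js that])
  have 1: "(\<lambda>n. gram js m n k p k' 0 - ip (cayleys js h (vec_seq js m \<kappa> p) n) (cayleys js h (vec_seq js m \<kappa>' 0) n)) \<longlonglongrightarrow> 0"
    unfolding gram_def dec by (rule ip_eqv[OF add add bdd2 bdd])
  have 2: "(\<lambda>n. ip (cayleys js h (vec_seq js m \<kappa> p) n) (cayleys js h (vec_seq js m \<kappa>' 0) n) -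
      ip (vec_seq js m \<kappa> p n) (vec_seq js m \<kappa>' 0 n)) \<longlonglongrightarrow> 0"
    by (rule cayleys_ip[OF js(1) bdd bdd])
  have 3: "(\<lambda>n. ip (vec_seq js m \<kappa> p n) (vec_seq js m \<kappa>' 0 n) - ip (W \<kappa> p) (W \<kappa>' 0)) \<longlonglongrightarrow> 0"
    by (rule ip_eqv[OF val val bdd_const bdd]) (use le in auto)
  have "(\<lambda>n. gram js m n k p k' 0 - ip (W \<kappa> p) (W \<kappa>' 0)) \<longlonglongrightarrow> 0"
    using tendsto_add[OF tendsto_add[OF 1 2] 3] by simp
  then have "(\<lambda>n. gram js m n k p k' 0) \<longlonglongrightarrow> ip (W \<kappa> p) (W \<kappa>' 0)" by (simp add: LIM_zero_iff)
  also have "W \<kappa> p * star (W \<kappa>' 0) =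
      (\<Prod>j\<in>set js. var_minus j ^ \<kappa> j * var_plus j ^ (m - \<kappa> j) * (var_plus j ^ \<kappa>' j * var_minus j ^ (m - \<kappa>' j))) * var e ^ p"
    by (simp add: W_def star_prod prod.distrib ac_simps)
  then have "ip (W \<kappa> p) (W \<kappa>' 0) = L \<dots>" by (simp only: ip_def)
  also have "(\<Prod>j\<in>set js. var_minus j ^ \<kappa> j * var_plus j ^ (m - \<kappa> j) * (var_plus j ^ \<kappa>' j * var_minus j ^ (m - \<kappa>' j))) =
      (\<Prod>j\<in>set js. var_minus j ^ (m + k j - k' j) * var_plus j ^ (m + k' j - k j))"
  proof (rule prod.cong[OF refl])
    fix j assume "j \<in> set js"
    from le[OF this] have *: "\<kappa> j + (m - \<kappa>' j) = m + k j - k' j" "(m - \<kappa> j) + \<kappa>' j = m + k' j - k j"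
      by (simp_all add: dec)
    show "var_minus j ^ \<kappa> j * var_plus j ^ (m - \<kappa> j) * (var_plus j ^ \<kappa>' j * var_minus j ^ (m - \<kappa>' j)) =
      var_minus j ^ (m + k j - k' j) * var_plus j ^ (m + k' j - k j)"
    proof -
      have "var_minus j ^ \<kappa> j * var_plus j ^ (m - \<kappa> j) * (var_plus j ^ \<kappa>' j * var_minus j ^ (m - \<kappa>' j)) =
        var_minus j ^ (\<kappa> j + (m - \<kappa>' j)) * var_plus j ^ ((m - \<kappa> j) + \<kappa>' j)"
        by (simp only: power_add ac_simps)
      then show ?thesis by (simp only: *)
    qed
  qed
  finally show ?thesis .
qed

end

section \<open>Positivity on nonnegative polynomials\<close>

text \<open>The solution of \<open>(x - i) / (x + i) = cis (2 t)\<close> is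
  \<open>x = - cot t\<close>.\<close>

lemma cayley_point:
  assumes "sin t \<noteq> 0"
  shows "complex_of_real (- cos t / sin t) - \<i> = cis (2 * t) * (complex_of_real (- cos t / sin t) + \<i>)"
proof -
  have "of_real (sin t) * (complex_of_real (- cos t / sin t) - \<i>) = - cis t"
    "of_real (sin t) * (complex_of_real (- cos t / sin t) + \<i>) = - cis (- t)"
    using assms by (simp_all add: complex_eq_iff)
  moreover have "cis t = cis (2 * t) * cis (- t)" by (simp add: cis_mult)
  ultimately have "of_real (sin t) * (complex_of_real (- cos t / sin t) - \<i>) =
      of_real (sin t) * (cis (2 * t) * (complex_of_real (- cos t / sin t) + \<i>))"
    by (metis mult.left_commute mult_minus_right)
  then show ?thesis using assms by simp
qed

text \<open>The nodes \<open>grid_root M r\<close> are shifted by half a step, so that the point \<open>1\<close>, which corresponds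
  to infinity under the Cayley transform, is avoided.\<close>

definition grid_root :: "nat \<Rightarrow> nat \<Rightarrow> complex" where
  "grid_root M r = cis (2 * (pi * (2 * real r + 1) / (2 * real M)))"

definition grid_point :: "nat \<Rightarrow> nat \<Rightarrow> real" where
  "grid_point M r = (let t = pi * (2 * real r + 1) / (2 * real M) in - cos t / sin t)"

lemma grid_point_root:
  assumes "r < M"
  shows "complex_of_real (grid_point M r) - \<i> = grid_root M r * (complex_of_real (grid_point M r) + \<i>)"
proof -
  let ?t = "pi * (2 * real r + 1) / (2 * real M)"
  have M: "0 < real M" using assms by simp
  have "2 * real r + 1 < 2 * real M" using assms by linarith
  then have "pi * (2 * real r + 1) < pi * (2 * real M)" by (intro mult_strict_left_mono) auto
  then have "0 < ?t" "?t < pi" using M by (auto simp: divide_less_eq intro!: divide_pos_pos mult_pos_pos)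
  then have "sin ?t \<noteq> 0" using sin_gt_zero by fastforce
  from cayley_point[OF this] show ?thesis unfolding grid_root_def grid_point_def Let_def .
qed

lemma grid_root_cnj: "grid_root M r * cnj (grid_root M r) = 1"
  by (simp add: grid_root_def cis_cnj cis_mult)

text \<open>A geometric sum with ratio \<open>cis x\<close> over full turns; the half-step shift of
  the nodes only contributes the factor \<open>cis (x / 2)\<close>. The ratio is not 1 because
  distinct \<open>a\<close> and \<open>b\<close> differ by less than \<open>M\<close>.\<close>

lemma grid_root_orthogonal:
  assumes "a < b + M" "b < a + M"
  shows "(\<Sum>r<M. grid_root M r ^ a * cnj (grid_root M r) ^ b) = (if a = b then of_nat M else 0)"
proof (cases "a = b")
  case True
  have "grid_root M r ^ b * cnj (grid_root M r) ^ b = 1" for r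
    by (simp add: power_mult_distrib[symmetric] grid_root_cnj)
  then show ?thesis using True by simp
next
  case False
  define x where "x = 2 * pi * (real a - real b) / real M"
  have M: "M > 0" using assms by simp
  have "grid_root M r ^ a * cnj (grid_root M r) ^ b = cis (x / 2) * cis x ^ r" for r
  proof -
    have "grid_root M r ^ a * cnj (grid_root M r) ^ b = cis (real a * (2 * (pi * (2 * real r + 1) / (2 * real M)))
        + real b * - (2 * (pi * (2 * real r + 1) / (2 * real M))))"
      by (simp only: grid_root_def cis_cnj Complex.DeMoivre cis_mult)
    also have "real a * (2 * (pi * (2 * real r + 1) / (2 * real M))) + real b * - (2 * (pi * (2 * real r + 1) / (2 * real M)))
        = x / 2 + real r * x"
      using M by (simp add: x_def field_simps)
    finally show ?thesis by (simp only: Complex.DeMoivre cis_mult)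
  qed
  then have "(\<Sum>r<M. grid_root M r ^ a * cnj (grid_root M r) ^ b) = cis (x / 2) * (\<Sum>r<M. cis x ^ r)"
    by (simp add: sum_distrib_left)
  moreover have "(\<Sum>r<M. cis x ^ r) = 0"
  proof -
    have "cis x \<noteq> 1"
    proof
      assume "cis x = 1"
      then have "cos x = 1" by (simp add: complex_eq_iff)
      then obtain n :: int where n: "x = of_int n * 2 * pi" using cos_one_2pi_int by auto
      then have "2 * pi * ((real a - real b) / real M) = 2 * pi * of_int n" by (simp add: x_def)
      then have "(real a - real b) / real M = of_int n" by (subst (asm) mult_left_cancel) auto
      then have "real_of_int (int a - int b) = real_of_int (n * int M)" using M by (simp add: field_simps)
      then have "int a - int b = n * int M" by (simp only: of_int_eq_iff)
      moreover have "\<bar>int a - int b\<bar> < int M" using assms by linarith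
      ultimately have "\<bar>n\<bar> * int M < 1 * int M" by (simp add: abs_mult)
      then have "\<bar>n\<bar> < 1" using M by (subst (asm) mult_less_cancel_right_pos) auto
      then show False using \<open>int a - int b = n * int M\<close> False by simp
    qed
    moreover have "cis x ^ M = 1"
    proof -
      have "real M * x = 2 * pi * of_int (int a - int b)" using M by (simp add: x_def)
      then show ?thesis unfolding Complex.DeMoivre by (simp only: cis_multiple_2pi Ints_of_int)
    qed
    ultimately show ?thesis by (simp add: geometric_sum)
  qed
  ultimately show ?thesis using False by simp
qed

text \<open>The number of pairs in a window of length \<open>N\<close> with difference
  \<open>\<kappa> - m\<close>, that is \<open>N - \<bar>\<kappa> - m\<bar>\<close> or 0: the Fejer
  weight of the frequency \<open>\<kappa> - m\<close>.\<close>

definition shift_count :: "nat \<Rightarrow> nat \<Rightarrow> nat \<Rightarrow> nat" where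
  "shift_count N m \<kappa> = (\<Sum>a<N. \<Sum>b<N. of_bool (\<kappa> + b = m + a))"

lemma shift_count_le: "shift_count N m \<kappa> \<le> N"
proof -
  have "(\<Sum>b<N. of_bool (\<kappa> + b = m + a)) \<le> (1 :: nat)" for a
  proof -
    have "(\<Sum>b<N. of_bool (\<kappa> + b = m + a)) = card {b. b < N \<and> \<kappa> + b = m + a}"
      by (simp add: of_bool_def sum.If_cases Int_def)
    also have "\<dots> \<le> card {m + a - \<kappa>}" by (intro card_mono) auto
    finally show ?thesis by simp
  qed
  then have "shift_count N m \<kappa> \<le> (\<Sum>a<N. 1)" unfolding shift_count_def by (intro sum_mono)
  then show ?thesis by simp
qed

lemma shift_count_ge: assumes "\<kappa> \<le> 2 * m" shows "N \<le> shift_count N m \<kappa> + 2 * m"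
proof (cases "N \<le> 2 * m")
  case False
  have "(\<Sum>b<N. of_bool (\<kappa> + b = m + a)) \<ge> (1 :: nat)" if "a \<in> {m..<N - m}" for a
  proof -
    have "(\<Sum>b\<in>{m + a - \<kappa>}. of_bool (\<kappa> + b = m + a)) \<le> (\<Sum>b<N. of_bool (\<kappa> + b = m + a) :: nat)"
      by (rule sum_mono2) (use that assms False in auto)
    then show ?thesis using that assms by auto
  qed
  then have "(\<Sum>a\<in>{m..<N - m}. 1) \<le> (\<Sum>a\<in>{m..<N - m}. \<Sum>b<N. of_bool (\<kappa> + b = m + a) :: nat)"
    by (intro sum_mono) auto
  also have "\<dots> \<le> shift_count N m \<kappa>" unfolding shift_count_def by (rule sum_mono2) auto
  finally show ?thesis by simp
qed simp

lemma shift_count_limit: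
  assumes "\<kappa> \<le> 2 * m" shows "(\<lambda>N. real (shift_count N m \<kappa>) / real N) \<longlonglongrightarrow> 1"
proof (rule tendsto_sandwich[where f = "\<lambda>N. 1 - real (2 * m) / real N" and h = "\<lambda>_. 1"])
  have "1 - real (2 * m) / real N \<le> real (shift_count N m \<kappa>) / real N" if "N \<ge> 1" for N
  proof -
    have "real N \<le> real (shift_count N m \<kappa> + 2 * m)" using shift_count_ge[OF assms, of N] by (simp only: of_nat_le_iff)
    then have "(real N - real (2 * m)) / real N \<le> real (shift_count N m \<kappa>) / real N"
      by (intro divide_right_mono) auto
    then show ?thesis using that by (simp add: diff_divide_distrib)
  qed
  then show "\<forall>\<^sub>F N in sequentially. 1 - real (2 * m) / real N \<le> real (shift_count N m \<kappa>) / real N"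
    by (intro eventually_sequentiallyI)
  show "\<forall>\<^sub>F N in sequentially. real (shift_count N m \<kappa>) / real N \<le> 1"
    by (intro always_eventually allI) (use shift_count_le in \<open>auto simp: divide_le_eq_1\<close>)
  have "(\<lambda>N. 1 - real (2 * m) / real N) \<longlonglongrightarrow> 1 - 0"
    by (intro tendsto_intros lim_const_over_n)
  then show "(\<lambda>N. 1 - real (2 * m) / real N) \<longlonglongrightarrow> 1" by simp
qed simp

lemma shift_count_prod:
  assumes "finite J"
  shows "(\<Sum>k\<in>PiE J (\<lambda>_. {..<N}). \<Sum>k'\<in>PiE J (\<lambda>_. {..<N}). of_bool (\<forall>j\<in>J. \<kappa> j + k' j = m + k j)) =
    (\<Prod>j\<in>J. shift_count N m (\<kappa> j))"
proof -
  have "of_bool (\<forall>j\<in>J. \<kappa> j + k' j = m + k j) = (\<Prod>j\<in>J. of_bool (\<kappa> j + k' j = m + k j) :: nat)" for k k' :: "_ \<Rightarrow> nat"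
    using assms by (induction J) auto
  then have "(\<Sum>k\<in>PiE J (\<lambda>_. {..<N}). \<Sum>k'\<in>PiE J (\<lambda>_. {..<N}). of_bool (\<forall>j\<in>J. \<kappa> j + k' j = m + k j)) =
      (\<Sum>k\<in>PiE J (\<lambda>_. {..<N}). \<Sum>k'\<in>PiE J (\<lambda>_. {..<N}). \<Prod>j\<in>J. of_bool (\<kappa> j + k' j = m + k j) :: nat)"
    by (simp only:)
  also have "\<dots> = (\<Sum>k\<in>PiE J (\<lambda>_. {..<N}). \<Prod>j\<in>J. \<Sum>b<N. of_bool (\<kappa> j + b = m + k j))"
    by (intro sum.cong refl prod_sum_PiE[symmetric] assms) simp
  also have "\<dots> = (\<Prod>j\<in>J. shift_count N m (\<kappa> j))"
    unfolding shift_count_def by (rule prod_sum_PiE[symmetric]) (use assms in simp_all)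
  finally show ?thesis .
qed

lemma coeff_mult_sum:
  fixes \<tau> \<sigma> :: "complex poly"
  assumes "degree \<tau> \<le> d" "degree \<sigma> \<le> d" "2 * d \<le> B"
  shows "(\<Sum>a\<le>d. \<Sum>b\<le>d. coeff \<tau> a * coeff \<sigma> b * h (a + b)) = (\<Sum>q\<le>B. coeff (\<tau> * \<sigma>) q * h q)"
proof -
  have "(\<Sum>q\<le>B. coeff (\<tau> * \<sigma>) q * h q) = (\<Sum>q\<le>B. \<Sum>i\<le>q. coeff \<tau> i * coeff \<sigma> (q - i) * h (i + (q - i)))"
    by (simp add: coeff_mult sum_distrib_right)
  also have "\<dots> = (\<Sum>(i, j)\<in>{(i, j). i + j \<le> B}. coeff \<tau> i * coeff \<sigma> j * h (i + j))"
    by (rule sum.triangle_reindex_eq[symmetric])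
  also have "\<dots> = (\<Sum>(i, j)\<in>{..d} \<times> {..d}. coeff \<tau> i * coeff \<sigma> j * h (i + j))"
  proof (rule sum.mono_neutral_right)
    show "finite {(i, j). i + j \<le> B}"
      by (rule finite_subset[of _ "{..B} \<times> {..B}"]) auto
    show "\<forall>p\<in>{(i, j). i + j \<le> B} - {..d} \<times> {..d}. (case p of (i, j) \<Rightarrow> coeff \<tau> i * coeff \<sigma> j * h (i + j)) = 0"
      using assms by (auto dest!: le_degree)
  qed (use assms in auto)
  finally show ?thesis by (simp add: sum.cartesian_product)
qed

text \<open>Divided by the product of the \<open>(x_j^2 + 1)^m\<close> this is the character
  \<open>u^(\<kappa> - m)\<close> in the Cayley variables
  \<open>u_j = (x_j - i) / (x_j + i)\<close>.\<close>

definition cayley_basis :: "'d::finite set \<Rightarrow> nat \<Rightarrow> ('d \<Rightarrow> nat) \<Rightarrow> 'd mpoly" where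
  "cayley_basis J m \<kappa> = (\<Prod>j\<in>J. var_minus j ^ \<kappa> j * var_plus j ^ (2 * m - \<kappa> j))"

text \<open>Both \<open>x_j\<close> and 1 are linear forms in \<open>x_j - i\<close> and
  \<open>x_j + i\<close> (\<open>half\<close> and \<open>unit\<close>), so a power can be padded to
  a homogeneous form of any degree \<open>n \<ge> a\<close>.\<close>

lemma var_power_expand:
  assumes "a \<le> n"
  shows "\<exists>c. var j ^ a = (\<Sum>\<kappa>\<le>n. const (c \<kappa>) * (var_minus j ^ \<kappa> * var_plus j ^ (n - \<kappa>)))"
proof -
  let ?S = "\<lambda>n c. \<Sum>\<kappa>\<le>n. const (c \<kappa>) * (var_minus j ^ \<kappa> * var_plus j ^ (n - \<kappa>))"
  have step: "\<exists>c'. (const u * var_plus j + const v * var_minus j) * ?S n c = ?S (Suc n) c'" for u v n c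
  proof
    let ?c1 = "\<lambda>\<kappa>. if \<kappa> \<le> n then u * c \<kappa> else 0" and ?c2 = "\<lambda>\<kappa>. if \<kappa> = 0 then 0 else v * c (\<kappa> - 1)"
    have 1: "const u * var_plus j * ?S n c = ?S (Suc n) ?c1"
    proof -
      have "?S (Suc n) ?c1 = (\<Sum>\<kappa>\<le>n. const (u * c \<kappa>) * (var_minus j ^ \<kappa> * var_plus j ^ (Suc n - \<kappa>)))"
        by (simp add: sum.atMost_Suc)
      also have "\<dots> = (\<Sum>\<kappa>\<le>n. const u * var_plus j * (const (c \<kappa>) * (var_minus j ^ \<kappa> * var_plus j ^ (n - \<kappa>))))"
        by (intro sum.cong refl) (simp add: Suc_diff_le const_mult[symmetric] ac_simps)
      finally show ?thesis by (simp add: sum_distrib_left)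
    qed
    have 2: "const v * var_minus j * ?S n c = ?S (Suc n) ?c2"
    proof -
      have "?S (Suc n) ?c2 = (\<Sum>\<kappa>\<le>n. const (v * c \<kappa>) * (var_minus j ^ Suc \<kappa> * var_plus j ^ (n - \<kappa>)))"
        by (subst sum.atMost_Suc_shift) simp
      also have "\<dots> = (\<Sum>\<kappa>\<le>n. const v * var_minus j * (const (c \<kappa>) * (var_minus j ^ \<kappa> * var_plus j ^ (n - \<kappa>))))"
        by (intro sum.cong refl) (simp add: const_mult[symmetric] ac_simps)
      finally show ?thesis by (simp add: sum_distrib_left)
    qed
    show "(const u * var_plus j + const v * var_minus j) * ?S n c = ?S (Suc n) (\<lambda>\<kappa>. ?c1 \<kappa> + ?c2 \<kappa>)"
      unfolding distrib_right 1 2 by (simp only: sum.distrib[symmetric] single_add distrib_right)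
  qed
  have half: "const (1/2) * var_plus j + const (1/2) * var_minus j = var j"
  proof -
    have "const (1/2) * var_plus j + const (1/2) * var_minus j = (const (1/2) + const (1/2)) * var j"
      by (simp add: var_plus_def var_minus_def algebra_simps)
    also have "const (1/2) + const (1/2) = (1 :: 'a mpoly)" by (simp add: single_add[symmetric])
    finally show ?thesis by simp
  qed
  have unit: "const (- \<i> / 2) * var_plus j + const (\<i> / 2) * var_minus j = 1"
  proof -
    have "const (- \<i> / 2) * var_plus j + const (\<i> / 2) * var_minus j =
        (const (- \<i> / 2) + const (\<i> / 2)) * var j + (const (- \<i> / 2) * const \<i> - const (\<i> / 2) * const \<i>)"
      by (simp add: var_plus_def var_minus_def algebra_simps)
    also have "const (- \<i> / 2) + const (\<i> / 2) = (0 :: 'a mpoly)" by (simp add: single_add[symmetric])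
    also have "const (- \<i> / 2) * const \<i> - const (\<i> / 2) * const \<i> = (1 :: 'a mpoly)"
      by (simp add: const_mult single_diff[symmetric])
    finally show ?thesis by simp
  qed
  show ?thesis using assms
  proof (induction n arbitrary: a)
    case 0
    then show ?case by (intro exI[of _ "\<lambda>_. 1"]) simp
  next
    case (Suc n)
    show ?case
    proof (cases "a = 0")
      case True
      obtain c where c: "var j ^ 0 = ?S n c" using Suc.IH[of 0] by blast
      have "var j ^ a = 1 * ?S n c" using True c by simp
      then show ?thesis using step[of "- \<i> / 2" "\<i> / 2" c n] unfolding unit by (simp only:)
    next
      case False
      have "a - 1 \<le> n" using Suc.prems by simp
      from Suc.IH[OF this] obtain c where c: "var j ^ (a - 1) = ?S n c" by blast
      have "var j ^ a = var j * ?S n c" using False c by (metis power_eq_if)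
      then show ?thesis using step[of "1/2" "1/2" c n] unfolding half by (simp only:)
    qed
  qed
qed

lemma single_eq_prod: "Poly_Mapping.single \<alpha> 1 = (\<Prod>j\<in>UNIV. var j ^ (\<alpha> $ j))"
proof -
  have "(\<Prod>j\<in>A. var j ^ (\<alpha> $ j)) = Poly_Mapping.single (\<Sum>j\<in>A. axis j (\<alpha> $ j)) 1" if "finite A" for A
    using that by (induction A) (simp_all add: var_power mult_single)
  moreover have "(\<Sum>j\<in>UNIV. axis j (\<alpha> $ j)) = \<alpha>"
    by (simp add: vec_eq_iff axis_def if_distrib[of "\<lambda>f. f _"] cong: if_cong)
  ultimately show ?thesis by simp
qed

lemma cayley_basis_expand:
  fixes p :: "'d::finite mpoly" and e :: 'd
  defines "J \<equiv> UNIV - {e}"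
  shows "\<exists>m E g. p = (\<Sum>\<kappa>\<in>PiE J (\<lambda>_. {..2 * m}). \<Sum>q\<le>E. const (g \<kappa> q) * (cayley_basis J m \<kappa> * var e ^ q))"
proof -
  let ?S = "\<lambda>m E g. \<Sum>\<kappa>\<in>PiE J (\<lambda>_. {..2 * m}). \<Sum>q\<le>E. const (g \<kappa> q) * (cayley_basis J m \<kappa> * var e ^ q)"
  \<comment> \<open>One bound for all exponents serves as \<open>m\<close> and as \<open>E\<close>;
    0 is inserted for the zero polynomial.\<close>
  define B where "B = Max (insert 0 ((\<lambda>(\<alpha>, j). \<alpha> $ j) ` (Poly_Mapping.keys p \<times> UNIV)))"
  have B: "\<alpha> $ j \<le> B" if "\<alpha> \<in> Poly_Mapping.keys p" for \<alpha> j
    unfolding B_def by (rule Max_ge) (use that in force)+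
  have mono: "\<exists>g. Poly_Mapping.single \<alpha> c = ?S B B g" if \<alpha>: "\<And>j. \<alpha> $ j \<le> B" for \<alpha> c
  proof -
    have "\<forall>j. \<exists>c. var j ^ (\<alpha> $ j) = (\<Sum>\<kappa>\<le>2 * B. const (c \<kappa>) * (var_minus j ^ \<kappa> * var_plus j ^ (2 * B - \<kappa>)))"
      by (intro allI var_power_expand trans_le_add1[OF \<alpha>, of _ B, folded mult_2])
    from choice[OF this] obtain d where
      "\<forall>j. var j ^ (\<alpha> $ j) = (\<Sum>\<kappa>\<le>2 * B. const (d j \<kappa>) * (var_minus j ^ \<kappa> * var_plus j ^ (2 * B - \<kappa>)))" ..
    note d = this[rule_format]
    have prod_const: "(\<Prod>j\<in>A. const (f j)) = const (\<Prod>j\<in>A. f j)" for f and A :: "'d set"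
      by (induction A rule: infinite_finite_induct) (simp_all add: const_mult)
    have "Poly_Mapping.single \<alpha> c = const c * ((\<Prod>j\<in>J. var j ^ (\<alpha> $ j)) * var e ^ (\<alpha> $ e))"
    proof -
      have "Poly_Mapping.single \<alpha> c = const c * Poly_Mapping.single \<alpha> 1" by (simp add: mult_single)
      also have "Poly_Mapping.single \<alpha> 1 = (\<Prod>j\<in>J. var j ^ (\<alpha> $ j)) * var e ^ (\<alpha> $ e)"
        unfolding single_eq_prod J_def by (subst prod.remove[of _ e]) (simp_all add: mult.commute)
      finally show ?thesis .
    qed
    also have "(\<Prod>j\<in>J. var j ^ (\<alpha> $ j)) =
        (\<Sum>\<kappa>\<in>PiE J (\<lambda>_. {..2 * B}). \<Prod>j\<in>J. const (d j (\<kappa> j)) * (var_minus j ^ \<kappa> j * var_plus j ^ (2 * B - \<kappa> j)))"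
      unfolding d by (rule prod_sum_PiE) (simp_all add: J_def)
    also have "\<dots> = (\<Sum>\<kappa>\<in>PiE J (\<lambda>_. {..2 * B}). const (\<Prod>j\<in>J. d j (\<kappa> j)) * cayley_basis J B \<kappa>)"
      by (simp add: prod.distrib prod_const cayley_basis_def)
    also have "const c * (\<dots> * var e ^ (\<alpha> $ e)) =
        (\<Sum>\<kappa>\<in>PiE J (\<lambda>_. {..2 * B}). const (c * (\<Prod>j\<in>J. d j (\<kappa> j))) * (cayley_basis J B \<kappa> * var e ^ (\<alpha> $ e)))"
      unfolding sum_distrib_right sum_distrib_left
      by (intro sum.cong refl) (simp add: const_mult[symmetric] ac_simps)
    also have "\<dots> = ?S B B (\<lambda>\<kappa> q. if q = \<alpha> $ e then c * (\<Prod>j\<in>J. d j (\<kappa> j)) else 0)"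
    proof (intro sum.cong refl)
      fix \<kappa>
      have "const (if q = \<alpha> $ e then z else 0) * X = (if q = \<alpha> $ e then const z * X else 0)" for q z and X :: "'d mpoly"
        by simp
      then show "const (c * (\<Prod>j\<in>J. d j (\<kappa> j))) * (cayley_basis J B \<kappa> * var e ^ (\<alpha> $ e)) =
        (\<Sum>q\<le>B. const (if q = \<alpha> $ e then c * (\<Prod>j\<in>J. d j (\<kappa> j)) else 0) * (cayley_basis J B \<kappa> * var e ^ q))"
        using \<alpha>[of e] by simp
    qed
    finally show ?thesis
      by (intro exI[of _ "\<lambda>\<kappa> q. if q = \<alpha> $ e then c * (\<Prod>j\<in>J. d j (\<kappa> j)) else 0"])
  qed
  have "\<exists>g. (\<Sum>\<alpha>\<in>A. Poly_Mapping.single \<alpha> (Poly_Mapping.lookup p \<alpha>)) = ?S B B g" if "finite A" "A \<subseteq> Poly_Mapping.keys p" for A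
    using that
  proof (induction A)
    case empty
    show ?case by (intro exI[of _ "\<lambda>_ _. 0"]) simp
  next
    case (insert \<alpha> A)
    then obtain g where g: "(\<Sum>\<alpha>\<in>A. Poly_Mapping.single \<alpha> (Poly_Mapping.lookup p \<alpha>)) = ?S B B g" by auto
    obtain h where h: "Poly_Mapping.single \<alpha> (Poly_Mapping.lookup p \<alpha>) = ?S B B h" using mono B insert.prems by blast
    show ?case
      using insert.hyps
      by (intro exI[of _ "\<lambda>\<kappa> q. h \<kappa> q + g \<kappa> q"]) (simp add: g h single_add distrib_right sum.distrib)
  qed
  from this[OF finite_keys order_refl] have "\<exists>g. p = ?S B B g"
    unfolding poly_mapping_sum_single[symmetric] .
  then show ?thesis by - (rule exI[of _ B], rule exI[of _ B])
qed

lemma Re_of_nat_mult: "Re (of_nat n * z) = real n * Re z"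
  by simp

lemma zero_le_mult_pos: "0 \<le> a * b \<Longrightarrow> 0 < a \<Longrightarrow> (0 :: real) \<le> b"
  by (simp add: zero_le_mult_iff)

text \<open>At a node \<open>x - i = \<omega> (x + i)\<close> with \<open>\<omega>\<close>
  unimodular, so division by \<open>(x^2 + 1)^m\<close> leaves
  \<open>\<omega>^(\<kappa> - m)\<close>, written with \<open>cnj \<omega>\<close> to avoid negative
  exponents.\<close>

lemma ev_cayley_basis:
  fixes x :: "real ^ 'd::finite"
  assumes "\<And>j. j \<in> J \<Longrightarrow> \<kappa> j \<le> 2 * m" and "\<And>j. j \<in> J \<Longrightarrow> r j < M \<and> x $ j = grid_point M (r j)"
  shows "ev (cayley_basis J m \<kappa>) x =
    (\<Prod>j\<in>J. grid_root M (r j) ^ \<kappa> j * cnj (grid_root M (r j)) ^ m) * of_real (\<Prod>j\<in>J. ((x $ j)\<^sup>2 + 1) ^ m)"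
proof -
  have "ev (var_minus j ^ \<kappa> j * var_plus j ^ (2 * m - \<kappa> j)) x =
      (grid_root M (r j) ^ \<kappa> j * cnj (grid_root M (r j)) ^ m) * of_real (((x $ j)\<^sup>2 + 1) ^ m)" if j: "j \<in> J" for j
  proof -
    define y where "y = complex_of_real (x $ j) + \<i>"
    define \<omega> where "\<omega> = grid_root M (r j)"
    have w: "complex_of_real (x $ j) - \<i> = \<omega> * y"
      using grid_point_root[of "r j" M] assms(2)[OF j] by (simp add: \<omega>_def y_def)
    have "complex_of_real ((x $ j)\<^sup>2 + 1) = (complex_of_real (x $ j) - \<i>) * (complex_of_real (x $ j) + \<i>)"
      by (simp add: algebra_simps power2_eq_square)
    then have "complex_of_real ((x $ j)\<^sup>2 + 1) = (\<omega> * y) * y" by (simp only: w y_def[symmetric])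
    then have "cnj \<omega> ^ m * of_real (((x $ j)\<^sup>2 + 1) ^ m) = (\<omega> * cnj \<omega>) ^ m * y ^ (2 * m)"
      by (simp only: of_real_power) (simp add: power_mult_distrib power_mult power2_eq_square ac_simps)
    also have "\<dots> = y ^ (2 * m)" by (simp add: \<omega>_def grid_root_cnj)
    also have "\<dots> = y ^ \<kappa> j * y ^ (2 * m - \<kappa> j)" using assms(1)[OF j] by (simp flip: power_add)
    finally have 1: "y ^ \<kappa> j * y ^ (2 * m - \<kappa> j) = cnj \<omega> ^ m * of_real (((x $ j)\<^sup>2 + 1) ^ m)" ..
    have "ev (var_minus j ^ \<kappa> j * var_plus j ^ (2 * m - \<kappa> j)) x = \<omega> ^ \<kappa> j * (y ^ \<kappa> j * y ^ (2 * m - \<kappa> j))"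
      unfolding ev_mult ev_power ev_var_plus ev_var_minus w by (simp add: y_def[symmetric] power_mult_distrib)
    then show ?thesis unfolding 1 \<omega>_def[symmetric] by (simp only: mult.assoc)
  qed
  then show ?thesis unfolding cayley_basis_def ev_prod by (simp add: prod.distrib)
qed

text \<open>With every coordinate but \<open>e\<close> frozen at a node, \<open>p\<close> is
  \<open>D > 0\<close> times a polynomial in \<open>x_e\<close> with these coefficients, which is
  therefore nonnegative on the line.\<close>

lemma ex_grid_square:
  fixes p :: "'d::finite mpoly" and e :: 'd
  defines "J \<equiv> UNIV - {e}"
  assumes p: "p = (\<Sum>\<kappa>\<in>PiE J (\<lambda>_. {..2 * m}). \<Sum>q\<le>E. const (g \<kappa> q) * (cayley_basis J m \<kappa> * var e ^ q))"
    and pos: "\<And>x. ev p x \<in> \<real>\<^sub>\<ge>\<^sub>0" and r: "r \<in> PiE J (\<lambda>_. {..<M})"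
  shows "\<exists>\<tau>. \<forall>q. coeff (\<tau> * conj_poly \<tau>) q = (if q \<le> E then
    \<Sum>\<kappa>\<in>PiE J (\<lambda>_. {..2 * m}). g \<kappa> q * (\<Prod>j\<in>J. grid_root M (r j) ^ \<kappa> j * cnj (grid_root M (r j)) ^ m) else 0)"
proof -
  define c where "c q = (\<Sum>\<kappa>\<in>PiE J (\<lambda>_. {..2 * m}). g \<kappa> q * (\<Prod>j\<in>J. grid_root M (r j) ^ \<kappa> j * cnj (grid_root M (r j)) ^ m))" for q
  define G where "G = (\<Sum>q\<le>E. monom (c q) q)"
  define D where "D = (\<Prod>j\<in>J. ((grid_point M (r j))\<^sup>2 + 1) ^ m)"
  have D: "D > 0" unfolding D_def by (intro prod_pos) (simp add: add_nonneg_pos)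
  have "poly G (of_real t) \<in> \<real>\<^sub>\<ge>\<^sub>0" for t
  proof -
    define x :: "real ^ 'd" where "x = (\<chi> j. if j = e then t else grid_point M (r j))"
    have xe: "x $ e = t" by (simp add: x_def)
    have basis: "ev (cayley_basis J m \<kappa>) x =
        (\<Prod>j\<in>J. grid_root M (r j) ^ \<kappa> j * cnj (grid_root M (r j)) ^ m) * of_real D"
      if "\<kappa> \<in> PiE J (\<lambda>_. {..2 * m})" for \<kappa>
    proof -
      have "ev (cayley_basis J m \<kappa>) x =
        (\<Prod>j\<in>J. grid_root M (r j) ^ \<kappa> j * cnj (grid_root M (r j)) ^ m) * of_real (\<Prod>j\<in>J. ((x $ j)\<^sup>2 + 1) ^ m)"
        by (rule ev_cayley_basis) (use that r in \<open>auto simp: PiE_iff J_def x_def\<close>)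
      also have "(\<Prod>j\<in>J. ((x $ j)\<^sup>2 + 1) ^ m) = D"
        unfolding D_def by (intro prod.cong refl) (auto simp: J_def x_def)
      finally show ?thesis .
    qed
    have "ev p x = (\<Sum>\<kappa>\<in>PiE J (\<lambda>_. {..2 * m}). \<Sum>q\<le>E. of_real D *
        (g \<kappa> q * (\<Prod>j\<in>J. grid_root M (r j) ^ \<kappa> j * cnj (grid_root M (r j)) ^ m) * of_real t ^ q))"
      unfolding p ev_sum
      by (intro sum.cong refl) (simp add: basis xe)
    also have "\<dots> = of_real D * poly G (of_real t)"
      by (subst sum.swap) (simp add: G_def c_def poly_sum poly_monom sum_distrib_left sum_distrib_right ac_simps)
    finally have "poly G (of_real t) = of_real (inverse D) * ev p x" using D by (simp add: field_simps)
    then show ?thesis using pos[of x] D by (simp add: complex_nonneg_Reals_iff)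
  qed
  from nonneg_poly_eq_mult_conj[OF this] obtain \<tau> where \<tau>: "G = \<tau> * conj_poly \<tau>" ..
  have "coeff G q = (if q \<le> E then c q else 0)" for q
    by (simp add: G_def coeff_sum coeff_monom)
  then show ?thesis unfolding \<tau> c_def by (intro exI[of _ \<tau>] allI)
qed

section \<open>Fejer means and positivity of \<open>L\<close>\<close>

context commuting_resolvents
begin

text \<open>
  Up to a positive factor, the left-hand side is the limit of the sum over the grid points \<open>r\<close> of the squared
  norms of \<open>\<tau>\<^sub>r(X\<^sub>e) (\<Sum>\<^sub>k r\<^sup>-\<^sup>k U\<^sup>k) b\<close>, with \<open>k\<close> ranging over a cube of side \<open>N\<close>; the factor \<open>shift_count\<close> is the
  Fejer weight.
\<close>

lemma fejer_nonneg:
  fixes N :: nat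
  defines "J \<equiv> UNIV - {e}"
  assumes p: "p = (\<Sum>\<kappa>\<in>PiE J (\<lambda>_. {..2 * m}). \<Sum>q\<le>E. const (g \<kappa> q) * (cayley_basis J m \<kappa> * var e ^ q))"
    and pos: "\<And>x. ev p x \<in> \<real>\<^sub>\<ge>\<^sub>0"
  shows "0 \<le> Re (\<Sum>\<kappa>\<in>PiE J (\<lambda>_. {..2 * m}). \<Sum>q\<le>E.
    g \<kappa> q * L (cayley_basis J m \<kappa> * var e ^ q) * of_nat (\<Prod>j\<in>J. shift_count N m (\<kappa> j)))"
proof -
  obtain js where js: "set js = J" "distinct js" using finite_distinct_list[of J] by auto
  have ejs: "e \<notin> set js" by (simp add: js J_def)
  \<comment> \<open>Both \<open>\<kappa> + k'\<close> and \<open>m + k\<close> lie below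
    \<open>N + 2 * m\<close>, so the grid sums are exactly orthogonal; the final 1 keeps
    \<open>M\<close> positive.\<close>
  define M where "M = N + 2 * m + 1"
  define \<Theta> K I where "\<Theta> = PiE J (\<lambda>_. {..<M})" and "K = PiE J (\<lambda>_. {..<N})" and "I = PiE J (\<lambda>_. {..2 * m})"
  have fin: "finite \<Theta>" "finite K" "finite I" unfolding \<Theta>_def K_def I_def by (auto intro: finite_PiE)
  define \<phi> where "\<phi> r \<kappa> = (\<Prod>j\<in>J. grid_root M (r j) ^ \<kappa> j * cnj (grid_root M (r j)) ^ m)" for r \<kappa>
  define ph where "ph r k = (\<Prod>j\<in>J. cnj (grid_root M (r j)) ^ k j)" for r k
  define c where "c r q = (\<Sum>\<kappa>\<in>I. g \<kappa> q * \<phi> r \<kappa>)" for r q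
  have "\<forall>r\<in>\<Theta>. \<exists>\<tau>. \<forall>q. coeff (\<tau> * conj_poly \<tau>) q = (if q \<le> E then c r q else 0)"
    unfolding c_def \<phi>_def I_def \<Theta>_def J_def
    by (intro ballI ex_grid_square[OF p[unfolded J_def] pos])
  from bchoice[OF this] obtain \<tau> where
    "\<forall>r\<in>\<Theta>. \<forall>q. coeff (\<tau> r * conj_poly (\<tau> r)) q = (if q \<le> E then c r q else 0)" ..
  note \<tau> = this[rule_format]
  define d where "d r = degree (\<tau> r)" for r
  have conv: "(\<Sum>a\<le>d r. \<Sum>b\<le>d r. coeff (\<tau> r) a * cnj (coeff (\<tau> r) b) * h (a + b)) = (\<Sum>q\<le>E. c r q * h q)"
    if "r \<in> \<Theta>" for r h
  proof -
    have "(\<Sum>a\<le>d r. \<Sum>b\<le>d r. coeff (\<tau> r) a * cnj (coeff (\<tau> r) b) * h (a + b)) =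
        (\<Sum>q\<le>2 * d r + E. coeff (\<tau> r * conj_poly (\<tau> r)) q * h q)"
      unfolding coeff_conj_poly[symmetric]
      by (rule coeff_mult_sum) (auto simp: d_def degree_map_poly)
    also have "\<dots> = (\<Sum>q\<le>E. c r q * h q)"
      unfolding \<tau>[OF that] by (rule sum.mono_neutral_cong_right) auto
    finally show ?thesis .
  qed
  let ?\<gamma> = "\<lambda>n k a k' b. gram js m n k a k' b"
  define v where "v r n = (\<Sum>k\<in>K. \<Sum>a\<le>d r. const (ph r k * coeff (\<tau> r) a) * vec_seq js m k a n)" for r n
  \<comment> \<open>What the squared norm of \<open>v r n\<close> becomes once the Hankel property
    merges the two powers of \<open>x_e\<close>: the products of coefficients of
    \<open>\<tau> r\<close> collapse to \<open>c r\<close>.\<close>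
  define R where "R r n = (\<Sum>k\<in>K. \<Sum>k'\<in>K. ph r k * cnj (ph r k') * (\<Sum>q\<le>E. c r q * ?\<gamma> n k q k' 0))" for r n
  have ipv: "ip (v r n) (v r n) = (\<Sum>k\<in>K. \<Sum>k'\<in>K. ph r k * cnj (ph r k') *
      (\<Sum>a\<le>d r. \<Sum>b\<le>d r. coeff (\<tau> r) a * cnj (coeff (\<tau> r) b) * ?\<gamma> n k a k' b))" for r n
  proof -
    have "ip (v r n) (v r n) = (\<Sum>k\<in>K. \<Sum>a\<le>d r. \<Sum>k'\<in>K. \<Sum>b\<le>d r.
        ph r k * coeff (\<tau> r) a * (cnj (ph r k') * cnj (coeff (\<tau> r) b) * ?\<gamma> n k a k' b))"
      unfolding v_def ip_sum_left ip_const_left unfolding ip_sum_right ip_const_right sum_distrib_left gram_def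
      by (simp add: mult.assoc)
    also have "\<dots> = (\<Sum>k\<in>K. \<Sum>k'\<in>K. \<Sum>a\<le>d r. \<Sum>b\<le>d r.
        ph r k * coeff (\<tau> r) a * (cnj (ph r k') * cnj (coeff (\<tau> r) b) * ?\<gamma> n k a k' b))"
      by (intro sum.cong refl sum.swap)
    finally show ?thesis by (simp add: sum_distrib_left ac_simps)
  qed
  have null: "(\<lambda>n. ip (v r n) (v r n) - R r n) \<longlonglongrightarrow> 0" if "r \<in> \<Theta>" for r
  proof -
    have "ip (v r n) (v r n) - R r n = (\<Sum>k\<in>K. \<Sum>k'\<in>K. ph r k * cnj (ph r k') *
      (\<Sum>a\<le>d r. \<Sum>b\<le>d r. coeff (\<tau> r) a * cnj (coeff (\<tau> r) b) * (?\<gamma> n k a k' b - ?\<gamma> n k (a + b) k' 0)))" for n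
      unfolding ipv R_def conv[OF that, symmetric] by (simp only: right_diff_distrib sum_subtractf)
    moreover have "(\<lambda>n. \<Sum>k\<in>K. \<Sum>k'\<in>K. ph r k * cnj (ph r k') *
      (\<Sum>a\<le>d r. \<Sum>b\<le>d r. coeff (\<tau> r) a * cnj (coeff (\<tau> r) b) * (?\<gamma> n k a k' b - ?\<gamma> n k (a + b) k' 0))) \<longlonglongrightarrow> 0"
      by (intro tendsto_null_sum tendsto_mult_right_zero gram_hankel ejs)
    ultimately show ?thesis by simp
  qed
  let ?cond = "\<lambda>\<kappa> k k'. \<forall>j\<in>J. \<kappa> j + k' j = m + k j"
  let ?w = "\<lambda>\<kappa> k k'. if ?cond \<kappa> k k' then of_nat (M ^ card J) else (0 :: complex)"
  let ?P = "\<lambda>\<kappa> q. L (cayley_basis J m \<kappa> * var e ^ q)"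
  \<comment> \<open>Summation over the nodes retains the pairs with
    \<open>k - k' = \<kappa> - m\<close>, whose number is the product of the
    \<open>shift_count\<close>.\<close>
  have orth: "(\<Sum>r\<in>\<Theta>. ph r k * cnj (ph r k') * \<phi> r \<kappa>) = ?w \<kappa> k k'"
    if k: "k \<in> K" "k' \<in> K" "\<kappa> \<in> I" for k k' \<kappa>
  proof -
    have "(\<Sum>r\<in>\<Theta>. ph r k * cnj (ph r k') * \<phi> r \<kappa>) =
      (\<Sum>r\<in>\<Theta>. \<Prod>j\<in>J. grid_root M (r j) ^ (\<kappa> j + k' j) * cnj (grid_root M (r j)) ^ (m + k j))"
      by (simp add: ph_def \<phi>_def prod.distrib power_add ac_simps)
    also have "\<dots> = (\<Prod>j\<in>J. \<Sum>i<M. grid_root M i ^ (\<kappa> j + k' j) * cnj (grid_root M i) ^ (m + k j))"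
      unfolding \<Theta>_def by (rule prod_sum_PiE[symmetric]) auto
    also have "\<dots> = (\<Prod>j\<in>J. if \<kappa> j + k' j = m + k j then of_nat M else 0)"
    proof (intro prod.cong refl grid_root_orthogonal)
      fix j assume "j \<in> J"
      then have "k j < N" "k' j < N" "\<kappa> j \<le> 2 * m" using k by (auto simp: K_def I_def PiE_iff)
      then show "\<kappa> j + k' j < m + k j + M" "m + k j < \<kappa> j + k' j + M" by (auto simp: M_def)
    qed
    also have "\<dots> = ?w \<kappa> k k'"
    proof (cases "?cond \<kappa> k k'")
      case True
      then have "(\<Prod>j\<in>J. if \<kappa> j + k' j = m + k j then of_nat M else 0) = (\<Prod>j\<in>J. of_nat M :: complex)"
        by (intro prod.cong) auto
      then show ?thesis using True by simp
    next
      case False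
      then show ?thesis by (auto intro!: prod_zero)
    qed
    finally show ?thesis .
  qed
  have sumR: "(\<Sum>r\<in>\<Theta>. R r n) = (\<Sum>k\<in>K. \<Sum>k'\<in>K. \<Sum>q\<le>E. \<Sum>\<kappa>\<in>I.
      g \<kappa> q * ?w \<kappa> k k' * ?\<gamma> n k q k' 0)" for n
  proof -
    have "(\<Sum>r\<in>\<Theta>. R r n) = (\<Sum>k\<in>K. \<Sum>r\<in>\<Theta>. \<Sum>k'\<in>K. ph r k * cnj (ph r k') * (\<Sum>q\<le>E. c r q * ?\<gamma> n k q k' 0))"
      unfolding R_def by (rule sum.swap)
    also have "\<dots> = (\<Sum>k\<in>K. \<Sum>k'\<in>K. \<Sum>r\<in>\<Theta>. ph r k * cnj (ph r k') * (\<Sum>q\<le>E. c r q * ?\<gamma> n k q k' 0))"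
      by (intro sum.cong refl sum.swap)
    also have "\<dots> = (\<Sum>k\<in>K. \<Sum>k'\<in>K. \<Sum>q\<le>E. \<Sum>\<kappa>\<in>I.
      g \<kappa> q * (\<Sum>r\<in>\<Theta>. ph r k * cnj (ph r k') * \<phi> r \<kappa>) * ?\<gamma> n k q k' 0)"
    proof (intro sum.cong refl)
      fix k k'
      have "(\<Sum>r\<in>\<Theta>. ph r k * cnj (ph r k') * (\<Sum>q\<le>E. c r q * ?\<gamma> n k q k' 0)) =
        (\<Sum>r\<in>\<Theta>. \<Sum>q\<le>E. \<Sum>\<kappa>\<in>I. g \<kappa> q * (ph r k * cnj (ph r k') * \<phi> r \<kappa>) * ?\<gamma> n k q k' 0)"
        unfolding c_def sum_distrib_left sum_distrib_right by (simp only: ac_simps)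
      also have "\<dots> = (\<Sum>q\<le>E. \<Sum>r\<in>\<Theta>. \<Sum>\<kappa>\<in>I. g \<kappa> q * (ph r k * cnj (ph r k') * \<phi> r \<kappa>) * ?\<gamma> n k q k' 0)"
        by (rule sum.swap)
      also have "\<dots> = (\<Sum>q\<le>E. \<Sum>\<kappa>\<in>I. \<Sum>r\<in>\<Theta>. g \<kappa> q * (ph r k * cnj (ph r k') * \<phi> r \<kappa>) * ?\<gamma> n k q k' 0)"
        by (intro sum.cong refl sum.swap)
      finally show "(\<Sum>r\<in>\<Theta>. ph r k * cnj (ph r k') * (\<Sum>q\<le>E. c r q * ?\<gamma> n k q k' 0)) =
        (\<Sum>q\<le>E. \<Sum>\<kappa>\<in>I. g \<kappa> q * (\<Sum>r\<in>\<Theta>. ph r k * cnj (ph r k') * \<phi> r \<kappa>) * ?\<gamma> n k q k' 0)"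
        by (simp only: sum_distrib_left sum_distrib_right)
    qed
    also have "\<dots> = (\<Sum>k\<in>K. \<Sum>k'\<in>K. \<Sum>q\<le>E. \<Sum>\<kappa>\<in>I.
      g \<kappa> q * ?w \<kappa> k k' * ?\<gamma> n k q k' 0)"
      by (intro sum.cong refl arg_cong2[where f = "(*)"] orth)
    finally show ?thesis .
  qed
  have summand: "(\<lambda>n. g \<kappa> q * ?w \<kappa> k k' * ?\<gamma> n k q k' 0) \<longlonglongrightarrow>
      g \<kappa> q * ?w \<kappa> k k' * ?P \<kappa> q"
    if "\<kappa> \<in> I" for \<kappa> k k' q
  proof (cases "?cond \<kappa> k k'")
    case True
    have \<kappa>: "\<kappa> j \<le> 2 * m" if "j \<in> J" for j using that \<open>\<kappa> \<in> I\<close> by (auto simp: I_def PiE_iff)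
    have "(\<Prod>j\<in>set js. var_minus j ^ (m + k j - k' j) * var_plus j ^ (m + k' j - k j)) = cayley_basis J m \<kappa>"
      unfolding cayley_basis_def js
    proof (intro prod.cong refl arg_cong2[where f = "(*)"] arg_cong2[where f = "(^)"])
      fix j assume j: "j \<in> J"
      show "m + k j - k' j = \<kappa> j" "m + k' j - k j = 2 * m - \<kappa> j" using True[rule_format, OF j] \<kappa>[OF j] by linarith+
    qed
    moreover have "k j \<le> m + k' j \<and> k' j \<le> m + k j" if "j \<in> set js" for j
      using True \<kappa>[of j] that unfolding js by force
    ultimately have "(\<lambda>n. ?\<gamma> n k q k' 0) \<longlonglongrightarrow> ?P \<kappa> q"
      using gram_value[OF ejs js(2), of k m k' q] by simp
    then show ?thesis by (intro tendsto_mult tendsto_const)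
  next
    case False
    show ?thesis by (simp only: if_not_P[OF False] mult_zero_right mult_zero_left tendsto_const)
  qed
  let ?S = "\<Sum>\<kappa>\<in>I. \<Sum>q\<le>E. g \<kappa> q * ?P \<kappa> q * of_nat (\<Prod>j\<in>J. shift_count N m (\<kappa> j))"
  have lim: "(\<lambda>n. \<Sum>r\<in>\<Theta>. ip (v r n) (v r n)) \<longlonglongrightarrow> of_nat (M ^ card J) * ?S"
  proof -
    have "(\<lambda>n. (\<Sum>r\<in>\<Theta>. ip (v r n) (v r n) - R r n) + (\<Sum>r\<in>\<Theta>. R r n)) \<longlonglongrightarrow>
      0 + (\<Sum>k\<in>K. \<Sum>k'\<in>K. \<Sum>q\<le>E. \<Sum>\<kappa>\<in>I.
        g \<kappa> q * ?w \<kappa> k k' * ?P \<kappa> q)"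
      unfolding sumR by (intro tendsto_add tendsto_null_sum null tendsto_sum summand)
    moreover have "(\<Sum>k\<in>K. \<Sum>k'\<in>K. \<Sum>q\<le>E. \<Sum>\<kappa>\<in>I.
        g \<kappa> q * ?w \<kappa> k k' * ?P \<kappa> q) =
        of_nat (M ^ card J) * ?S"
    proof -
      let ?t = "\<lambda>k k' q \<kappa>. g \<kappa> q * ?w \<kappa> k k' * ?P \<kappa> q"
      have "(\<Sum>k\<in>K. \<Sum>k'\<in>K. \<Sum>q\<le>E. \<Sum>\<kappa>\<in>I. ?t k k' q \<kappa>) = (\<Sum>k\<in>K. \<Sum>k'\<in>K. \<Sum>(\<kappa>, q)\<in>I \<times> {..E}. ?t k k' q \<kappa>)"
        by (subst sum.swap[of _ I]) (simp add: sum.cartesian_product)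
      also have "\<dots> = (\<Sum>k\<in>K. \<Sum>(\<kappa>, q)\<in>I \<times> {..E}. \<Sum>k'\<in>K. ?t k k' q \<kappa>)"
        unfolding split_beta by (intro sum.cong refl sum.swap)
      also have "\<dots> = (\<Sum>(\<kappa>, q)\<in>I \<times> {..E}. \<Sum>k\<in>K. \<Sum>k'\<in>K. ?t k k' q \<kappa>)"
        unfolding split_beta by (rule sum.swap)
      also have "\<dots> = (\<Sum>(\<kappa>, q)\<in>I \<times> {..E}. of_nat (M ^ card J) *
          (g \<kappa> q * ?P \<kappa> q * of_nat (\<Prod>j\<in>J. shift_count N m (\<kappa> j))))"
      proof (intro sum.cong refl, clarify)
        fix \<kappa> q
        have "(\<Sum>k\<in>K. \<Sum>k'\<in>K. ?t k k' q \<kappa>) = (\<Sum>k\<in>K. \<Sum>k'\<in>K.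
            of_nat (M ^ card J) * (g \<kappa> q * ?P \<kappa> q) * of_nat (of_bool (?cond \<kappa> k k')))"
          by (intro sum.cong refl) simp
        also have "\<dots> = of_nat (M ^ card J) * (g \<kappa> q * ?P \<kappa> q) *
            of_nat (\<Sum>k\<in>K. \<Sum>k'\<in>K. of_bool (?cond \<kappa> k k'))"
          by (simp only: sum_distrib_left of_nat_sum)
        also have "(\<Sum>k\<in>K. \<Sum>k'\<in>K. of_bool (?cond \<kappa> k k')) = (\<Prod>j\<in>J. shift_count N m (\<kappa> j))"
          unfolding K_def by (rule shift_count_prod) simp
        finally show "(\<Sum>k\<in>K. \<Sum>k'\<in>K. ?t k k' q \<kappa>) = of_nat (M ^ card J) *
          (g \<kappa> q * ?P \<kappa> q * of_nat (\<Prod>j\<in>J. shift_count N m (\<kappa> j)))"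
          by (simp only: mult.assoc)
      qed
      also have "\<dots> = of_nat (M ^ card J) * ?S"
        unfolding sum_distrib_left unfolding sum.cartesian_product ..
      finally show ?thesis .
    qed
    ultimately show ?thesis by (simp flip: sum.distrib)
  qed
  have "0 \<le> Re (of_nat (M ^ card J) * ?S)"
  proof (rule tendsto_lowerbound[OF tendsto_Re[OF lim]])
    have "0 \<le> Re (\<Sum>r\<in>\<Theta>. ip (v r n) (v r n))" for n
      by (simp only: ip_nm Re_sum Re_complex_of_real sum_nonneg zero_le_power2)
    then show "\<forall>\<^sub>F n in sequentially. 0 \<le> Re (\<Sum>r\<in>\<Theta>. ip (v r n) (v r n))" by simp
  qed simp
  then have "0 \<le> real (M ^ card J) * Re ?S" unfolding Re_of_nat_mult .
  moreover have "0 < real (M ^ card J)" by (simp add: M_def)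
  ultimately have "0 \<le> Re ?S" by (rule zero_le_mult_pos)
  then show ?thesis unfolding I_def .
qed

text \<open>For fixed \<open>\<kappa>\<close> the normalised Fejer weight tends to 1 as the cube
  grows, and the expansion of \<open>p\<close> is finite, so \<open>L p\<close> is a limit of
  numbers with nonnegative real part.\<close>

theorem nonneg_imp_L_nonneg:
  assumes pos: "\<And>x. ev p x \<in> \<real>\<^sub>\<ge>\<^sub>0"
  shows "0 \<le> Re (L p)"
proof -
  define J where "J = UNIV - {e}"
  obtain m E g where p: "p = (\<Sum>\<kappa>\<in>PiE J (\<lambda>_. {..2 * m}). \<Sum>q\<le>E. const (g \<kappa> q) * (cayley_basis J m \<kappa> * var e ^ q))"
    using cayley_basis_expand[of p e, folded J_def] by (elim exE)
  let ?S = "\<lambda>f. \<Sum>\<kappa>\<in>PiE J (\<lambda>_. {..2 * m}). \<Sum>q\<le>E. g \<kappa> q * L (cayley_basis J m \<kappa> * var e ^ q) * f \<kappa>"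
  let ?f = "\<lambda>N \<kappa>. complex_of_real (\<Prod>j\<in>J. real (shift_count N m (\<kappa> j)) / real N)"
  have Lp: "L p = ?S (\<lambda>_. 1)"
    unfolding p by (simp add: lin_ext_sum lin_ext_const_mult)
  have "0 \<le> Re (?S (?f N))" if "N \<ge> 1" for N
  proof -
    have "?S (?f N) = of_real (inverse (real N ^ card J)) * ?S (\<lambda>\<kappa>. of_nat (\<Prod>j\<in>J. shift_count N m (\<kappa> j)))"
      unfolding sum_distrib_left by (intro sum.cong refl) (simp add: prod_dividef field_simps)
    then have "Re (?S (?f N)) = inverse (real N ^ card J) * Re (?S (\<lambda>\<kappa>. of_nat (\<Prod>j\<in>J. shift_count N m (\<kappa> j))))"
      by (simp only: Re_complex_of_real Im_complex_of_real times_complex.sel mult_zero_left diff_zero)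
    moreover have "0 \<le> Re (?S (\<lambda>\<kappa>. of_nat (\<Prod>j\<in>J. shift_count N m (\<kappa> j))))"
      using fejer_nonneg[OF p[unfolded J_def] pos] unfolding J_def .
    ultimately show ?thesis by simp
  qed
  then have ev: "\<forall>\<^sub>F N in sequentially. 0 \<le> Re (?S (?f N))" by (intro eventually_sequentiallyI)
  have "(\<lambda>N. ?S (?f N)) \<longlonglongrightarrow> ?S (\<lambda>_. of_real (\<Prod>j\<in>J. 1))"
    by (intro tendsto_sum tendsto_mult tendsto_const tendsto_of_real tendsto_prod shift_count_limit) (auto simp: PiE_iff)
  then have "(\<lambda>N. ?S (?f N)) \<longlonglongrightarrow> L p" unfolding Lp by simp
  from tendsto_lowerbound[OF tendsto_Re[OF this] ev] show ?thesis by simp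
qed

end

section \<open>Existence and uniqueness of the representing measure\<close>

lemma continuous_on_monomial: "continuous_on S (monomial \<alpha>)"
  unfolding monomial_def[abs_def] by (intro continuous_intros)

lemma continuous_on_ev: "continuous_on S (ev p)"
  unfolding ev_def[abs_def] lin_ext_def
  by (intro continuous_intros continuous_on_monomial)

definition real_part :: "'d::finite mpoly \<Rightarrow> 'd mpoly" where
  "real_part p = const (1 / 2) * (p + star p)"

lemma ev_real_part: "ev (real_part p) x = of_real (Re (ev p x))"
  by (simp add: real_part_def complex_eq_iff)

context psd_sequence
begin

lemma L_real_part: "Re (L (real_part p)) = Re (L p)"
  by (simp add: real_part_def lin_ext_const_mult lin_ext_add L_star)

text \<open>Haviland's theorem. The domain consists of real parts of polynomials, because the
  extension theorem is about real functionals; \<open>real_part\<close> shows that these are again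
  values of polynomials.\<close>

theorem moment_sequence_if_nonneg:
  assumes nonneg: "\<And>p. (\<And>x. ev p x \<in> \<real>\<^sub>\<ge>\<^sub>0) \<Longrightarrow> 0 \<le> Re (L p)"
  shows "moment_sequence s"
proof -
  define G where "G = {((\<lambda>x. Re (ev p x)), Re (L p)) |p. True}"
  have G_I: "((\<lambda>x. Re (ev p x)), Re (L p)) \<in> G" for p by (auto simp: G_def)
  have "\<exists>M. sets M = sets borel \<and> (\<forall>f a. (f, a) \<in> G \<longrightarrow> integrable M f \<and> integral\<^sup>L M f = a)"
  proof (rule ex_representing_measure_unnormalized)
    show "linear_graph G"
      unfolding linear_graph_def
    proof (intro allI impI)
      fix f a g b c d assume "(f, a) \<in> G" "(g, b) \<in> G"
      then obtain p q where *: "f = (\<lambda>x. Re (ev p x))" "a = Re (L p)" "g = (\<lambda>x. Re (ev q x))" "b = Re (L q)"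
        by (auto simp: G_def)
      show "((\<lambda>x. c * f x + d * g x), c * a + d * b) \<in> G"
        using G_I[of "const (of_real c) * p + const (of_real d) * q"]
        by (simp add: * lin_ext_add lin_ext_const_mult)
    qed
    show "positive_on UNIV G"
      unfolding positive_on_def
    proof (intro allI impI)
      fix f a assume "(f, a) \<in> G" and f: "\<forall>x\<in>UNIV. 0 \<le> f x"
      then obtain p where p: "f = (\<lambda>x. Re (ev p x))" "a = Re (L p)" by (auto simp: G_def)
      have "0 \<le> Re (L (real_part p))" by (rule nonneg) (use f in \<open>simp add: ev_real_part p\<close>)
      then show "0 \<le> a" by (simp add: p L_real_part)
    qed
    show "((\<lambda>_. 1), Re (L 1)) \<in> G" using G_I[of 1] by simp
    let ?w = "1 + (\<Sum>j\<in>UNIV. var j * var j)"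
    show "((\<lambda>x. Re (ev ?w x)), Re (L ?w)) \<in> G" by (rule G_I)
    show "norm x \<le> Re (ev ?w x)" for x :: "real ^ 'd"
    proof -
      have "Re (ev ?w x) = 1 + (\<Sum>j\<in>UNIV. x $ j * x $ j)" by (simp add: ev_sum)
      also have "\<dots> = 1 + (norm x)\<^sup>2"
        by (simp add: power2_norm_eq_inner inner_vec_def)
      finally have w: "Re (ev ?w x) = 1 + (norm x)\<^sup>2" .
      have "0 \<le> (norm x - 1)\<^sup>2 + (norm x)\<^sup>2" by simp
      then show ?thesis unfolding w by (simp add: power2_diff)
    qed
    fix f a assume "(f, a) \<in> G"
    then obtain p where p: "f = (\<lambda>x. Re (ev p x))" by (auto simp: G_def)
    show "continuous_on UNIV f" unfolding p by (intro continuous_intros continuous_on_ev)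
    have "(f x)\<^sup>2 \<le> Re (ev (real_part p * real_part p) x)" for x
      by (simp add: p ev_real_part power2_eq_square)
    then show "\<exists>v c. (v, c) \<in> G \<and> (\<forall>x. (f x)\<^sup>2 \<le> v x)"
      by (intro exI[of _ "\<lambda>x. Re (ev (real_part p * real_part p) x)"] exI[of _ "Re (L (real_part p * real_part p))"] conjI G_I allI)
  qed
  then obtain M where M1: "sets M = sets borel"
    and "\<forall>f a. (f, a) \<in> G \<longrightarrow> integrable M f \<and> integral\<^sup>L M f = a" by (elim exE conjE)
  note M = this(2)[rule_format, OF G_I]
  have mono: "(\<lambda>x. Re (ev (Poly_Mapping.single \<alpha> 1) x)) = monomial \<alpha>" for \<alpha> by (simp add: fun_eq_iff)
  have "represents M s"
    unfolding represents_def
  proof (intro conjI allI)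
    show "M \<in> moment_measures" unfolding moment_measures_def mem_Collect_eq
      by (intro conjI allI M1 M[of "Poly_Mapping.single _ 1", unfolded mono, THEN conjunct1])
    fix \<alpha>
    have "integral\<^sup>L M (monomial \<alpha>) = Re (s \<alpha>)"
      using M[of "Poly_Mapping.single \<alpha> 1", unfolded mono] by simp
    then show "s \<alpha> = complex_of_real (integral\<^sup>L M (monomial \<alpha>))"
      by (simp add: complex_eq_iff s_real)
  qed
  then show ?thesis unfolding moment_sequence_def ..
qed

end

section \<open>Uniqueness of the representing measure\<close>

lemma represents_ev:
  assumes "represents M s"
  shows "integrable M (ev p) \<and> integral\<^sup>L M (ev p) = lin_ext s p"
proof (induction p rule: poly_mapping_add_induct)
  case (single \<alpha> c)
  have i: "integrable M (monomial \<alpha>)" and s: "complex_of_real (integral\<^sup>L M (monomial \<alpha>)) = s \<alpha>"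
    using assms by (simp_all add: represents_def moment_measures_def)
  have "ev (Poly_Mapping.single \<alpha> c) = (\<lambda>x. c * complex_of_real (monomial \<alpha> x))" by (simp add: fun_eq_iff)
  then show ?case using i by (simp add: integral_complex_of_real s)
next
  case (add p q)
  have "ev (p + q) = (\<lambda>x. ev p x + ev q x)" by (simp add: fun_eq_iff)
  then show ?case using add by (simp add: lin_ext_add)
qed (simp add: ev_def)

text \<open>A continuous injection into a ball: polynomials in its coordinates are bounded functions
  of \<open>x\<close>, and the Stone-Weierstrass theorem applies on a compact set.\<close>

definition resolvent_point :: "real ^ 'd::finite \<Rightarrow> complex ^ 'd" where
  "resolvent_point x = (\<chi> j. 1 / (complex_of_real (x $ j) + \<i>))"

lemma resolvent_denom: "complex_of_real t + \<i> \<noteq> 0"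
  by (simp add: complex_eq_iff)

lemma norm_resolvent_le: "cmod (1 / (complex_of_real t + \<i>)) \<le> 1"
proof -
  have "1 \<le> cmod (complex_of_real t + \<i>)" using abs_Im_le_cmod[of "complex_of_real t + \<i>"] by simp
  then show ?thesis by (simp add: norm_divide divide_le_eq_1)
qed

lemma continuous_on_resolvent_point: "continuous_on S resolvent_point"
  unfolding resolvent_point_def[abs_def]
  by (intro continuous_intros) (simp add: resolvent_denom)

lemma inj_resolvent_point: "inj resolvent_point"
proof (rule injI)
  fix x y :: "real ^ 'a"
  assume "resolvent_point x = resolvent_point y"
  then have "1 / (complex_of_real (x $ j) + \<i>) = 1 / (complex_of_real (y $ j) + \<i>)" for j
    by (simp add: resolvent_point_def vec_eq_iff)
  then show "x = y" by (simp add: divide_inverse vec_eq_iff)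
qed

lemma resolvent_point_bounded: "norm (resolvent_point (x :: real ^ 'd::finite)) \<le> real CARD('d)"
proof -
  have "norm (resolvent_point x) \<le> (\<Sum>j\<in>UNIV. norm (resolvent_point x $ j))"
    by (simp add: norm_vec_def L2_set_le_sum)
  also have "\<dots> \<le> (\<Sum>j\<in>(UNIV :: 'd set). 1)"
    unfolding resolvent_point_def vec_lambda_beta by (intro sum_mono norm_resolvent_le)
  finally show ?thesis by simp
qed

text \<open>Real polynomial functions start from real linear forms; the imaginary part is written as
  \<open>Re (- \<i> * z)\<close> so that all terms have the shape \<open>Re (u * z)\<close> with
  \<open>cmod u = 1\<close>.\<close>

lemma bounded_linear_resolvent_expand:
  fixes f :: "complex ^ 'd::finite \<Rightarrow> real"
  assumes "bounded_linear f"
  shows "f y = (\<Sum>j\<in>UNIV. f (axis j 1) * Re (y $ j) + f (axis j \<i>) * Re (- \<i> * y $ j))"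
proof -
  interpret bounded_linear f by fact
  have "y = (\<Sum>j\<in>UNIV. Re (y $ j) *\<^sub>R axis j 1 + Im (y $ j) *\<^sub>R axis j \<i>)"
    by (simp add: vec_eq_iff axis_def complex_eq_iff if_distrib[of Re] if_distrib[of Im]
        if_distrib[of "(*) _"] if_distrib[of "\<lambda>f. f _"] sum.distrib Re_sum Im_sum cong: if_cong)
  then have "f y = f (\<Sum>j\<in>UNIV. Re (y $ j) *\<^sub>R axis j 1 + Im (y $ j) *\<^sub>R axis j \<i>)" by simp
  then show ?thesis by (simp add: sum add scaleR mult.commute)
qed

text \<open>From polynomials to continuous functions of \<open>resolvent_point\<close> by uniform
  approximation, then to boxes: the image of a box is compact, and by injectivity the indicator of
  the box is a limit of continuous functions of the distance to that image.\<close>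

lemma measure_eqI_resolvent:
  fixes M N :: "(real ^ 'd::finite) measure"
  assumes M: "sets M = sets borel" "finite_measure M" and N: "sets N = sets borel" "finite_measure N"
    and eq: "\<And>P. real_polynomial_function P \<Longrightarrow>
      (\<integral>x. P (resolvent_point x) \<partial>M) = (\<integral>x. P (resolvent_point x) \<partial>N)"
  shows "M = N"
proof -
  have meas: "(\<lambda>x. f (resolvent_point x)) \<in> borel_measurable borel" if "continuous_on UNIV f" for f :: "complex ^ 'd \<Rightarrow> real"
    by (intro borel_measurable_continuous_onI continuous_on_compose2[OF that continuous_on_resolvent_point]) auto
  have integ: "integrable M' (\<lambda>x. f (resolvent_point x))"
    if M': "sets M' = sets borel" "finite_measure M'" and f: "continuous_on UNIV f" for M' and f :: "complex ^ 'd \<Rightarrow> real"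
  proof -
    interpret finite_measure M' by fact
    have "compact (f ` cball 0 (real CARD('d)))"
      by (intro compact_continuous_image continuous_on_subset[OF f]) auto
    from compact_imp_bounded[OF this] obtain B where "\<forall>z\<in>f ` cball 0 (real CARD('d)). norm z \<le> B"
      unfolding bounded_iff by (elim exE)
    then have B: "norm (f y) \<le> B" if "y \<in> cball 0 (real CARD('d))" for y using that by blast
    show ?thesis
      by (rule integrable_const_bound[of _ B])
         (use B resolvent_point_bounded meas[OF f] in \<open>auto simp: measurable_cong_sets[OF M'(1) refl]\<close>)
  qed
  let ?I = "\<lambda>M' f. \<integral>x. f (resolvent_point x) \<partial>M'"
  have cont_eq: "?I M f = ?I N f"
    if f: "continuous_on UNIV f" for f :: "complex ^ 'd \<Rightarrow> real"
  proof -
    have *: "\<bar>?I M f - ?I N f\<bar> \<le> e * (measure M (space M) + measure N (space N))"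
      if e: "e > 0" for e
    proof -
      obtain P where P: "real_polynomial_function P" "\<And>y. y \<in> cball 0 (real CARD('d)) \<Longrightarrow> \<bar>f y - P y\<bar> < e"
        using Stone_Weierstrass_real_polynomial_function[OF compact_cball continuous_on_subset[OF f subset_UNIV] e] by blast
      have Pc: "continuous_on UNIV P"
        using continuous_on_polymonial_function[of P UNIV] P(1) by (simp add: real_polynomial_function_eq)
      have near: "\<bar>?I M' f - ?I M' P\<bar> \<le> e * measure M' (space M')"
        if M': "sets M' = sets borel" "finite_measure M'" for M'
      proof -
        interpret finite_measure M' by fact
        note i = integ[OF M' f] integ[OF M' Pc]
        have "\<bar>?I M' f - ?I M' P\<bar> =
            \<bar>\<integral>x. f (resolvent_point x) - P (resolvent_point x) \<partial>M'\<bar>" using i by simp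
        also have "\<dots> \<le> (\<integral>x. \<bar>f (resolvent_point x) - P (resolvent_point x)\<bar> \<partial>M')" by (rule integral_abs_bound)
        also have "\<dots> \<le> (\<integral>x. e \<partial>M')"
          by (rule integral_mono) (use i P(2) resolvent_point_bounded in \<open>auto intro: less_imp_le\<close>)
        finally show ?thesis by (simp add: mult.commute)
      qed
      show ?thesis using near[OF M] near[OF N] eq[OF P(1)] by (simp add: distrib_left)
    qed
    define c where "c = measure M (space M) + measure N (space N)"
    have "c \<ge> 0" by (simp add: c_def)
    have "\<bar>?I M f - ?I N f\<bar> \<le> 0"
    proof (rule field_le_epsilon)
      fix e :: real assume "e > 0"
      then have "e / (c + 1) > 0" using \<open>c \<ge> 0\<close> by simp
      from *[OF this] have "\<bar>?I M f - ?I N f\<bar> \<le> e / (c + 1) * c"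
        by (simp add: c_def)
      also have "\<dots> \<le> e" using \<open>e > 0\<close> \<open>c \<ge> 0\<close> by (simp add: field_simps)
      finally show "\<bar>?I M f - ?I N f\<bar> \<le> 0 + e" by simp
    qed
    then show ?thesis by simp
  qed
  have box: "emeasure M {a..b} = emeasure N {a..b}" for a b :: "real ^ 'd"
  proof (cases "{a..b} = {}")
    case False
    define K where "K = resolvent_point ` {a..b}"
    have "compact {a..b}" by (metis compact_cbox interval_cbox)
    then have "compact K" unfolding K_def
      by (rule compact_continuous_image[OF continuous_on_resolvent_point])
    then have K: "closed K" "K \<noteq> {}" using False by (auto simp: K_def compact_imp_closed)
    define F where "F n y = max 0 (1 - real n * infdist y K)" for n y
    have Fc: "continuous_on UNIV (F n)" for n
      unfolding F_def by (intro continuous_intros)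
    have F01: "0 \<le> F n y" "F n y \<le> 1" for n y
      by (auto simp: F_def infdist_nonneg)
    have lim: "(\<lambda>n. F n (resolvent_point x)) \<longlonglongrightarrow> indicator {a..b} x" for x
    proof (cases "x \<in> {a..b}")
      case True
      then have "F n (resolvent_point x) = 1" for n by (simp add: F_def K_def)
      then show ?thesis using True by simp
    next
      case False
      then have "resolvent_point x \<notin> K" unfolding K_def using inj_image_mem_iff[OF inj_resolvent_point] by blast
      then have pos: "infdist (resolvent_point x) K > 0" by (rule infdist_pos_not_in_closed[OF K])
      obtain n0 where n0: "1 / infdist (resolvent_point x) K < real n0" using reals_Archimedean2 by blast
      have "F n (resolvent_point x) = 0" if "n \<ge> n0" for n
      proof -
        have "1 / infdist (resolvent_point x) K < real n" using n0 that by linarith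
        then have "1 < real n * infdist (resolvent_point x) K" using pos by (simp add: field_simps)
        then show ?thesis by (simp add: F_def)
      qed
      then show ?thesis using False by (intro tendsto_eventually eventually_sequentiallyI[of n0]) simp
    qed
    have conv: "(\<lambda>n. \<integral>x. F n (resolvent_point x) \<partial>M') \<longlonglongrightarrow> measure M' {a..b}"
      if M': "sets M' = sets borel" "finite_measure M'" for M'
    proof -
      interpret finite_measure M' by fact
      have "(\<lambda>n. \<integral>x. F n (resolvent_point x) \<partial>M') \<longlonglongrightarrow> (\<integral>x. indicator {a..b} x \<partial>M')"
      proof (rule integral_dominated_convergence[where w = "\<lambda>_. 1"])
        show "indicator {a..b} \<in> borel_measurable M'"
          by (rule borel_measurable_indicator) (simp add: M'(1))
        show "(\<lambda>x. F n (resolvent_point x)) \<in> borel_measurable M'" for n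
          using meas[OF Fc] by (simp add: measurable_cong_sets[OF M'(1) refl])
        show "AE x in M'. (\<lambda>n. F n (resolvent_point x)) \<longlonglongrightarrow> indicator {a..b} x" using lim by simp
        show "AE x in M'. norm (F n (resolvent_point x)) \<le> 1" for n using F01 by simp
      qed simp
      moreover have "space M' = UNIV" using sets_eq_imp_space_eq[OF M'(1)] by simp
      ultimately show ?thesis by simp
    qed
    have "measure M {a..b} = measure N {a..b}"
      using LIMSEQ_unique[OF conv[OF M, unfolded cont_eq[OF Fc]] conv[OF N]] .
    then show ?thesis
      using finite_measure.emeasure_eq_measure[OF M(2)] finite_measure.emeasure_eq_measure[OF N(2)] by simp
  qed simp
  show ?thesis
  proof (rule measure_eqI_generator_eq)
    let ?E = "range (\<lambda>(a, b). {a..b}) :: (real ^ 'd) set set"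
    have "{a..b} \<inter> {c..d} = {(\<chi> i. max (a $ i) (c $ i))..(\<chi> i. min (b $ i) (d $ i))}" for a b c d :: "real ^ 'd"
      by (auto simp: less_eq_vec_def)
    then show "Int_stable ?E" unfolding Int_stable_def by fastforce
    show "?E \<subseteq> Pow UNIV" by simp
    show "emeasure M X = emeasure N X" if "X \<in> ?E" for X using that box by auto
    show "sets M = sigma_sets UNIV ?E" "sets N = sigma_sets UNIV ?E"
      unfolding M(1) N(1) borel_eq_atLeastAtMost by simp_all
    let ?A = "\<lambda>i. {(\<chi> j. - real i)..(\<chi> j. real i)} :: (real ^ 'd) set"
    show "range ?A \<subseteq> ?E" by auto
    show "(\<Union>i. ?A i) = UNIV"
    proof -
      have "\<exists>i. x \<in> ?A i" for x :: "real ^ 'd"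
      proof -
        obtain i where i: "norm x \<le> real i" using real_arch_simple by blast
        have "\<bar>x $ j\<bar> \<le> real i" for j using component_le_norm_cart[of x j] i by linarith
        then show ?thesis by (intro exI[of _ i]) (auto simp: less_eq_vec_def abs_le_iff minus_le_iff)
      qed
      then show ?thesis by auto
    qed
    show "emeasure M (?A i) \<noteq> \<infinity>" for i
      by (simp add: finite_measure.emeasure_eq_measure[OF M(2)])
  qed
qed

text \<open>Petersen's argument: the bounded functions with equal integrals against all polynomials are stable
  under multiplication by a resolvent that is an \<open>L\<^sup>2\<close> limit of polynomials.\<close>

theorem (in psd_sequence) represents_unique:
  assumes M: "represents M s" and N: "represents N s"
    and approx: "\<And>j d. 0 < d \<Longrightarrow> \<exists>c. nm (1 - var_plus j * c) < d"
  shows "M = N"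
proof -
  have sets: "sets M' = sets borel" if "represents M' s" for M'
    using that unfolding represents_def moment_measures_def by (elim conjE CollectE)
  have fin: "finite_measure M'" if "represents M' s" for M'
  proof -
    have "integrable M' (monomial 0)" using that by (simp add: represents_def moment_measures_def)
    moreover have "monomial 0 = (\<lambda>_ :: real ^ 'd. 1 :: real)" by (simp add: fun_eq_iff)
    ultimately have "integrable M' (\<lambda>_. 1 :: real)" by simp
    then show ?thesis by (intro finite_measureI) (simp add: integrable_iff_bounded)
  qed
  have evint: "integrable M' (ev p)" "integral\<^sup>L M' (ev p) = L p" if "represents M' s" for M' p
    using represents_ev[OF that] by auto
  have meas: "f \<in> borel_measurable M' \<longleftrightarrow> f \<in> borel_measurable borel" if "represents M' s" for M' and f :: "real ^ 'd \<Rightarrow> real"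
    unfolding measurable_cong_sets[OF sets[OF that] refl] ..
  have evmeas: "(\<lambda>x. Re (ev p x)) \<in> borel_measurable borel" for p
    by (intro borel_measurable_continuous_onI continuous_intros continuous_on_ev)
  \<comment> \<open>Equality against every polynomial is carried along, since replacing a resolvent
    by an approximating polynomial multiplies the test polynomial by it.\<close>
  define W where "W g \<longleftrightarrow> g \<in> borel_measurable borel \<and> (\<exists>B. \<forall>x. \<bar>g x\<bar> \<le> B) \<and>
     (\<forall>p. (\<integral>x. g x * Re (ev p x) \<partial>M) = (\<integral>x. g x * Re (ev p x) \<partial>N))" for g :: "real ^ 'd \<Rightarrow> real"
  have Wmeas: "g \<in> borel_measurable borel" if "W g" for g
    by (rule that[unfolded W_def, THEN conjunct1])
  have Wbdd: "\<exists>B. \<forall>x. \<bar>g x\<bar> \<le> B" if "W g" for g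
    by (rule that[unfolded W_def, THEN conjunct2, THEN conjunct1])
  have Weq: "(\<integral>x. g x * Re (ev p x) \<partial>M) = (\<integral>x. g x * Re (ev p x) \<partial>N)" if "W g" for g p
    by (rule that[unfolded W_def, THEN conjunct2, THEN conjunct2, THEN spec])
  have evRe: "integrable M' (\<lambda>x. Re (ev p x))" "(\<integral>x. Re (ev p x) \<partial>M') = Re (L p)" if "represents M' s" for M' p
    by (rule integrable_Re[OF evint(1)[OF that]])
       (rule trans[OF integral_Re[OF evint(1)[OF that]] arg_cong[OF evint(2)[OF that], of Re]])
  have Wint: "integrable M' (\<lambda>x. g x * Re (ev p x))"
    if M': "represents M' s" and g: "g \<in> borel_measurable borel" "\<And>x. \<bar>g x\<bar> \<le> B" for M' g B p
  proof (rule Bochner_Integration.integrable_bound)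
    show "integrable M' (\<lambda>x. B * Re (ev p x))" by (intro integrable_mult_right evRe(1)[OF M'])
    show "(\<lambda>x. g x * Re (ev p x)) \<in> borel_measurable M'" unfolding meas[OF M'] by (rule borel_measurable_times[OF g(1) evmeas])
    have "\<bar>g x\<bar> * \<bar>Re (ev p x)\<bar> \<le> \<bar>B\<bar> * \<bar>Re (ev p x)\<bar>" for x
      using g(2)[of x] by (intro mult_right_mono) auto
    then show "AE x in M'. norm (g x * Re (ev p x)) \<le> norm (B * Re (ev p x))" by (simp add: abs_mult)
  qed
  have W1: "W (\<lambda>_. 1)" unfolding W_def
  proof (intro conjI allI)
    show "(\<integral>x. 1 * Re (ev p x) \<partial>M) = (\<integral>x. 1 * Re (ev p x) \<partial>N)" for p
      unfolding mult_1_left evRe(2)[OF M] evRe(2)[OF N] ..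
    show "\<exists>B. \<forall>x :: real ^ 'd. \<bar>1 :: real\<bar> \<le> B" by (rule exI[of _ 1]) simp
  qed simp
  have Wlin: "W (\<lambda>x. a * g x + b * h x)" if Wg: "W g" and Wh: "W h" for a b g h
  proof -
    obtain B where "\<forall>x. \<bar>g x\<bar> \<le> B" using Wbdd[OF Wg] ..
    note B = this[rule_format]
    obtain C where "\<forall>x. \<bar>h x\<bar> \<le> C" using Wbdd[OF Wh] ..
    note C = this[rule_format]
    have gh: "g \<in> borel_measurable borel" "h \<in> borel_measurable borel" by (rule Wmeas[OF Wg], rule Wmeas[OF Wh])
    have eq: "(\<integral>x. g x * Re (ev p x) \<partial>M) = (\<integral>x. g x * Re (ev p x) \<partial>N)"
      "(\<integral>x. h x * Re (ev p x) \<partial>M) = (\<integral>x. h x * Re (ev p x) \<partial>N)" for p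
      by (rule Weq[OF Wg], rule Weq[OF Wh])
    have "\<bar>a * g x + b * h x\<bar> \<le> \<bar>a\<bar> * B + \<bar>b\<bar> * C" for x
    proof -
      have "\<bar>a * g x + b * h x\<bar> \<le> \<bar>a\<bar> * \<bar>g x\<bar> + \<bar>b\<bar> * \<bar>h x\<bar>"
        using abs_triangle_ineq[of "a * g x" "b * h x"] by (simp add: abs_mult)
      also have "\<dots> \<le> \<bar>a\<bar> * B + \<bar>b\<bar> * C" by (intro add_mono mult_left_mono B C) auto
      finally show ?thesis .
    qed
    then have bound: "\<exists>B. \<forall>x. \<bar>a * g x + b * h x\<bar> \<le> B" by blast
    have split: "(\<integral>x. (a * g x + b * h x) * Re (ev p x) \<partial>M') =
        a * (\<integral>x. g x * Re (ev p x) \<partial>M') + b * (\<integral>x. h x * Re (ev p x) \<partial>M')" if "represents M' s" for M' p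
      using Wint[OF that gh(1) B] Wint[OF that gh(2) C] by (simp add: distrib_right mult.assoc)
    show ?thesis unfolding W_def
    proof (intro conjI bound allI)
      show "(\<lambda>x. a * g x + b * h x) \<in> borel_measurable borel" using gh by simp
      show "(\<integral>x. (a * g x + b * h x) * Re (ev p x) \<partial>M) = (\<integral>x. (a * g x + b * h x) * Re (ev p x) \<partial>N)" for p
        unfolding split[OF M] split[OF N] eq ..
    qed
  qed
  have Wsum: "W (\<lambda>x. \<Sum>i\<in>I. g i x)" if "finite I" "\<And>i. i \<in> I \<Longrightarrow> W (g i)" for I and g :: "'d \<Rightarrow> real ^ 'd \<Rightarrow> real"
    using that
  proof (induction I)
    case empty
    then show ?case using Wlin[OF W1 W1, of 0 0] by simp
  next
    case (insert i I)
    then show ?case using Wlin[of "g i" "\<lambda>x. \<Sum>i\<in>I. g i x" 1 1] by simp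
  qed
  have Wres: "W (\<lambda>x. Re (u * (1 / (complex_of_real (x $ j) + \<i>))) * g x)" if g: "W g" and u: "cmod u \<le> 1" for u j g
  proof -
    obtain B where "\<forall>x. \<bar>g x\<bar> \<le> B" using Wbdd[OF g] ..
    note B = this[rule_format]
    have B0: "0 \<le> B" using B[of 0] by linarith
    note gm = Wmeas[OF g]
    let ?v = "\<lambda>x :: real ^ 'd. 1 / (complex_of_real (x $ j) + \<i>)"
    have vb: "\<bar>Re (u * ?v x)\<bar> \<le> 1" for x
    proof -
      have "\<bar>Re (u * ?v x)\<bar> \<le> cmod u * cmod (?v x)" using abs_Re_le_cmod[of "u * ?v x"] by (simp only: norm_mult)
      also have "\<dots> \<le> 1 * 1" by (intro mult_mono u norm_resolvent_le) auto
      finally show ?thesis by simp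
    qed
    let ?I = "\<lambda>M' p. \<integral>x. Re (u * ?v x) * g x * Re (ev p x) \<partial>M'"
    have vm: "(\<lambda>x. Re (u * ?v x)) \<in> borel_measurable borel"
      by (intro borel_measurable_continuous_onI continuous_intros) (simp add: resolvent_denom)
    have bound: "\<bar>Re (u * ?v x) * g x\<bar> \<le> B" for x
      using mult_mono[OF vb B, of x x] by (simp add: abs_mult)
    have meas': "(\<lambda>x. Re (u * ?v x) * g x) \<in> borel_measurable borel" using vm gm by simp
    have "?I M p = ?I N p" for p
    proof -
      define F where "F = Re (L (real_part p * real_part p))"
      have F: "integrable M' (\<lambda>x. (Re (ev p x))\<^sup>2)" "(\<integral>x. (Re (ev p x))\<^sup>2 \<partial>M') = F" if "represents M' s" for M'
      proof -
        have e: "(\<lambda>x. (Re (ev p x))\<^sup>2) = (\<lambda>x. Re (ev (real_part p * real_part p) x))"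
          by (simp add: fun_eq_iff ev_real_part power2_eq_square)
        show "integrable M' (\<lambda>x. (Re (ev p x))\<^sup>2)" "(\<integral>x. (Re (ev p x))\<^sup>2 \<partial>M') = F"
          unfolding F_def
          by (rule iffD2[OF arg_cong[OF e, of "integrable M'"] evRe(1)[OF that]])
             (rule trans[OF arg_cong[OF e, of "integral\<^sup>L M'"] evRe(2)[OF that]])
      qed
      have "0 \<le> (\<integral>x. (Re (ev p x))\<^sup>2 \<partial>M)" by (rule Bochner_Integration.integral_nonneg) simp
      then have F0: "0 \<le> F" unfolding F(2)[OF M] .
      \<comment> \<open>The polynomial \<open>c\<close> approximates the resolvent equally well in
        \<open>L^2(M)\<close> and \<open>L^2(N)\<close>, because squared norms of polynomials are
        determined by \<open>s\<close>.\<close>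
      have close: "\<bar>?I M p - ?I N p\<bar> \<le> B * (d * (F + 1))"
        if d: "d > 0" for d
      proof -
        obtain c where c: "nm (1 - var_plus j * c) < d" using approx[OF d] by blast
        define r where "r = 1 - var_plus j * c"
        define q where "q = real_part (const u * c) * real_part p"
        have q: "Re (ev q x) = Re (u * ev c x) * Re (ev p x)" for x
          by (simp add: q_def ev_real_part)
        have rint: "integrable M' (\<lambda>x. (cmod (ev r x))\<^sup>2)" "(\<integral>x. (cmod (ev r x))\<^sup>2 \<partial>M') = (nm r)\<^sup>2"
          if "represents M' s" for M'
        proof -
          have e: "(\<lambda>x. (cmod (ev r x))\<^sup>2) = (\<lambda>x. Re (ev (r * star r) x))"
            by (simp add: fun_eq_iff complex_mult_cnj cmod_power2)
          have Lr: "Re (L (r * star r)) = (nm r)\<^sup>2" using ip_nm[of r] by (simp add: ip_def)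
          show "integrable M' (\<lambda>x. (cmod (ev r x))\<^sup>2)"
            by (rule iffD2[OF arg_cong[OF e, of "integrable M'"] evRe(1)[OF that]])
          show "(\<integral>x. (cmod (ev r x))\<^sup>2 \<partial>M') = (nm r)\<^sup>2"
            by (rule trans[OF arg_cong[OF e, of "integral\<^sup>L M'"] trans[OF evRe(2)[OF that] Lr]])
        qed
        have diff: "\<bar>Re (u * ?v x) - Re (u * ev c x)\<bar> \<le> cmod (ev r x)" for x
        proof -
          \<comment> \<open>The factor \<open>?v\<close>, of modulus at most 1, turns smallness of
            \<open>1 - (x_j + i) c\<close> into smallness of the difference.\<close>
          have "?v x - ev c x = ev r x * ?v x"
            using resolvent_denom[of "x $ j"] by (simp add: r_def field_simps)
          then have "Re (u * ?v x) - Re (u * ev c x) = Re (u * (ev r x * ?v x))"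
            by (metis minus_complex.sel(1) right_diff_distrib)
          also have "\<bar>\<dots>\<bar> \<le> cmod u * (cmod (ev r x) * cmod (?v x))"
            using abs_Re_le_cmod[of "u * (ev r x * ?v x)"] by (simp only: norm_mult)
          also have "\<dots> \<le> 1 * (cmod (ev r x) * 1)"
            by (intro mult_mono u norm_resolvent_le order_refl) auto
          finally show ?thesis by simp
        qed
        have near: "\<bar>?I M' p - (\<integral>x. g x * Re (ev q x) \<partial>M')\<bar> \<le> B * (d * (F + 1)) / 2"
          if M': "represents M' s" for M'
        proof -
          note i1 = Wint[OF M' meas' bound, of p] and i2 = Wint[OF M' gm B, of q]
          \<comment> \<open>The arithmetic-geometric mean inequality with weight \<open>d\<close>
            takes the place of Cauchy-Schwarz for integrals and balances \<open>nm r < d\<close>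
            against the fixed \<open>F\<close>.\<close>
          have pw: "\<bar>Re (u * ?v x) * g x * Re (ev p x) - g x * Re (ev q x)\<bar> \<le>
              B / 2 * (d * (Re (ev p x))\<^sup>2 + (cmod (ev r x))\<^sup>2 / d)" for x
          proof -
            have "Re (u * ?v x) * g x * Re (ev p x) - g x * Re (ev q x) =
                g x * ((Re (u * ?v x) - Re (u * ev c x)) * Re (ev p x))"
              by (simp add: q algebra_simps)
            also have "\<bar>\<dots>\<bar> \<le> B * (cmod (ev r x) * \<bar>Re (ev p x)\<bar>)"
              unfolding abs_mult by (intro mult_mono B diff order_refl) (use B0 in auto)
            also have "cmod (ev r x) * \<bar>Re (ev p x)\<bar> \<le> (d * (Re (ev p x))\<^sup>2 + (cmod (ev r x))\<^sup>2 / d) / 2"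
            proof -
              have "0 \<le> (d * \<bar>Re (ev p x)\<bar> - cmod (ev r x))\<^sup>2 / d" using d by simp
              also have "\<dots> = d * (Re (ev p x))\<^sup>2 + (cmod (ev r x))\<^sup>2 / d - 2 * (cmod (ev r x) * \<bar>Re (ev p x)\<bar>)"
                using d by (simp add: power2_diff power_mult_distrib field_simps) (simp add: power2_eq_square)
              finally show ?thesis by simp
            qed
            finally show ?thesis using B0 by (simp add: mult_left_mono)
          qed
          have "\<bar>?I M' p - (\<integral>x. g x * Re (ev q x) \<partial>M')\<bar> =
              \<bar>\<integral>x. Re (u * ?v x) * g x * Re (ev p x) - g x * Re (ev q x) \<partial>M'\<bar>"
            using i1 i2 by simp
          also have "\<dots> \<le> (\<integral>x. \<bar>Re (u * ?v x) * g x * Re (ev p x) - g x * Re (ev q x)\<bar> \<partial>M')"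
            by (rule integral_abs_bound)
          also have "\<dots> \<le> (\<integral>x. B / 2 * (d * (Re (ev p x))\<^sup>2 + (cmod (ev r x))\<^sup>2 / d) \<partial>M')"
            by (rule integral_mono) (use i1 i2 F(1)[OF M'] rint(1)[OF M'] pw in auto)
          also have "\<dots> = B / 2 * (d * F + (nm r)\<^sup>2 / d)"
            using F[OF M'] rint[OF M'] by simp
          also have "\<dots> \<le> B / 2 * (d * F + d)"
          proof -
            have "(nm r)\<^sup>2 \<le> d\<^sup>2" using c by (intro power_mono) (auto simp: r_def)
            then have "(nm r)\<^sup>2 / d \<le> d" using d by (simp add: field_simps power2_eq_square)
            then show ?thesis using B0 by (intro mult_left_mono) auto
          qed
          finally show ?thesis by (simp add: algebra_simps)
        qed
        have "(\<integral>x. g x * Re (ev q x) \<partial>M) = (\<integral>x. g x * Re (ev q x) \<partial>N)" by (rule Weq[OF g])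
        then show ?thesis using near[OF M] near[OF N] by linarith
      qed
      have "\<bar>?I M p - ?I N p\<bar> \<le> 0"
      proof (rule field_le_epsilon)
        fix e :: real assume "e > 0"
        define c where "c = (B + 1) * (F + 1)"
        have c: "c > 0" using B0 F0 by (simp add: c_def)
        define d where "d = e / c"
        have d: "d > 0" using \<open>e > 0\<close> c by (simp add: d_def)
        have "B * (d * (F + 1)) \<le> (B + 1) * (d * (F + 1))" using d F0 by (intro mult_right_mono) auto
        also have "\<dots> = d * c" by (simp add: c_def)
        also have "\<dots> = e" using c by (simp add: d_def)
        finally show "\<bar>?I M p - ?I N p\<bar> \<le> 0 + e"
          using close[OF d] by simp
      qed
      then show ?thesis by simp
    qed
    then show ?thesis unfolding W_def by (intro conjI allI exI[of _ B] meas' bound)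
  qed
  have Wpoly: "W (\<lambda>x. P (resolvent_point x) * g x)" if "real_polynomial_function P" "W g" for P g
    using that
  proof (induction P arbitrary: g rule: real_polynomial_function.induct)
    case (linear f)
    let ?t = "\<lambda>j x. f (axis j 1) * (Re (1 * (1 / (complex_of_real (x $ j) + \<i>))) * g x) +
        f (axis j \<i>) * (Re (- \<i> * (1 / (complex_of_real (x $ j) + \<i>))) * g x)"
    have "W (\<lambda>x. \<Sum>j\<in>UNIV. ?t j x)"
      by (intro Wsum Wlin Wres linear) auto
    moreover have "f (resolvent_point x) * g x = (\<Sum>j\<in>UNIV. ?t j x)" for x
      by (subst bounded_linear_resolvent_expand[OF linear(1)])
         (simp only: resolvent_point_def vec_lambda_beta sum_distrib_right distrib_right mult.assoc mult_1_left)
    ultimately show ?case by simp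
  next
    case (const c)
    then show ?case using Wlin[of g g c 0] by simp
  next
    case (add P Q)
    then show ?case using Wlin[OF add.IH(1)[OF add.prems] add.IH(2)[OF add.prems], of 1 1] by (simp add: distrib_right)
  next
    case (mult P Q)
    then show ?case using mult.IH(1)[OF mult.IH(2)[OF mult.prems]] by (simp add: mult.assoc)
  qed
  show ?thesis
  proof (rule measure_eqI_resolvent[OF sets[OF M] fin[OF M] sets[OF N] fin[OF N]])
    fix P :: "complex ^ 'd \<Rightarrow> real" assume "real_polynomial_function P"
    from Wpoly[OF this W1] have "(\<integral>x. P (resolvent_point x) * 1 * Re (ev 1 x) \<partial>M) = (\<integral>x. P (resolvent_point x) * 1 * Re (ev 1 x) \<partial>N)"
      by (rule Weq)
    then show "(\<integral>x. P (resolvent_point x) \<partial>M) = (\<integral>x. P (resolvent_point x) \<partial>N)" by simp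
  qed
qed

theorem theorem23:
  fixes s :: "nat ^ 'd::{finite,linorder} \<Rightarrow> complex"
  assumes "CARD('d) \<ge> 3"
    and "positive_semidefinite s"
    and "\<And>j k. j < Max UNIV \<Longrightarrow> (\<forall>i. i \<noteq> j \<longrightarrow> even (k $ i)) \<Longrightarrow>
           determinate1 (shifted_sum s k (Max UNIV) j)"
    and "\<And>j l. j < l \<Longrightarrow> l < Max UNIV \<Longrightarrow>
           (\<forall>k. (\<forall>i. even (k $ i)) \<longrightarrow> determinate1 (shifted_sum s k l j)) \<or>
           (\<forall>k. (\<forall>i. even (k $ i)) \<longrightarrow> determinate1 (shifted_sum s k j l))"
  shows "moment_sequence s \<and>
         (determinate1 (\<lambda>n. s (axis (Max UNIV) n)) \<longrightarrow> determinate s)"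
proof -
  define e :: 'd where "e = Max UNIV"
  interpret psd_sequence s by standard (rule assms(2))
  have less: "j < e" if "j \<noteq> e" for j
    using that Max_ge[of UNIV j] unfolding e_def by (simp add: le_neq_trans)
  have graph: "graph_dense e j" if "j \<noteq> e" for j
    by (rule determinate_imp_graph_dense[OF that])
       (use assms(3)[of j] less[OF that] in \<open>simp add: e_def\<close>)
  have range: "range_dense j" if "j \<noteq> e" for j
    by (rule graph_dense_imp_range_dense[OF graph[OF that]])
  \<comment> \<open>Both alternatives of the second hypothesis lead here, since the product of the
    two factors does not depend on their order.\<close>
  have double: "\<exists>q. nm (a - var_plus j * (var_plus l * q)) < d"
    if "j < l" "l \<noteq> e" "0 < d" for j l a d
  proof -
    have j: "j \<noteq> e" "j \<noteq> l" using less[OF that(2)] that(1) by auto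
    from assms(4)[OF that(1) less[OF that(2), unfolded e_def]]
    consider "graph_dense l j" | "graph_dense j l"
      using determinate_imp_graph_dense[OF j(2)] determinate_imp_graph_dense[OF j(2)[symmetric]] by blast
    then show ?thesis
    proof cases
      case 1
      from double_range_dense[OF 1 range[OF that(2)] that(3)] show ?thesis by (simp only: mult.left_commute)
    next
      case 2
      from double_range_dense[OF 2 range[OF j(1)] that(3)] show ?thesis .
    qed
  qed
  interpret commuting_resolvents s e
  proof
    show "graph_dense e j" if "j \<noteq> e" for j by (rule graph[OF that])
    show "\<exists>q. nm (a - var_plus j * (var_plus l * q)) < d"
      if "j \<noteq> e" "l \<noteq> e" "j \<noteq> l" "0 < d" for j l a d
    proof (cases "j < l")
      case True
      then show ?thesis using double that by blast
    next
      case False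
      then have "l < j" using that(3) by simp
      from double[OF this that(1,4)] show ?thesis by (simp only: mult.left_commute)
    qed
  qed
  have moment: "moment_sequence s"
    by (rule moment_sequence_if_nonneg[OF nonneg_imp_L_nonneg])
  have "determinate s" if det: "determinate1 (\<lambda>n. s (axis e n))"
  proof -
    \<comment> \<open>For \<open>j = e\<close> determinacy of the last marginal enters, with
      \<open>r = 1\<close>, and conjugation turns \<open>x_e - i\<close> into
      \<open>x_e + i\<close>; for the other indices the range is already dense.\<close>
    have approx: "\<exists>c. nm (1 - var_plus j * c) < d" if d: "0 < d" for j d
    proof (cases "j = e")
      case True
      obtain Q where "nm (1 * (1 - var_minus e * Q)) < d"
        using determinate1_small_element[OF det _ d, of e 1] by (auto simp: var_power)
      then have "nm (star (1 - var_minus e * Q)) < d" unfolding nm_star by simp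
      then show ?thesis using True by auto
    next
      case False
      then show ?thesis using range[OF False] d unfolding range_dense_def by blast
    qed
    have "\<exists>M. represents M s" using moment unfolding moment_sequence_def .
    then show ?thesis unfolding determinate_def
      by (rule ex_ex1I) (rule represents_unique[OF _ _ approx])
  qed
  then show ?thesis using moment unfolding e_def by blast
qed

end
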